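(* Let $k$ be odd and $\ell=\lceil k/2\rceil$. (1) The components of $\mathbf{DCM}_k$ of smallest order are isolated vertices, and there are exactly $\frac{1}{\ell}\binom{4\ell-2}{\ell-1}$ of them. (2) For $k\ge 3$, the components of $\mathbf{DCM}_k$ of second smallest order are stars $K_{1,\ell-1}$ (of order $\ell$), and for $k\ge 5$ there are exactly $(2\ell-1)\cdot 2^{\ell-3}$ of them.
   Context: Let $k\ge 1$ and let $X_{2k}=\{P_1,\dots,P_{2k}\}$ be $2k$ points in convex position in the plane, labeled in clockwise cyclic order; indices are taken modulo $2k$. A matching of $X_{2k}$ means a set of $k$ pairwise non-crossing straight segments (edges) with endpoints in $X_{2k}$ covering every point exactly once; its size is $k$. Two matchings $M,M'$ of $X_{2k}$ are disjoint compatible if they have no common edge and no edge of $M$ crosses an edge of $M'$. $\mathbf{DCM}_k$ is the graph whose vertices are the matchings of $X_{2k}$, two being adjacent iff they are disjoint compatible. The order of a component is its number of vertices. *)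

theory Defs
  imports Complex_Main
begin

text \<open>Points of X_{2k} are labelled 0, ..., 2k-1 in cyclic (clockwise) order.
  A segment is a 2-element set of labels.  Two segments with four distinct
  endpoints cross iff their endpoints interleave along the cyclic order;
  segments sharing an endpoint (points in convex position) do not cross.\<close>

definition crosses :: "nat set \<Rightarrow> nat set \<Rightarrow> bool" where
  "crosses e f \<longleftrightarrow> (\<exists>a b c d. a < b \<and> b < c \<and> c < d \<and>
      ((e = {a, c} \<and> f = {b, d}) \<or> (e = {b, d} \<and> f = {a, c})))"

definition is_segment :: "nat \<Rightarrow> nat set \<Rightarrow> bool" where
  "is_segment k e \<longleftrightarrow> card e = 2 \<and> e \<subseteq> {0..<2*k}"

definition is_matching :: "nat \<Rightarrow> nat set set \<Rightarrow> bool" where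
  "is_matching k M \<longleftrightarrow>
     (\<forall>e\<in>M. is_segment k e) \<and>
     (\<forall>e\<in>M. \<forall>f\<in>M. e \<noteq> f \<longrightarrow> e \<inter> f = {}) \<and>
     (\<forall>p<2*k. \<exists>e\<in>M. p \<in> e) \<and>
     (\<forall>e\<in>M. \<forall>f\<in>M. \<not> crosses e f)"

definition matchings :: "nat \<Rightarrow> nat set set set" where
  "matchings k = {M. is_matching k M}"

definition dcm_adj :: "nat \<Rightarrow> nat set set \<Rightarrow> nat set set \<Rightarrow> bool" where
  "dcm_adj k M M' \<longleftrightarrow> is_matching k M \<and> is_matching k M' \<and> M \<inter> M' = {} \<and>
     (\<forall>e\<in>M. \<forall>f\<in>M'. \<not> crosses e f)"

definition dcm_component :: "nat \<Rightarrow> nat set set \<Rightarrow> nat set set set" where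
  "dcm_component k M = {M'. (dcm_adj k)\<^sup>*\<^sup>* M M'}"

definition dcm_components :: "nat \<Rightarrow> nat set set set set" where
  "dcm_components k = dcm_component k ` matchings k"

definition is_star :: "nat \<Rightarrow> nat set set set \<Rightarrow> nat \<Rightarrow> bool" where
  "is_star k C n \<longleftrightarrow> card C = n + 1 \<and>
     (\<exists>c\<in>C. (\<forall>x\<in>C - {c}. dcm_adj k c x) \<and>
             (\<forall>x\<in>C - {c}. \<forall>y\<in>C - {c}. \<not> dcm_adj k x y))"

end

(* A non-crossing matching of 2k points in convex position is the same as a rooted plane forest
   with k edges, the dual tree of the matching rooted at the outer face.  A neighbour of a matching
   amounts to an orientation of the edges of the dual tree in which no vertex has indegree 1,
   together with a non-crossing partition without singletons of the incoming edges at every vertex.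
   Everything is reduced to inserting four consecutive points, matched either as two adjacent leaf
   edges (state A) or as a pendant path of two edges (state B).  The neighbours of the B-extension
   of f are exactly the A-extensions of the neighbours of f, whereas the A-extension of f has, in
   addition to the B-extensions, the neighbours obtained from those of f with one leaf edge inserted
   by splitting that leaf edge; since every matching of even size has a neighbour, for odd size
   the latter always exist.  Hence, for odd k, a matching is isolated iff its dual tree has a
   perfect matching, and such trees are counted by a Fuss-Catalan recurrence.  Inductively, every
   other component has at least l = (k + 1) / 2 elements, with equality iff it contains a matching
   whose dual tree is a caterpillar with all inner vertices of degree 3; such a matching
   has l - 1 neighbours, each of degree 1. *)

theory Submission
  imports Defs
begin

section \<open>Crossings and matchings\<close>

text \<open>Two obstacles shape the argument. The first: an A-extension with neighbours may extend
  an isolated matching, so the size induction cannot strip just any four-point block. Hence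
  \<open>peel\<close>, which walks within the component to an A-extension of a matching that still
  has a neighbour. From there two edges fewer mean a bound smaller by one, and that one is regained
  from splitting the inserted leaf edge, which yields at least one member outside all extensions. If
  the bound is attained, no admissible base matching may yield two split members; three consecutive
  leaves, which can be paired in two ways, are the main device for producing a second one and
  thereby a contradiction. The second obstacle: rooting the dual tree at point 0 breaks the cyclic
  symmetry. The map \<open>rot\<close> restores it, so that facts about caterpillars need to be
  checked only with the root at an end of the spine, in the form \<open>[lf, lf, t]\<close>, and are
  then carried along rotations.\<close>

lemma crosses_commute: "crosses e f \<longleftrightarrow> crosses f e"
  unfolding crosses_def by metis

lemma crosses_pair:
  assumes "a < c" "b < d"
  shows "crosses {a, c} {b, d} \<longleftrightarrow> a < b \<and> b < c \<and> c < d \<or> b < a \<and> a < d \<and> d < c"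
proof
  assume "crosses {a, c} {b, d}"
  then obtain a' b' c' d' where o: "a' < b'" "b' < c'" "c' < d'"
    and "{a,c} = {a',c'} \<and> {b,d} = {b',d'} \<or> {a,c} = {b',d'} \<and> {b,d} = {a',c'}"
    unfolding crosses_def by blast
  then show "a < b \<and> b < c \<and> c < d \<or> b < a \<and> a < d \<and> d < c"
    using assms o unfolding doubleton_eq_iff by auto
next
  assume "a < b \<and> b < c \<and> c < d \<or> b < a \<and> a < d \<and> d < c"
  then show "crosses {a, c} {b, d}" unfolding crosses_def by blast
qed

lemma crosses_image:
  assumes "strict_mono_on V h" "e \<subseteq> V" "f \<subseteq> V"
  shows "crosses (h ` e) (h ` f) \<longleftrightarrow> crosses e f"
proof
  assume "crosses e f"
  then obtain a b c d where o: "a < b" "b < c" "c < d"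
    and ef: "e = {a,c} \<and> f = {b,d} \<or> e = {b,d} \<and> f = {a,c}"
    unfolding crosses_def by blast
  have "a \<in> V" "b \<in> V" "c \<in> V" "d \<in> V" using assms(2,3) ef by auto
  then have "h a < h b" "h b < h c" "h c < h d"
    using assms(1) o by (auto simp: strict_mono_on_def)
  moreover have "h ` e = {h a, h c} \<and> h ` f = {h b, h d} \<or> h ` e = {h b, h d} \<and> h ` f = {h a, h c}"
    using ef by auto
  ultimately show "crosses (h ` e) (h ` f)" unfolding crosses_def by blast
next
  have inj: "inj_on h V" using assms(1) by (rule strict_mono_on_imp_inj_on)
  have less: "x < y" if "h x < h y" "x \<in> V" "y \<in> V" for x y
    using that assms(1) by (metis linorder_neq_iff order_less_asym strict_mono_onD)
  assume "crosses (h ` e) (h ` f)"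
  then obtain a b c d where o: "a < b" "b < c" "c < d"
    and ef: "h ` e = {a,c} \<and> h ` f = {b,d} \<or> h ` e = {b,d} \<and> h ` f = {a,c}"
    unfolding crosses_def by blast
  have "{a,b,c,d} \<subseteq> h ` V" using ef assms(2,3) by blast
  then obtain a' b' c' d' where V: "a' \<in> V" "b' \<in> V" "c' \<in> V" "d' \<in> V"
    and eq: "a = h a'" "b = h b'" "c = h c'" "d = h d'" by auto
  have "a' < b'" "b' < c'" "c' < d'" using o V less eq by auto
  moreover have "e = {a',c'} \<and> f = {b',d'} \<or> e = {b',d'} \<and> f = {a',c'}"
  proof -
    have "u = w" if "h ` u = h ` w" "u \<subseteq> V" "w \<subseteq> V" for u w
      using inj_on_image_eq_iff[OF inj that(2,3)] that(1) by simp
    moreover have "h ` e = h ` {a',c'} \<and> h ` f = h ` {b',d'} \<or> h ` e = h ` {b',d'} \<and> h ` f = h ` {a',c'}"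
      using ef eq by simp
    moreover have "{a',c'} \<subseteq> V" "{b',d'} \<subseteq> V" using V by auto
    ultimately show ?thesis using assms(2,3) by meson
  qed
  ultimately show "crosses e f" unfolding crosses_def by blast
qed

lemma not_crosses_interval:
  assumes "e \<subseteq> {g..<h}" "f \<inter> {g..<h} = {}"
  shows "\<not> crosses e f" "\<not> crosses f e"
proof -
  show "\<not> crosses e f"
  proof
    assume "crosses e f"
    then obtain a b c d where o: "a < b" "b < c" "c < d"
      and ef: "e = {a,c} \<and> f = {b,d} \<or> e = {b,d} \<and> f = {a,c}"
      unfolding crosses_def by blast
    from ef show False
    proof
      assume "e = {a,c} \<and> f = {b,d}"
      then have "a \<in> {g..<h}" "c \<in> {g..<h}" "b \<notin> {g..<h}" using assms by auto
      then show False using o by auto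
    next
      assume "e = {b,d} \<and> f = {a,c}"
      then have "b \<in> {g..<h}" "d \<in> {g..<h}" "c \<notin> {g..<h}" using assms by auto
      then show False using o by auto
    qed
  qed
  then show "\<not> crosses f e" using crosses_commute by blast
qed

lemma not_crosses_refl: "\<not> crosses e e"
  by (auto simp: crosses_def doubleton_eq_iff)

lemma not_crosses_neighbours: "\<not> crosses {a, Suc a} f" "\<not> crosses f {a, Suc a}"
  by (auto simp: crosses_def doubleton_eq_iff)

text \<open>Over an arbitrary point set \<open>V\<close> instead of \<open>{0..<2*k}\<close>,
  because matchings are restricted to arcs, glued from disjoint arcs and relabelled by monotone
  maps.\<close>

definition ncm :: "nat set \<Rightarrow> nat set set \<Rightarrow> bool" where
  "ncm V M \<longleftrightarrow>
     (\<forall>e\<in>M. card e = 2 \<and> e \<subseteq> V) \<and>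
     (\<forall>e\<in>M. \<forall>f\<in>M. e \<noteq> f \<longrightarrow> e \<inter> f = {}) \<and>
     (\<forall>p\<in>V. \<exists>e\<in>M. p \<in> e) \<and>
     (\<forall>e\<in>M. \<forall>f\<in>M. \<not> crosses e f)"

lemma is_matching_iff_ncm: "is_matching k M \<longleftrightarrow> ncm {0..<2*k} M"
  unfolding is_matching_def ncm_def is_segment_def by auto

lemma ncm_subset: "ncm V M \<Longrightarrow> e \<in> M \<Longrightarrow> e \<subseteq> V"
  by (simp add: ncm_def)

lemma ncm_card: "ncm V M \<Longrightarrow> e \<in> M \<Longrightarrow> card e = 2"
  by (simp add: ncm_def)

lemma ncm_not_crosses: "ncm V M \<Longrightarrow> e \<in> M \<Longrightarrow> f \<in> M \<Longrightarrow> \<not> crosses e f"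
  by (simp add: ncm_def)

lemma ncm_cover: "ncm V M \<Longrightarrow> p \<in> V \<Longrightarrow> \<exists>e\<in>M. p \<in> e"
  by (simp add: ncm_def)

lemma ncm_disjoint:
  assumes "ncm V M" "e \<in> M" "f \<in> M" "x \<in> e" "x \<in> f"
  shows "e = f"
proof -
  have "\<forall>e\<in>M. \<forall>f\<in>M. e \<noteq> f \<longrightarrow> e \<inter> f = {}" using assms(1) by (simp add: ncm_def)
  then show ?thesis using assms(2-5) by blast
qed

lemma ncm_edge:
  assumes "ncm V M" "e \<in> M"
  obtains a b where "e = {a, b}" "a < b" "a \<in> V" "b \<in> V"
proof -
  have e: "card e = 2" "e \<subseteq> V" using assms by (simp_all add: ncm_card ncm_subset)
  then obtain a b where ab: "e = {a,b}" "a \<noteq> b" by (meson card_2_iff)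
  show thesis
  proof (cases "a < b")
    case True
    then show ?thesis using that[of a b] ab e(2) by simp
  next
    case False
    then show ?thesis using that[of b a] ab e(2) by (simp add: insert_commute)
  qed
qed

lemma ncm_unique: "ncm V M \<Longrightarrow> {a, b} \<in> M \<Longrightarrow> {a, c} \<in> M \<Longrightarrow> b = c"
  using ncm_disjoint[of V M "{a, b}" "{a, c}" a] by (auto simp: doubleton_eq_iff)

lemma ncm_partner:
  assumes "ncm V M" "p \<in> V"
  obtains q where "{p, q} \<in> M" "q \<in> V" "q \<noteq> p"
proof -
  obtain e where e: "e \<in> M" "p \<in> e" using ncm_cover[OF assms] by blast
  obtain a b where ab: "e = {a,b}" "a < b" "a \<in> V" "b \<in> V"
    using e(1) by (elim ncm_edge[OF assms(1)])
  then show thesis using e that[of a] that[of b] by (auto simp: insert_commute)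
qed

lemma ncm_restrict:
  assumes "ncm V M" "W \<subseteq> V" "\<And>e. e \<in> M \<Longrightarrow> e \<subseteq> W \<or> e \<inter> W = {}"
  shows "ncm W {e \<in> M. e \<subseteq> W}"
  unfolding ncm_def
proof (intro conjI ballI impI)
  fix p assume p: "p \<in> W"
  then obtain e where "e \<in> M" "p \<in> e" using ncm_cover[OF assms(1)] assms(2) by blast
  then show "\<exists>e\<in>{e \<in> M. e \<subseteq> W}. p \<in> e" using assms(3)[of e] p by blast
next
  fix e f assume "e \<in> {e \<in> M. e \<subseteq> W}" "f \<in> {e \<in> M. e \<subseteq> W}" "e \<noteq> f"
  then show "e \<inter> f = {}" using ncm_disjoint[OF assms(1), of e f] by blast
qed (simp_all add: ncm_card[OF assms(1)] ncm_not_crosses[OF assms(1)])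

lemma ncm_Un:
  assumes "ncm V M" "ncm W N" "V \<inter> W = {}" "\<And>e f. e \<in> M \<Longrightarrow> f \<in> N \<Longrightarrow> \<not> crosses e f"
  shows "ncm (V \<union> W) (M \<union> N)"
  unfolding ncm_def
proof (intro conjI ballI impI)
  fix e assume "e \<in> M \<union> N"
  then show "card e = 2" "e \<subseteq> V \<union> W"
    using ncm_card[OF assms(1)] ncm_card[OF assms(2)] ncm_subset[OF assms(1)] ncm_subset[OF assms(2)]
    by blast+
next
  fix p assume "p \<in> V \<union> W"
  then show "\<exists>e\<in>M \<union> N. p \<in> e" using ncm_cover[OF assms(1)] ncm_cover[OF assms(2)] by blast
next
  fix e f assume ef: "e \<in> M \<union> N" "f \<in> M \<union> N"
  then show "\<not> crosses e f"
    using ncm_not_crosses[OF assms(1)] ncm_not_crosses[OF assms(2)] assms(4) crosses_commute by blast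
  assume "e \<noteq> f"
  show "e \<inter> f = {}"
  proof (rule ccontr)
    assume "e \<inter> f \<noteq> {}"
    then obtain x where x: "x \<in> e" "x \<in> f" by blast
    from ef consider "e \<in> M" "f \<in> M" | "e \<in> N" "f \<in> N" | "e \<in> M" "f \<in> N" | "e \<in> N" "f \<in> M"
      by blast
    then show False
      using ncm_disjoint[OF assms(1) _ _ x] ncm_disjoint[OF assms(2) _ _ x] \<open>e \<noteq> f\<close> x assms(3)
        ncm_subset[OF assms(1)] ncm_subset[OF assms(2)] by cases blast+
  qed
qed

lemma ncm_image:
  assumes "ncm V M" "strict_mono_on V h"
  shows "ncm (h ` V) (image h ` M)"
  unfolding ncm_def
proof (intro conjI ballI impI)
  have inj: "inj_on h V" using assms(2) by (rule strict_mono_on_imp_inj_on)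
  {
    fix e' assume "e' \<in> image h ` M"
    then obtain e where e: "e' = h ` e" "e \<in> M" by blast
    show "card e' = 2" unfolding e(1)
      using card_image[OF inj_on_subset[OF inj ncm_subset[OF assms(1) e(2)]]] ncm_card[OF assms(1) e(2)]
      by simp
    show "e' \<subseteq> h ` V" unfolding e(1) by (intro image_mono ncm_subset[OF assms(1) e(2)])
    fix f' assume "f' \<in> image h ` M"
    then obtain f where f: "f' = h ` f" "f \<in> M" by blast
    show "\<not> crosses e' f'" unfolding e(1) f(1)
      using crosses_image[OF assms(2) ncm_subset[OF assms(1) e(2)] ncm_subset[OF assms(1) f(2)]]
        ncm_not_crosses[OF assms(1) e(2) f(2)] by simp
    assume "e' \<noteq> f'"
    then have "e \<inter> f = {}" using ncm_disjoint[OF assms(1) e(2) f(2)] e(1) f(1) by blast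
    then show "e' \<inter> f' = {}" unfolding e(1) f(1)
      using inj_on_image_Int[OF inj, of e f] ncm_subset[OF assms(1)] e(2) f(2) by simp
  next
    fix p' assume "p' \<in> h ` V"
    then obtain p where p: "p' = h p" "p \<in> V" by blast
    then show "\<exists>e\<in>image h ` M. p' \<in> e" using ncm_cover[OF assms(1) p(2)] by blast
  }
qed

section \<open>Matchings as plane forests\<close>

datatype tree = Node "tree list"

abbreviation lf :: tree where "lf \<equiv> Node []"

fun sz :: "tree list \<Rightarrow> nat" where
  "sz [] = 0"
| "sz (Node ts # us) = Suc (sz ts + sz us)"

text \<open>The points are numbered from \<open>p\<close> on in the order of a walk around the forest that passes every
  edge twice; an edge becomes the segment between its two passages.\<close>

fun mat :: "nat \<Rightarrow> tree list \<Rightarrow> nat set set" where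
  "mat p [] = {}"
| "mat p (Node ts # us) =
     insert {p, p + 1 + 2 * sz ts} (mat (p + 1) ts \<union> mat (p + 2 + 2 * sz ts) us)"

lemma sz_append [simp]: "sz (a @ b) = sz a + sz b"
  by (induction a rule: sz.induct) auto

lemma mat_append: "mat p (a @ b) = mat p a \<union> mat (p + 2 * sz a) b"
  by (induction p a rule: mat.induct) (auto simp: algebra_simps)

lemma sz_eq_0 [simp]: "sz f = 0 \<longleftrightarrow> f = []"
  by (cases f rule: sz.cases) auto

lemma sz_eq_1: "sz f = Suc 0 \<longleftrightarrow> f = [lf]"
  by (cases f rule: sz.cases) auto

lemma mat_subset: "e \<in> mat p f \<Longrightarrow> e \<subseteq> {p..<p + 2 * sz f}"
proof (induction p f rule: mat.induct)
  case (2 p ts us)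
  then show ?case by fastforce
qed simp

lemma mat_bounds: "e \<in> mat p f \<Longrightarrow> x \<in> e \<Longrightarrow> p \<le> x \<and> x < p + 2 * sz f"
  using mat_subset by fastforce

lemma mat_ex_elem: "e \<in> mat p f \<Longrightarrow> \<exists>x. x \<in> e"
  by (induction p f rule: mat.induct) auto

lemma ncm_mat: "ncm {p..<p + 2 * sz f} (mat p f)"
proof (induction p f rule: mat.induct)
  case (1 p)
  show ?case by (simp add: ncm_def)
next
  case (2 p ts us)
  let ?q = "p + 1 + 2 * sz ts"
  have 1: "ncm {p, ?q} {{p, ?q}}"
    using not_crosses_refl by (simp add: ncm_def)
  have "ncm ({p, ?q} \<union> {p+1..<p+1 + 2 * sz ts}) ({{p, ?q}} \<union> mat (p+1) ts)"
  proof (rule ncm_Un[OF 1 "2.IH"(1)])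
    fix e f assume "e \<in> {{p, ?q}}" "f \<in> mat (p+1) ts"
    then have "f \<subseteq> {p+1..<p+1 + 2 * sz ts}" "e \<inter> {p+1..<p+1 + 2 * sz ts} = {}"
      using mat_subset[of f "p+1" ts] by auto
    then show "\<not> crosses e f" by (rule not_crosses_interval)
  qed auto
  then have "ncm (({p, ?q} \<union> {p+1..<p+1 + 2 * sz ts}) \<union> {p+2+2*sz ts..<p+2+2*sz ts + 2 * sz us})
     (({{p, ?q}} \<union> mat (p+1) ts) \<union> mat (p+2+2*sz ts) us)"
  proof (rule ncm_Un[OF _ "2.IH"(2)])
    fix e f assume "e \<in> {{p, ?q}} \<union> mat (p+1) ts" "f \<in> mat (p+2+2*sz ts) us"
    then have "e \<subseteq> {p..<p+2+2*sz ts}" "f \<inter> {p..<p+2+2*sz ts} = {}"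
      using mat_bounds[of e "p+1" ts] mat_bounds[of f "p+2+2*sz ts" us] by force+
    then show "\<not> crosses e f" by (rule not_crosses_interval)
  qed auto
  moreover have "({p, ?q} \<union> {p+1..<p+1 + 2 * sz ts}) \<union> {p+2+2*sz ts..<p+2+2*sz ts + 2 * sz us}
     = {p..<p + 2 * sz (Node ts # us)}" by auto
  ultimately show ?case by simp
qed

text \<open>The partner \<open>q\<close> of the first point cuts the remaining points into two
  intervals, and no edge joins them. They carry the children of the first tree and the remaining
  trees. The parity of \<open>n\<close> is part of the conclusion so that the induction itself
  delivers it.\<close>

lemma ncm_imp_mat:
  assumes "ncm {p..<p + n} M"
  shows "\<exists>f. n = 2 * sz f \<and> M = mat p f"
  using assms
proof (induction n arbitrary: p M rule: less_induct)
  case (less n)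
  show ?case
  proof (cases "n = 0")
    case True
    then have "M = {}" using ncm_subset[OF less.prems] ncm_card[OF less.prems] by fastforce
    then show ?thesis using True by (auto intro: exI[of _ "[]"])
  next
    case False
    then obtain q where q: "{p, q} \<in> M" "q \<in> {p..<p+n}" "q \<noteq> p"
      using ncm_partner[OF less.prems, of p] by auto
    then have pq: "p < q" "q < p + n" by auto
    have less1: "q - p - 1 < n" and less2: "p + n - q - 1 < n" using pq by auto
    let ?V = "{p+1..<p+1 + (q - p - 1)}" and ?W = "{q+1..<q+1 + (p + n - q - 1)}"
    have V: "?V = {p<..<q}" and W: "?W = {q<..<p+n}" using pq by auto
    have part: "e = {p, q} \<or> e \<subseteq> {p<..<q} \<or> e \<subseteq> {q<..<p+n}" if eM: "e \<in> M" for e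
    proof (cases "e = {p,q}")
      case False
      obtain a b where e: "e = {a,b}" "a < b" "a \<in> {p..<p+n}" "b \<in> {p..<p+n}"
        by (rule ncm_edge[OF less.prems eM])
      have "e \<inter> {p,q} = {}" using ncm_disjoint[OF less.prems eM q(1)] False by blast
      moreover have "\<not> crosses {p,q} {a,b}" using ncm_not_crosses[OF less.prems q(1) eM] e(1) by simp
      ultimately have "a \<noteq> q" "b \<noteq> q" "p < a" "\<not> (a < q \<and> q < b)"
        using e pq(1) crosses_pair[OF pq(1) e(2)] by auto
      then show ?thesis using e(2-4) unfolding e(1) by auto
    qed simp
    have "ncm ?V {e \<in> M. e \<subseteq> ?V}"
    proof (rule ncm_restrict[OF less.prems])
      show "?V \<subseteq> {p..<p+n}" using pq by auto
      show "e \<subseteq> ?V \<or> e \<inter> ?V = {}" if "e \<in> M" for e using part[OF that] pq unfolding V by auto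
    qed
    from less.IH[OF less1 this] obtain f1
      where f1: "q - p - 1 = 2 * sz f1" "{e \<in> M. e \<subseteq> ?V} = mat (p+1) f1"
      by blast
    have "ncm ?W {e \<in> M. e \<subseteq> ?W}"
    proof (rule ncm_restrict[OF less.prems])
      show "?W \<subseteq> {p..<p+n}" using pq by auto
      show "e \<subseteq> ?W \<or> e \<inter> ?W = {}" if "e \<in> M" for e using part[OF that] pq unfolding W by auto
    qed
    from less.IH[OF less2 this] obtain f2
      where f2: "p + n - q - 1 = 2 * sz f2" "{e \<in> M. e \<subseteq> ?W} = mat (q+1) f2"
      by blast
    have "M = insert {p,q} ({e \<in> M. e \<subseteq> ?V} \<union> {e \<in> M. e \<subseteq> ?W})"
      using part q(1) unfolding V W by blast
    moreover have "q = p + 1 + 2 * sz f1" using f1(1) pq by simp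
    ultimately have "M = mat p (Node f1 # f2)" unfolding f1(2) f2(2) by simp
    moreover have "n = 2 * sz (Node f1 # f2)" using f1(1) f2(1) pq by auto
    ultimately show ?thesis by blast
  qed
qed

text \<open>The partner of the first point reveals the size of the first tree; its child forest and
  the remaining forest are then recovered as the segments within two known intervals.\<close>

lemma mat_inj: "mat p f = mat p h \<Longrightarrow> f = h"
proof (induction f arbitrary: p h rule: sz.induct)
  case 1
  then show ?case by (cases h rule: sz.cases) auto
next
  case (2 ts us)
  from "2.prems" obtain ts' us' where h: "h = Node ts' # us'"
    by (cases h rule: sz.cases) auto
  have "{p, p + 1 + 2 * sz ts} \<in> mat p h" using "2.prems" by (metis insertI1 mat.simps(2))
  moreover have "{p, p + 1 + 2 * sz ts'} \<in> mat p h" using h by simp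
  ultimately have "p + 1 + 2 * sz ts = p + 1 + 2 * sz ts'" using ncm_unique[OF ncm_mat] by blast
  then have s: "sz ts' = sz ts" by simp
  \<comment> \<open>The covered points determine the total size, and with it the size of the
    remaining forest.\<close>
  have "\<Union> (mat p f) = {p..<p + 2 * sz f}" for f
    using ncm_subset[OF ncm_mat[of p f]] ncm_cover[OF ncm_mat[of p f]] by blast
  then have "{p..<p + 2 * sz (Node ts # us)} = {p..<p + 2 * sz h}"
    using "2.prems" by metis
  from arg_cong[OF this, of card] have su: "sz us' = sz us" using s h by simp
  have 1: "mat (p+1) xs = {e \<in> mat p (Node xs # ys). e \<subseteq> {p+1..<p+1+2*sz xs}}" for xs ys
  proof -
    have "\<not> e \<subseteq> {p+1..<p+1+2*sz xs}" if "e \<in> mat (p+2+2*sz xs) ys" for e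
      using mat_ex_elem[OF that] mat_bounds[OF that] by fastforce
    then show ?thesis using mat_subset[of _ "p+1" xs] by auto
  qed
  have 2: "mat (p+2+2*sz xs) ys = {e \<in> mat p (Node xs # ys). e \<subseteq> {p+2+2*sz xs..<p+2+2*sz xs+2*sz ys}}"
    for xs ys
  proof -
    have "\<not> e \<subseteq> {p+2+2*sz xs..<p+2+2*sz xs+2*sz ys}" if "e \<in> mat (p+1) xs" for e
      using mat_ex_elem[OF that] mat_bounds[OF that] by fastforce
    then show ?thesis using mat_subset[of _ "p+2+2*sz xs" ys] by auto
  qed
  have "mat (p+1) ts = mat (p+1) ts'" using "2.prems" unfolding 1[of ts us] 1[of ts' us'] h s by simp
  moreover have "mat (p+2+2*sz ts) us = mat (p+2+2*sz ts) us'"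
    using "2.prems" 2[of ts us] 2[of ts' us'] su unfolding h s by simp
  ultimately show ?case using "2.IH" h by blast
qed

lemma mat_shift: "mat (p + d) f = image (\<lambda>q. q + d) ` mat p f"
proof (induction p f rule: mat.induct)
  case (2 p ts us)
  show ?case using 2
    by (simp add: image_Un algebra_simps)
qed simp

lemma bij_betw_mat: "bij_betw (mat 0) {f. sz f = k} (matchings k)"
  unfolding bij_betw_def
proof
  show "inj_on (mat 0) {f. sz f = k}" by (auto intro: inj_onI dest: mat_inj)
  show "mat 0 ` {f. sz f = k} = matchings k"
  proof (intro equalityI subsetI)
    fix M assume "M \<in> mat 0 ` {f. sz f = k}"
    then show "M \<in> matchings k"
      using ncm_mat[of 0] by (auto simp: matchings_def is_matching_iff_ncm)
  next
    fix M assume "M \<in> matchings k"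
    then have "ncm {0..<0 + 2*k} M" by (simp add: matchings_def is_matching_iff_ncm)
    from ncm_imp_mat[OF this] show "M \<in> mat 0 ` {f. sz f = k}" by auto
  qed
qed

lemma finite_sz: "finite {f. sz f = k}"
proof -
  have "matchings k \<subseteq> Pow (Pow {0..<2*k})"
    by (auto simp: matchings_def is_matching_def is_segment_def)
  then have "finite (matchings k)" by (rule finite_subset) simp_all
  then show ?thesis using bij_betw_finite[OF bij_betw_mat] by blast
qed

section \<open>Inserting a block of consecutive points\<close>

text \<open>Inserts \<open>x\<close> between the points \<open>g - 1\<close> and \<open>g\<close>; meaningful for \<open>g \<le> 2 * sz f\<close> only.\<close>

fun ins :: "nat \<Rightarrow> tree list \<Rightarrow> tree list \<Rightarrow> tree list" where
  "ins g x [] = x"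
| "ins g x (Node ts # us) =
     (if g = 0 then x @ Node ts # us
      else if g \<le> 1 + 2 * sz ts then Node (ins (g - 1) x ts) # us
      else Node ts # ins (g - 2 - 2 * sz ts) x us)"

lemma sz_ins [simp]: "sz (ins g x f) = sz f + sz x"
  by (induction g x f rule: ins.induct) auto

definition sh :: "nat \<Rightarrow> nat \<Rightarrow> nat \<Rightarrow> nat" where
  "sh g s q = (if q < g then q else q + s)"

lemma strict_mono_sh: "strict_mono (sh g s)"
  by (auto simp: strict_mono_def sh_def)

lemma sh_notin: "sh g s q \<notin> {g..<g + s}"
  by (auto simp: sh_def)

lemma inj_image: "inj h \<Longrightarrow> inj (image h)"
  by (rule injI) (simp add: inj_image_eq_iff)

lemma image_image_cong:
  assumes "\<And>e x. e \<in> A \<Longrightarrow> x \<in> e \<Longrightarrow> h x = k x"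
  shows "image h ` A = image k ` A"
  by (intro image_cong refl) (use assms in auto)

lemma image_sh_low:
  assumes "p + 2 * sz f \<le> g"
  shows "image (sh g s) ` mat p f = mat p f"
proof -
  have "image (sh g s) ` mat p f = image (\<lambda>x. x) ` mat p f"
  proof (rule image_image_cong)
    fix e x assume "e \<in> mat p f" "x \<in> e"
    from mat_bounds[OF this] show "sh g s x = x" using assms by (simp add: sh_def)
  qed
  then show ?thesis by simp
qed

lemma image_sh_high:
  assumes "g \<le> p"
  shows "image (sh g s) ` mat p f = mat (p + s) f"
  unfolding mat_shift
proof (rule image_image_cong)
  fix e x assume "e \<in> mat p f" "x \<in> e"
  from mat_bounds[OF this] show "sh g s x = x + s" using assms by (simp add: sh_def)
qed

text \<open>Translates the recursion on forests into segments: the old segments make room by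
  \<open>sh\<close>, and the block is added untouched. The injectivity and commutation laws of
  \<open>ins\<close> follow from this identity and \<open>mat_inj\<close>.\<close>

lemma mat_ins:
  assumes "g \<le> 2 * sz f"
  shows "mat p (ins g x f) = image (sh (p + g) (2 * sz x)) ` mat p f \<union> mat (p + g) x"
  using assms
proof (induction f arbitrary: g p rule: sz.induct)
  case 1
  then show ?case by simp
next
  case (2 ts us)
  consider "g = 0" | "0 < g" "g \<le> 1 + 2 * sz ts" | "1 + 2 * sz ts < g" by linarith
  then show ?case
  proof cases
    case 1
    then show ?thesis
      using image_sh_high[of p p "2 * sz x" "Node ts # us"]
      by (simp add: mat_append Un_commute del: mat.simps)
  next
    case 2
    then obtain g' where g: "g = Suc g'" "g' \<le> 2 * sz ts" by (cases g) auto
    have 1: "mat (Suc p) (ins g' x ts) = image (sh (p + g) (2 * sz x)) ` mat (Suc p) ts \<union> mat (p + g) x"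
      using "2.IH"(1)[OF g(2), of "Suc p"] g(1) by simp
    have 2: "image (sh (p + g) (2 * sz x)) ` mat (p + 2 + 2 * sz ts) us = mat (p + 2 + 2 * sz ts + 2 * sz x) us"
      by (rule image_sh_high) (use g in simp)
    have 3: "sh (p + g) (2 * sz x) ` {p, p + 1 + 2 * sz ts} = {p, p + 1 + 2 * sz ts + 2 * sz x}"
      using g by (simp add: sh_def insert_commute)
    have "mat p (ins g x (Node ts # us)) = insert {p, p + 1 + 2 * sz ts + 2 * sz x}
        (mat (Suc p) (ins g' x ts) \<union> mat (p + 2 + 2 * sz ts + 2 * sz x) us)"
      using g by (simp add: algebra_simps)
    also have "\<dots> = image (sh (p + g) (2 * sz x)) ` mat p (Node ts # us) \<union> mat (p + g) x"
      unfolding mat.simps image_insert[of "image (sh (p + g) (2 * sz x))"] image_Un 1 2 3 by auto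
    finally show ?thesis .
  next
    case 3
    define g' where "g' = g - 2 - 2 * sz ts"
    have g: "g = 2 + 2 * sz ts + g'" "g' \<le> 2 * sz us" using 3 "2.prems" by (auto simp: g'_def)
    have 1: "mat (p + 2 + 2 * sz ts) (ins g' x us)
       = image (sh (p + g) (2 * sz x)) ` mat (p + 2 + 2 * sz ts) us \<union> mat (p + g) x"
      using "2.IH"(2)[OF g(2), of "p + 2 + 2 * sz ts"] g(1) by (simp add: algebra_simps)
    have 2: "image (sh (p + g) (2 * sz x)) ` mat (p + 1) ts = mat (p + 1) ts"
      by (rule image_sh_low) (use g in simp)
    have 3: "sh (p + g) (2 * sz x) ` {p, p + 1 + 2 * sz ts} = {p, p + 1 + 2 * sz ts}"
      using g by (simp add: sh_def)
    have "ins g x (Node ts # us) = Node ts # ins g' x us" using g by simp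
    then have "mat p (ins g x (Node ts # us)) = insert {p, p + 1 + 2 * sz ts}
        (mat (p + 1) ts \<union> mat (p + 2 + 2 * sz ts) (ins g' x us))"
      by simp
    also have "\<dots> = image (sh (p + g) (2 * sz x)) ` mat p (Node ts # us) \<union> mat (p + g) x"
      unfolding mat.simps image_insert[of "image (sh (p + g) (2 * sz x))"] image_Un 1 2 3 by auto
    finally show ?thesis .
  qed
qed

lemma mat_ins_0: "g \<le> 2 * sz f \<Longrightarrow> mat 0 (ins g x f) = image (sh g (2 * sz x)) ` mat 0 f \<union> mat g x"
  using mat_ins[of g f 0 x] by simp

lemma mat_ins_inside:
  assumes "g \<le> 2 * sz f"
  shows "{e \<in> mat 0 (ins g x f). e \<subseteq> {g..<g + 2 * sz x}} = mat g x"
proof -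
  have "\<not> sh g (2 * sz x) ` e \<subseteq> {g..<g + 2 * sz x}" if "e \<in> mat 0 f" for e
    using mat_ex_elem[OF that] sh_notin[of g "2 * sz x"] by blast
  then show ?thesis unfolding mat_ins_0[OF assms] using mat_subset[of _ g x] by blast
qed

lemma mat_ins_outside:
  assumes "g \<le> 2 * sz f"
  shows "{e \<in> mat 0 (ins g x f). e \<inter> {g..<g + 2 * sz x} = {}} = image (sh g (2 * sz x)) ` mat 0 f"
proof -
  have "e \<inter> {g..<g + 2 * sz x} \<noteq> {}" if "e \<in> mat g x" for e
    using mat_ex_elem[OF that] mat_subset[OF that] by blast
  moreover have "sh g (2 * sz x) ` e \<inter> {g..<g + 2 * sz x} = {}" for e
    using sh_notin[of g "2 * sz x"] by blast
  ultimately show ?thesis unfolding mat_ins_0[OF assms] by blast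
qed

lemma ins_inj:
  assumes "ins g x f = ins g y h" "sz x = sz y" "g \<le> 2 * sz f"
  shows "f = h \<and> x = y"
proof
  have "sz f = sz h" using arg_cong[OF assms(1), of sz] assms(2) by simp
  then have gh: "g \<le> 2 * sz h" using assms(3) by simp
  show "x = y"
    using mat_ins_inside[OF assms(3), of x] mat_ins_inside[OF gh, of y] assms(1,2) mat_inj[of g x y]
    by simp
  have "image (sh g (2 * sz x)) ` mat 0 f = image (sh g (2 * sz x)) ` mat 0 h"
    using mat_ins_outside[OF assms(3), of x] mat_ins_outside[OF gh, of y] assms(1,2) by simp
  moreover have "inj (image (sh g (2 * sz x)))"
    by (intro inj_image strict_mono_imp_inj_on strict_mono_sh)
  ultimately have "mat 0 f = mat 0 h" by (simp add: inj_image_eq_iff)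
  then show "f = h" by (rule mat_inj)
qed

lemma ins_0 [simp]: "ins 0 x f = x @ f"
  by (cases f rule: sz.cases) auto

lemma ins_append_right: "ins (2 * sz a + g) x (a @ b) = a @ ins g x b"
  by (induction a rule: sz.induct) auto

lemma ins_append_left: "g \<le> 2 * sz a \<Longrightarrow> ins g x (a @ b) = ins g x a @ b"
proof (induction a arbitrary: g rule: sz.induct)
  case (2 ts us)
  then show ?case by simp
qed simp

lemma image_image_image: "image h ` (image k ` A) = image (\<lambda>x. h (k x)) ` A"
  by (simp add: image_image)

text \<open>After \<open>x\<close> has been inserted at the earlier gap, the later gap
  \<open>h\<close> has moved by the \<open>2 * sz x\<close> new points.\<close>

lemma ins_ins_comm:
  assumes "g \<le> h" "h \<le> 2 * sz f"
  shows "ins g x (ins h y f) = ins (h + 2 * sz x) y (ins g x f)"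
proof (rule mat_inj)
  have "image (\<lambda>q. sh g (2 * sz x) (sh h (2 * sz y) q)) ` mat 0 f
      = image (\<lambda>q. sh (h + 2 * sz x) (2 * sz y) (sh g (2 * sz x) q)) ` mat 0 f"
    by (rule image_image_cong) (use assms in \<open>auto simp: sh_def\<close>)
  moreover have "image (sh (h + 2 * sz x) (2 * sz y)) ` mat g x = mat g x"
    by (rule image_sh_low) (use assms in simp)
  moreover have "image (sh g (2 * sz x)) ` mat h y = mat (h + 2 * sz x) y"
    by (rule image_sh_high) (use assms in simp)
  ultimately show "mat 0 (ins g x (ins h y f)) = mat 0 (ins (h + 2 * sz x) y (ins g x f))"
    using assms by (simp add: mat_ins_0 image_Un image_image_image Un_commute Un_left_commute)
qed

lemma ins_ins_nested:
  assumes "h \<le> 2 * sz x" "g \<le> 2 * sz f"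
  shows "ins g (ins h y x) f = ins (g + h) y (ins g x f)"
proof (rule mat_inj)
  have "image (\<lambda>q. sh (g + h) (2 * sz y) (sh g (2 * sz x) q)) ` mat 0 f
      = image (sh g (2 * sz x + 2 * sz y)) ` mat 0 f"
    by (rule image_image_cong) (use assms in \<open>auto simp: sh_def\<close>)
  then show "mat 0 (ins g (ins h y x) f) = mat 0 (ins (g + h) y (ins g x f))"
    using assms by (simp add: mat_ins_0 mat_ins image_Un image_image_image Un_commute Un_left_commute)
qed

text \<open>The converse of \<open>mat_ins\<close>: since \<open>mat g x\<close> already covers its
  interval, no other segment of \<open>z\<close> touches that interval, and it can be cut
  out.\<close>

lemma ins_split:
  assumes "mat g x \<subseteq> mat 0 z" "g + 2 * sz x \<le> 2 * sz z"
  obtains f where "g \<le> 2 * sz f" "z = ins g x f"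
proof -
  let ?s = "2 * sz x"
  let ?I = "{g..<g + ?s}" and ?W = "{0..<2 * sz z} - {g..<g + ?s}"
  \<comment> \<open>Closes the gap; off the block it is undone by \<open>sh g ?s\<close>.\<close>
  let ?u = "\<lambda>q. if q < g then q else q - ?s"
  have nz: "ncm {0..<2 * sz z} (mat 0 z)" using ncm_mat[of 0 z] by simp
  have part: "e \<in> mat g x \<or> e \<inter> ?I = {}" if "e \<in> mat 0 z" for e
  proof (rule ccontr)
    assume a: "\<not> ?thesis"
    then obtain p where "p \<in> e" "p \<in> ?I" by blast
    moreover obtain e' where "e' \<in> mat g x" "p \<in> e'" using ncm_cover[OF ncm_mat \<open>p \<in> ?I\<close>] by blast
    ultimately have "e = e'" using ncm_disjoint[OF nz that] assms(1) by blast
    then show False using a \<open>e' \<in> mat g x\<close> by blast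
  qed
  let ?M = "{e \<in> mat 0 z. e \<subseteq> ?W}"
  have M: "ncm ?W ?M"
  proof (rule ncm_restrict[OF nz])
    fix e assume e: "e \<in> mat 0 z"
    show "e \<subseteq> ?W \<or> e \<inter> ?W = {}"
      using part[OF e] mat_subset[OF e] mat_subset[of e g x] by auto
  qed blast
  have "ncm (?u ` ?W) (image ?u ` ?M)"
    by (rule ncm_image[OF M]) (auto simp: strict_mono_on_def)
  moreover have "?u ` ?W = {0..<0 + (2 * sz z - ?s)}"
  proof (intro equalityI subsetI)
    fix q assume "q \<in> {0..<0 + (2 * sz z - ?s)}"
    then have "q = ?u (sh g ?s q)" "sh g ?s q \<in> ?W" using assms(2) by (auto simp: sh_def)
    then show "q \<in> ?u ` ?W" by (rule image_eqI)
  qed (use assms(2) in auto)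
  ultimately obtain f where f: "2 * sz z - ?s = 2 * sz f" "image ?u ` ?M = mat 0 f"
    using ncm_imp_mat[of 0 "2 * sz z - ?s" "image ?u ` ?M"] by auto
  have gf: "g \<le> 2 * sz f" using f(1) assms(2) by simp
  have "image (sh g ?s) ` (image ?u ` ?M) = image (\<lambda>x. x) ` ?M"
    unfolding image_image_image by (rule image_image_cong) (auto simp: sh_def)
  moreover have "?M \<union> mat g x = mat 0 z"
    using part mat_subset[of _ 0 z] assms(1) by auto
  ultimately have "mat 0 (ins g x f) = mat 0 z"
    unfolding mat_ins_0[OF gf] f(2)[symmetric] by simp
  then show thesis using that[OF gf] mat_inj by blast
qed

section \<open>Disjoint compatibility\<close>

definition compat :: "nat set set \<Rightarrow> nat set set \<Rightarrow> bool" where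
  "compat A B \<longleftrightarrow> A \<inter> B = {} \<and> (\<forall>e\<in>A. \<forall>f\<in>B. \<not> crosses e f)"

lemma compat_sym: "compat A B \<longleftrightarrow> compat B A"
  unfolding compat_def by (metis Int_commute crosses_commute)

lemma compat_image:
  assumes "strict_mono h"
  shows "compat (image h ` A) (image h ` B) \<longleftrightarrow> compat A B"
proof -
  have "inj (image h)" by (intro inj_image strict_mono_imp_inj_on assms)
  then have "image h ` A \<inter> image h ` B = image h ` (A \<inter> B)" by (simp add: image_Int)
  moreover have "crosses (h ` e) (h ` f) \<longleftrightarrow> crosses e f" for e f
    using crosses_image[of UNIV h e f] assms by simp
  ultimately show ?thesis by (simp add: compat_def)
qed

text \<open>A segment inside an arc and a segment avoiding it can neither cross nor coincide, so
  only pairs of the same kind matter.\<close>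

lemma compat_interval:
  assumes "\<And>e. e \<in> A \<union> B \<Longrightarrow> e \<inter> {g..<h} = {}" "\<And>e. e \<in> X \<union> Y \<Longrightarrow> e \<subseteq> {g..<h} \<and> e \<noteq> {}"
  shows "compat (A \<union> X) (B \<union> Y) \<longleftrightarrow> compat A B \<and> compat X Y"
proof -
  have "\<not> crosses e f" if "e \<in> A" "f \<in> Y" for e f
    using not_crosses_interval(2)[of f g h e] assms that by simp
  moreover have "\<not> crosses e f" if "e \<in> X" "f \<in> B" for e f
    using not_crosses_interval(1)[of e g h f] assms that by simp
  moreover have "e \<notin> X \<union> Y" if "e \<in> A \<union> B" for e
    using assms(1)[OF that] assms(2)[of e] by blast
  then have "A \<inter> Y = {}" "X \<inter> B = {}" by auto
  ultimately show ?thesis unfolding compat_def by (simp add: Int_Un_distrib Int_Un_distrib2 ball_Un) blast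
qed

definition adj :: "tree list \<Rightarrow> tree list \<Rightarrow> bool" where
  "adj f h \<longleftrightarrow> sz f = sz h \<and> compat (mat 0 f) (mat 0 h)"

lemma adj_sz: "adj f h \<Longrightarrow> sz h = sz f"
  by (simp add: adj_def)

lemma adj_sym: "adj f h \<longleftrightarrow> adj h f"
  unfolding adj_def using compat_sym by auto

lemma adj_irrefl: "f \<noteq> [] \<Longrightarrow> \<not> adj f f"
  by (cases f rule: sz.cases) (auto simp: adj_def compat_def)

lemma dcm_adj_mat: "sz f = k \<Longrightarrow> sz h = k \<Longrightarrow> dcm_adj k (mat 0 f) (mat 0 h) \<longleftrightarrow> adj f h"
  using bij_betw_apply[OF bij_betw_mat, of f k] bij_betw_apply[OF bij_betw_mat, of h k]
  by (simp add: dcm_adj_def adj_def compat_def matchings_def)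

text \<open>The main source of neighbours: at a common gap the inner blocks and the outer forests
  can be exchanged independently of each other.\<close>

lemma adj_ins:
  assumes "sz f = sz h" "sz x = sz y" "g \<le> 2 * sz f"
  shows "adj (ins g x f) (ins g y h) \<longleftrightarrow> adj f h \<and> adj x y"
proof -
  have gh: "g \<le> 2 * sz h" using assms by simp
  have "compat (mat 0 (ins g x f)) (mat 0 (ins g y h)) \<longleftrightarrow>
    compat (image (sh g (2 * sz x)) ` mat 0 f) (image (sh g (2 * sz x)) ` mat 0 h) \<and> compat (mat g x) (mat g y)"
    unfolding mat_ins_0[OF assms(3)] mat_ins_0[OF gh] assms(2)[symmetric]
  proof (rule compat_interval)
    fix e assume "e \<in> image (sh g (2 * sz x)) ` mat 0 f \<union> image (sh g (2 * sz x)) ` mat 0 h"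
    then show "e \<inter> {g..<g + 2 * sz x} = {}" using sh_notin[of g "2 * sz x"] by blast
  next
    fix e assume "e \<in> mat g x \<union> mat g y"
    then show "e \<subseteq> {g..<g + 2 * sz x} \<and> e \<noteq> {}"
      using mat_subset[of e g x] mat_subset[of e g y] mat_ex_elem[of e g x] mat_ex_elem[of e g y] assms(2)
      by auto
  qed
  moreover have "compat (mat g x) (mat g y) \<longleftrightarrow> compat (mat 0 x) (mat 0 y)"
    using compat_image[of "\<lambda>q. q + g"] mat_shift[of 0 g] by (simp add: strict_mono_def)
  ultimately show ?thesis using assms compat_image[OF strict_mono_sh] by (auto simp: adj_def)
qed

lemma adj_append: "sz a = sz c \<Longrightarrow> sz b = sz d \<Longrightarrow> adj (a @ b) (c @ d) \<longleftrightarrow> adj b d \<and> adj a c"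
  using adj_ins[of b d a c 0] by simp

text \<open>A forest with at least two edges contains a smaller forest with at least two edges, or
  begins with \<open>Node [lf]\<close>, or equals \<open>[lf, lf]\<close>; hence the search for a
  block always ends.\<close>

lemma ins_cases:
  assumes "2 \<le> sz f"
  obtains g h where "g \<le> 2 * sz h" "f = ins g [lf, lf] h"
    | g h where "g \<le> 2 * sz h" "f = ins g [Node [lf]] h"
proof -
  have "\<exists>g h. g \<le> 2 * sz h \<and> (f = ins g [lf, lf] h \<or> f = ins g [Node [lf]] h)"
    using assms
  proof (induction f rule: sz.induct)
    case (2 ts us)
    consider "2 \<le> sz ts" | "sz ts = 1" | "sz ts = 0" "2 \<le> sz us" | "sz ts = 0" "sz us = 1"
      using "2.prems" by fastforce
    then show ?case
    proof cases
      case 1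
      then obtain g h where gh: "g \<le> 2 * sz h" "ts = ins g [lf, lf] h \<or> ts = ins g [Node [lf]] h"
        using "2.IH"(1) by blast
      then show ?thesis
        by (intro exI[of _ "Suc g"] exI[of _ "Node h # us"]) auto
    next
      case 2
      then have "ts = [lf]" by (simp add: sz_eq_1)
      then show ?thesis by (intro exI[of _ 0] exI[of _ us]) simp
    next
      case 3
      then obtain g h where gh: "g \<le> 2 * sz h" "us = ins g [lf, lf] h \<or> us = ins g [Node [lf]] h"
        using "2.IH"(2) by blast
      then show ?thesis using 3
        by (intro exI[of _ "Suc (Suc g)"] exI[of _ "lf # h"]) auto
    next
      case 4
      then have "ts = []" "us = [lf]" by (simp_all add: sz_eq_1)
      then show ?thesis by (intro exI[of _ 0] exI[of _ "[]"]) simp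
    qed
  qed simp
  then show thesis using that by blast
qed

lemma adj_lf_lf: "adj [lf, lf] [Node [lf]]"
  by (simp add: adj_def compat_def crosses_pair doubleton_eq_iff numeral_eq_Suc)

lemma adj_lf_lf_lf: "adj [lf, lf, lf] [Node [lf, lf]]"
  by (simp add: adj_def compat_def crosses_pair doubleton_eq_iff numeral_eq_Suc)

lemma adj_Nil: "adj [] h \<longleftrightarrow> h = []"
  by (cases h rule: sz.cases) (auto simp: adj_def compat_def)

section \<open>Degrees, and the neighbours of the two extensions\<close>

definition nbrs :: "tree list \<Rightarrow> tree list set" where
  "nbrs f = {h. adj f h}"

definition deg :: "tree list \<Rightarrow> nat" where
  "deg f = card (nbrs f)"

lemma finite_nbrs [simp]: "finite (nbrs f)"
  by (rule finite_subset[OF _ finite_sz[of "sz f"]]) (auto simp: nbrs_def adj_sz)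

lemma deg_pos_iff: "0 < deg f \<longleftrightarrow> (\<exists>h. adj f h)"
  using finite_nbrs[of f] by (auto simp: deg_def card_gt_0_iff nbrs_def)

lemma deg_eq_0_iff: "deg f = 0 \<longleftrightarrow> (\<forall>h. \<not> adj f h)"
  using deg_pos_iff[of f] by auto

lemma adj_partner:
  assumes "adj f z" "p < 2 * sz f"
  obtains q where "{p, q} \<in> mat 0 z" "q < 2 * sz f" "q \<noteq> p" "{p, q} \<notin> mat 0 f"
proof -
  have z: "ncm {0..<2 * sz z} (mat 0 z)" using ncm_mat[of 0 z] by simp
  obtain q where q: "{p, q} \<in> mat 0 z" "q \<in> {0..<2 * sz z}" "q \<noteq> p"
    using ncm_partner[OF z, of p] assms adj_sz[OF assms(1)] by auto
  moreover have "{p, q} \<notin> mat 0 f" using assms(1) q(1) by (auto simp: adj_def compat_def)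
  ultimately show thesis using that adj_sz[OF assms(1)] by auto
qed

lemma not_crosses_nested:
  assumes "\<not> crosses {a, b} {p, q}" "a < p" "p < b"
  shows "a \<le> q \<and> q \<le> b"
proof (rule ccontr)
  assume "\<not> (a \<le> q \<and> q \<le> b)"
  then consider "q < a" | "b < q" by linarith
  then show False
  proof cases
    case 1
    then show False using assms crosses_pair[of a b q p] by (simp add: insert_commute)
  next
    case 2
    then show False using assms crosses_pair[of a b p q] by simp
  qed
qed

lemma adj_nested:
  assumes "adj f z" "{a, b} \<in> mat 0 f" "{p, q} \<in> mat 0 z" "a < p" "p < b"
  shows "a \<le> q \<and> q \<le> b"
  using assms not_crosses_nested[of a b p q] by (auto simp: adj_def compat_def)

lemma mat_nested:
  assumes "{a, b} \<in> mat p f" "{c, d} \<in> mat p f" "a < c" "c < b"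
  shows "a < d \<and> d < b"
proof -
  have "\<not> crosses {a,b} {c,d}" using ncm_not_crosses[OF ncm_mat] assms by blast
  from not_crosses_nested[OF this] assms have "a \<le> d \<and> d \<le> b" by blast
  moreover have "d \<noteq> a" using ncm_unique[OF ncm_mat, of a b p f c] assms by (auto simp: insert_commute)
  moreover have "d \<noteq> b" using ncm_unique[OF ncm_mat, of b a p f c] assms by (auto simp: insert_commute)
  ultimately show ?thesis by auto
qed

text \<open>The segment from \<open>g\<close> to \<open>g + 3\<close> forces the partners of
  \<open>g + 1\<close> and \<open>g + 2\<close> in \<open>z\<close> into these four points, and they
  may not be joined to each other. The only assignment without a crossing or a shared endpoint joins
  them to \<open>g\<close> and \<open>g + 3\<close>; that block is then cut out of
  \<open>z\<close>.\<close>

lemma adj_ins_B: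
  assumes "g \<le> 2 * sz f" "adj (ins g [Node [lf]] f) z"
  obtains h where "adj f h" "z = ins g [lf, lf] h"
proof -
  let ?M = "mat 0 (ins g [Node [lf]] f)" and ?Z = "mat 0 z"
  have sz: "sz z = sz f + 2" using adj_sz[OF assms(2)] by simp
  have out: "{g, g + 3} \<in> ?M" and inn: "{g + 1, g + 2} \<in> ?M"
    using mat_ins_0[OF assms(1), of "[Node [lf]]"] by (simp_all add: numeral_eq_Suc)
  have Z: "ncm {0..<0 + 2 * sz z} ?Z" by (rule ncm_mat)
  obtain q where q: "{g + 1, q} \<in> ?Z" "q \<noteq> g + 1" "{g + 1, q} \<notin> ?M"
    by (rule adj_partner[OF assms(2), of "g + 1"]) (use assms(1) in auto)
  have "g \<le> q \<and> q \<le> g + 3" using adj_nested[OF assms(2) out q(1)] by simp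
  moreover have "q \<noteq> g + 2" using q inn by auto
  ultimately have q': "q = g \<or> q = g + 3" using q(2) by auto
  obtain r where r: "{g + 2, r} \<in> ?Z" "r \<noteq> g + 2" "{g + 2, r} \<notin> ?M"
    by (rule adj_partner[OF assms(2), of "g + 2"]) (use assms(1) in auto)
  have "g \<le> r \<and> r \<le> g + 3" using adj_nested[OF assms(2) out r(1)] by simp
  moreover have "r \<noteq> g + 1" using r inn by (auto simp: insert_commute)
  ultimately have r': "r = g \<or> r = g + 3" using r(2) by auto
  have "q = g"
  proof (rule ccontr)
    assume "q \<noteq> g"
    then have "q = g + 3" using q' by blast
    then show False using mat_nested[OF q(1) r(1)] r' by auto
  qed
  moreover have "r = g + 3"
  proof (rule ccontr)
    assume "r \<noteq> g + 3"
    then have "{g, g + 2} \<in> ?Z" "{g, g + 1} \<in> ?Z" using r' r(1) q(1) \<open>q = g\<close> by (auto simp: insert_commute)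
    then show False using ncm_unique[OF Z, of g "g+2" "g+1"] by simp
  qed
  ultimately have "mat g [lf, lf] \<subseteq> mat 0 z" using q(1) r(1) by (simp add: insert_commute numeral_eq_Suc)
  then obtain h where h: "g \<le> 2 * sz h" "z = ins g [lf, lf] h"
    using ins_split[of g "[lf, lf]" z] sz assms(1) by auto
  have "adj f h" using assms h adj_ins[of f h "[Node [lf]]" "[lf, lf]" g] sz by simp
  then show thesis using that h by blast
qed

lemma nbrs_ins_B:
  assumes "g \<le> 2 * sz f"
  shows "nbrs (ins g [Node [lf]] f) = ins g [lf, lf] ` nbrs f"
proof (intro equalityI subsetI)
  fix z assume "z \<in> nbrs (ins g [Node [lf]] f)"
  then show "z \<in> ins g [lf, lf] ` nbrs f"
    using adj_ins_B[OF assms, of z] by (auto simp: nbrs_def)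
next
  fix z assume "z \<in> ins g [lf, lf] ` nbrs f"
  then obtain h where h: "adj f h" "z = ins g [lf, lf] h" by (auto simp: nbrs_def)
  then have "adj (ins g [Node [lf]] f) z"
    using adj_ins[of f h "[Node [lf]]" "[lf, lf]" g] assms adj_sz[OF h(1)] adj_lf_lf adj_sym by auto
  then show "z \<in> nbrs (ins g [Node [lf]] f)" by (simp add: nbrs_def)
qed

lemma inj_on_ins: "g \<le> 2 * n \<Longrightarrow> inj_on (ins g x) {f. sz f = n}"
proof (rule inj_onI)
  fix f h assume "g \<le> 2 * n" "f \<in> {f. sz f = n}" "h \<in> {f. sz f = n}" "ins g x f = ins g x h"
  then show "f = h" using ins_inj[of g x f x h] by simp
qed

lemma nbrs_subset: "nbrs f \<subseteq> {h. sz h = sz f}"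
  by (auto simp: nbrs_def adj_sz)

lemma deg_ins_B:
  assumes "g \<le> 2 * sz f"
  shows "deg (ins g [Node [lf]] f) = deg f"
  unfolding deg_def nbrs_ins_B[OF assms]
  by (rule card_image) (rule inj_on_subset[OF inj_on_ins[OF assms] nbrs_subset])

text \<open>Two new points are placed between the ends of the leaf edge at \<open>g\<close>. The
  forest uses them to turn that edge into two neighbouring short edges, whereas \<open>z\<close>
  joins the new points to each other. Segments between consecutive points cross nothing.\<close>

lemma adj_split:
  assumes "g \<le> 2 * sz f" "adj (ins g [lf] f) z"
  shows "adj (ins g [lf, lf] f) (ins (Suc g) [lf] z)"
proof -
  let ?h = "sh (Suc g) 2"
  let ?A = "image (sh g 2) ` mat 0 f"
  have szz: "sz z = Suc (sz f)" using adj_sz[OF assms(2)] by simp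
  have c: "compat (?A \<union> {{g, Suc g}}) (mat 0 z)"
    using assms mat_ins_0[OF assms(1), of "[lf]"] by (simp add: adj_def)
  have "compat ?A (mat 0 z)" using c by (auto simp: compat_def)
  then have c': "compat (image ?h ` ?A) (image ?h ` mat 0 z)" using compat_image[OF strict_mono_sh] by blast
  have "image ?h ` ?A = image (sh g 4) ` mat 0 f"
    unfolding image_image_image by (rule image_image_cong) (auto simp: sh_def)
  then have M: "mat 0 (ins g [lf, lf] f) = image ?h ` ?A \<union> {{g, Suc g}, {g + 2, Suc (g + 2)}}"
    using mat_ins_0[OF assms(1), of "[lf, lf]"] by (simp add: numeral_eq_Suc)
  have Z: "mat 0 (ins (Suc g) [lf] z) = image ?h ` mat 0 z \<union> {{Suc g, Suc (Suc g)}}"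
    using mat_ins_0[of "Suc g" z "[lf]"] szz assms(1) by (simp add: numeral_eq_Suc)
  \<comment> \<open>The shift skips exactly the two new points, so no shifted segment equals a new
    one.\<close>
  have n: "Suc g \<notin> ?h ` e" "g + 2 \<notin> ?h ` e" for e
    by (auto simp: sh_def split: if_splits)
  have "compat (image ?h ` ?A \<union> {{g, Suc g}, {g + 2, Suc (g + 2)}})
     (image ?h ` mat 0 z \<union> {{Suc g, Suc (Suc g)}})"
    unfolding compat_def
  proof
    have "{g, Suc g} \<notin> image ?h ` B" "{g + 2, Suc (g + 2)} \<notin> image ?h ` B"
      "{Suc g, Suc (Suc g)} \<notin> image ?h ` B" for B
      using n by (metis (no_types, lifting) image_iff insertI1 insertI2)+
    moreover have "image ?h ` ?A \<inter> image ?h ` mat 0 z = {}" using c' by (simp add: compat_def)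
    moreover have "{Suc g, Suc (Suc g)} \<notin> {{g, Suc g}, {g + 2, Suc (g + 2)}}"
      by (simp add: doubleton_eq_iff)
    moreover have "(A \<union> {y, z}) \<inter> (B \<union> {x}) = {}"
      if "A \<inter> B = {}" "y \<notin> B" "z \<notin> B" "x \<notin> A" "x \<notin> {y, z}" for A B and x y z :: "nat set"
      using that by blast
    ultimately show "(image ?h ` ?A \<union> {{g, Suc g}, {g + 2, Suc (g + 2)}}) \<inter>
      (image ?h ` mat 0 z \<union> {{Suc g, Suc (Suc g)}}) = {}"
      by presburger
    show "\<forall>e\<in>image ?h ` ?A \<union> {{g, Suc g}, {g + 2, Suc (g + 2)}}.
        \<forall>f\<in>image ?h ` mat 0 z \<union> {{Suc g, Suc (Suc g)}}. \<not> crosses e f"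
    proof (intro ballI)
      fix e f assume "e \<in> image ?h ` ?A \<union> {{g, Suc g}, {g + 2, Suc (g + 2)}}"
        "f \<in> image ?h ` mat 0 z \<union> {{Suc g, Suc (Suc g)}}"
      then consider "\<exists>a. e = {a, Suc a}" | "\<exists>a. f = {a, Suc a}"
        | "e \<in> image ?h ` ?A" "f \<in> image ?h ` mat 0 z" by blast
      then show "\<not> crosses e f"
      proof cases
        case 3
        then show ?thesis using c' unfolding compat_def by blast
      qed (auto simp: not_crosses_neighbours)
    qed
  qed
  then show ?thesis using M Z szz by (simp add: adj_def)
qed

text \<open>The new segment \<open>{Suc g, Suc (Suc g)}\<close> blocks \<open>{g, Suc g}\<close>,
  which an A-extension contains. A B-extension contains \<open>{g, g + 3}\<close>, which before the
  split would be \<open>{g, Suc g}\<close>, and \<open>z\<close> may not share that leaf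
  edge.\<close>

lemma split_not_ins:
  assumes "g \<le> 2 * sz f" "adj (ins g [lf] f) z"
  shows "ins (Suc g) [lf] z \<noteq> ins g [lf, lf] h" "ins (Suc g) [lf] z \<noteq> ins g [Node [lf]] h"
proof -
  have szz: "sz z = Suc (sz f)" using adj_sz[OF assms(2)] by simp
  have Z: "mat 0 (ins (Suc g) [lf] z) = image (sh (Suc g) 2) ` mat 0 z \<union> {{Suc g, Suc (Suc g)}}"
    using mat_ins_0[of "Suc g" z "[lf]"] szz assms(1) by (simp add: numeral_eq_Suc)
  have nz: "{g, Suc g} \<notin> mat 0 z"
    using assms mat_ins_0[OF assms(1), of "[lf]"] by (auto simp: adj_def compat_def)
  show "ins (Suc g) [lf] z \<noteq> ins g [lf, lf] h"
  proof
    assume eq: "ins (Suc g) [lf] z = ins g [lf, lf] h"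
    have "sz h = sz f" using arg_cong[OF eq, of sz] szz by simp
    then have "{g, Suc g} \<in> mat 0 (ins (Suc g) [lf] z)"
      using mat_ins_0[of g h "[lf, lf]"] assms(1) unfolding eq by simp
    moreover have "{Suc g, Suc (Suc g)} \<in> mat 0 (ins (Suc g) [lf] z)" unfolding Z by simp
    ultimately show False 
      using ncm_unique[OF ncm_mat, of "Suc g" g 0 "ins (Suc g) [lf] z" "Suc (Suc g)"]
      by (simp add: insert_commute)
  qed
  show "ins (Suc g) [lf] z \<noteq> ins g [Node [lf]] h"
  proof
    assume eq: "ins (Suc g) [lf] z = ins g [Node [lf]] h"
    have "sz h = sz f" using arg_cong[OF eq, of sz] szz by simp
    then have "{g, g + 3} \<in> mat 0 (ins (Suc g) [lf] z)"
      using mat_ins_0[of g h "[Node [lf]]"] assms(1) unfolding eq by (simp add: numeral_eq_Suc)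
    then have "{g, g + 3} \<in> image (sh (Suc g) 2) ` mat 0 z" unfolding Z by (auto simp: doubleton_eq_iff)
    moreover have "sh (Suc g) 2 ` {g, Suc g} = {g, g + 3}" by (auto simp: sh_def)
    moreover have "inj (image (sh (Suc g) 2))" by (intro inj_image strict_mono_imp_inj_on strict_mono_sh)
    ultimately show False using nz inj_image_mem_iff by metis
  qed
qed

text \<open>B-extensions of neighbours of \<open>f\<close> and splittings of neighbours of
  \<open>ins g [lf] f\<close> are two disjoint families of neighbours. An inequality is enough,
  since it is used only to bound degrees from below.\<close>

lemma deg_ins_A:
  assumes "g \<le> 2 * sz f"
  shows "deg f + deg (ins g [lf] f) \<le> deg (ins g [lf, lf] f)"
proof -
  let ?B = "ins g [Node [lf]] ` nbrs f" and ?E = "ins (Suc g) [lf] ` nbrs (ins g [lf] f)"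
  have "?B \<subseteq> nbrs (ins g [lf, lf] f)"
  proof
    fix z assume "z \<in> ?B"
    then obtain h where h: "adj f h" "z = ins g [Node [lf]] h" by (auto simp: nbrs_def)
    then show "z \<in> nbrs (ins g [lf, lf] f)"
      using adj_ins[of f h "[lf, lf]" "[Node [lf]]" g] assms adj_sz[OF h(1)] adj_lf_lf by (simp add: nbrs_def)
  qed
  moreover have "?E \<subseteq> nbrs (ins g [lf, lf] f)" using adj_split[OF assms] by (auto simp: nbrs_def)
  moreover have "?B \<inter> ?E = {}"
  proof -
    have False if z: "z \<in> ?B" "z \<in> ?E" for z
    proof -
      obtain h y where "z = ins g [Node [lf]] h" "z = ins (Suc g) [lf] y" "adj (ins g [lf] f) y"
        using z unfolding nbrs_def by blast
      then show False using split_not_ins(2)[OF assms, of y h] by simp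
    qed
    then show ?thesis by blast
  qed
  moreover have "card ?B = deg f" unfolding deg_def
    by (rule card_image) (rule inj_on_subset[OF inj_on_ins[OF assms] nbrs_subset])
  moreover have "card ?E = deg (ins g [lf] f)" unfolding deg_def
    by (rule card_image, rule inj_on_subset[OF inj_on_ins nbrs_subset]) (use assms in simp)
  ultimately show ?thesis
    using card_mono[of "nbrs (ins g [lf, lf] f)" "?B \<union> ?E"] card_Un_disjoint[of ?B ?E]
    by (simp add: deg_def)
qed

text \<open>Blocks of four points are removed until nothing is left, and each block passes on a
  neighbour in either state. The start is the empty matching, which is compatible with
  itself.\<close>

lemma deg_pos_even:
  assumes "even (sz f)"
  shows "0 < deg f"
  using assms
proof (induction "sz f" arbitrary: f rule: less_induct)
  case less
  show ?case
  proof (cases "sz f = 0")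
    case True
    then show ?thesis by (simp add: deg_pos_iff adj_Nil)
  next
    case False
    then have "2 \<le> sz f" using less.prems by presburger
    then show ?thesis
    proof (cases rule: ins_cases)
      case (1 g h)
      then have "0 < deg h" using less by simp
      then show ?thesis using deg_ins_A[OF 1(1)] 1(2) by simp
    next
      case (2 g h)
      then have "0 < deg h" using less by simp
      then show ?thesis using deg_ins_B[OF 2(1)] 2(2) by simp
    qed
  qed
qed

lemma deg_pos_ins_A:
  assumes "g \<le> 2 * sz f" "odd (sz f)"
  shows "0 < deg (ins g [lf, lf] f)"
  using deg_ins_A[OF assms(1)] deg_pos_even[of "ins g [lf] f"] assms(2) by simp

section \<open>Cyclic relabelling of the points\<close>

text \<open>On matchings, \<open>rot\<close> moves the first point to the end.\<close>

fun rot :: "tree list \<Rightarrow> tree list" where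
  "rot [] = []"
| "rot (Node a # b) = a @ [Node b]"

lemma sz_rot [simp]: "sz (rot f) = sz f"
  by (cases f rule: rot.cases) auto

lemma rot_inj: "rot f = rot h \<Longrightarrow> f = h"
  by (cases f rule: rot.cases; cases h rule: rot.cases) auto

definition shc :: "nat \<Rightarrow> nat \<Rightarrow> nat" where
  "shc n q = (if q = 0 then n - 1 else q - 1)"

lemma mat_rot: "mat 0 (rot f) = image (shc (2 * sz f)) ` mat 0 f"
proof (cases f rule: rot.cases)
  case (2 a b)
  have low: "image (shc (2 * sz f)) ` mat (Suc p) h = mat p h" for p h
  proof -
    have "image (shc (2 * sz f)) ` mat (Suc p) h = image (\<lambda>x. x) ` mat p h"
      unfolding mat_shift[of p 1 h, simplified] image_image_image
      by (rule image_image_cong) (auto simp: shc_def)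
    then show ?thesis by simp
  qed
  have "shc (2 * sz f) ` {0, 0 + 1 + 2 * sz a} = {2 * sz a, 2 * sz a + 1 + 2 * sz b}"
    using 2 by (auto simp: shc_def)
  then have "image (shc (2 * sz f)) ` mat 0 f
      = insert {2 * sz a, 2 * sz a + 1 + 2 * sz b} (mat 0 a \<union> mat (2 * sz a + 1) b)"
    unfolding 2 mat.simps image_insert[of "image (shc (2 * sz (Node a # b)))"] image_Un
    using low[of 0 a] low[of "2 * sz a + 1" b] 2 by simp
  then show ?thesis using 2 by (simp add: mat_append)
qed simp

text \<open>Crossing is defined by the linear order but depends only on the cyclic one. Only a
  segment containing 0 changes its place in the order; away from 0 the map \<open>shc n\<close> is
  increasing.\<close>

lemma crosses_shc:
  assumes "e \<subseteq> {0..<n}" "f \<subseteq> {0..<n}"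
  shows "crosses (shc n ` e) (shc n ` f) \<longleftrightarrow> crosses e f"
proof -
  have *: "crosses (shc n ` e) (shc n ` f)" if ef: "crosses e f" "e \<subseteq> {0..<n}" "f \<subseteq> {0..<n}" "0 \<in> e" for e f
  proof -
    obtain a b c d where o: "a < b" "b < c" "c < d"
      and x: "e = {a,c} \<and> f = {b,d} \<or> e = {b,d} \<and> f = {a,c}"
      using ef(1) unfolding crosses_def by blast
    then have *: "e = {a,c}" "f = {b,d}" "a = 0" using ef(4) by auto
    have "d < n" using ef(3) * by auto
    then have "crosses {c - 1, n - 1} {b - 1, d - 1}"
      using o by (subst crosses_pair) auto
    moreover have "shc n ` e = {c - 1, n - 1}" "shc n ` f = {b - 1, d - 1}"
      using o * by (auto simp: shc_def)
    ultimately show ?thesis by simp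
  qed
  have **: "\<not> crosses (shc n ` e) (shc n ` f)" if ef: "\<not> crosses e f" "e \<subseteq> {0..<n}" "f \<subseteq> {0..<n}" "0 \<in> e" for e f
  proof
    assume "crosses (shc n ` e) (shc n ` f)"
    then obtain a b c d where o: "a < b" "b < c" "c < d"
      and x: "shc n ` e = {a,c} \<and> shc n ` f = {b,d} \<or> shc n ` e = {b,d} \<and> shc n ` f = {a,c}"
      unfolding crosses_def by blast
    have inj: "inj_on (shc n) {0..<n}" by (auto simp: inj_on_def shc_def split: if_splits)
    have n: "n - 1 \<in> shc n ` e" using ef(4) by (auto simp: shc_def intro: rev_image_eqI)
    have dn: "x \<le> n - 1" if xs: "x \<in> shc n ` e \<union> shc n ` f" for x
    proof -
      obtain q where "q \<in> e \<union> f" "x = shc n q" using xs by blast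
      moreover have "q < n" using ef(2,3) \<open>q \<in> e \<union> f\<close> by (meson UnE atLeastLessThan_iff subsetD)
      ultimately show ?thesis unfolding shc_def by (auto intro: diff_le_mono)
    qed
    have "d \<in> shc n ` e \<union> shc n ` f" using x by (elim disjE) simp_all
    from dn[OF this] have d: "d \<le> n - 1" .
    then have "n - 1 \<notin> {a, c}" "n - 1 \<noteq> b" using o by simp_all
    then have x': "shc n ` e = {b,d}" "shc n ` f = {a,c}" "d = n - 1"
      using x n by (elim disjE; simp)+
    have eq: "shc n ` e = shc n ` {b + 1, 0}" "shc n ` f = shc n ` {a + 1, c + 1}"
      using x' by (auto simp: shc_def)
    have sub: "{b + 1, 0} \<subseteq> {0..<n}" "{a + 1, c + 1} \<subseteq> {0..<n}" using o x'(3) by auto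
    have "e = {b + 1, 0}" "f = {a + 1, c + 1}"
      using inj_on_image_eq_iff[OF inj ef(2) sub(1)] inj_on_image_eq_iff[OF inj ef(3) sub(2)] eq by blast+
    then have "e = {0, b + 1}" "f = {a + 1, c + 1}" by (simp_all add: insert_commute)
    then have "crosses e f" using o by (simp add: crosses_pair)
    then show False using ef(1) by blast
  qed
  consider "0 \<in> e" | "0 \<in> f" | "0 \<notin> e" "0 \<notin> f" by blast
  then show ?thesis
  proof cases
    case 1
    then show ?thesis using *[of e f] **[of e f] assms by blast
  next
    case 2
    then show ?thesis using *[of f e] **[of f e] assms crosses_commute by metis
  next
    case 3
    show ?thesis
      by (rule crosses_image[of "{0<..}"]) (use 3 in \<open>auto simp: strict_mono_on_def shc_def subset_eq intro!: gr0I\<close>)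
  qed
qed

lemma adj_rot [simp]: "adj (rot f) (rot h) \<longleftrightarrow> adj f h"
proof (cases "sz f = sz h")
  case True
  let ?n = "2 * sz f"
  have inj: "inj_on (shc ?n) {0..<?n}" by (auto simp: inj_on_def shc_def split: if_splits)
  have sf: "e \<subseteq> {0..<?n}" if "e \<in> mat 0 f" for e using mat_subset[OF that] by simp
  have sh: "e \<subseteq> {0..<?n}" if "e \<in> mat 0 h" for e using mat_subset[OF that] True by simp
  have "image (shc ?n) ` mat 0 f \<inter> image (shc ?n) ` mat 0 h = image (shc ?n) ` (mat 0 f \<inter> mat 0 h)"
    by (rule inj_on_image_Int[of _ "Pow {0..<?n}", symmetric])
      (use inj sf sh in \<open>auto simp: inj_on_image_eq_iff intro: inj_onI\<close>)
  moreover have "crosses (shc ?n ` e) (shc ?n ` e') \<longleftrightarrow> crosses e e'" if "e \<in> mat 0 f" "e' \<in> mat 0 h" for e e'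
    by (rule crosses_shc) (use sf sh that in auto)
  ultimately show ?thesis
    using True by (simp add: adj_def mat_rot compat_def)
qed (simp add: adj_def)

section \<open>Rotation\<close>

lemma rot_surj: "\<exists>f. rot f = h"
proof (cases h rule: rev_cases)
  case Nil
  then show ?thesis by (intro exI[of _ "[]"]) simp
next
  case (snoc a t)
  then show ?thesis by (cases t) (intro exI[of _ "Node a # b" for b], simp)
qed

lemma nbrs_rot: "nbrs (rot f) = rot ` nbrs f"
proof (intro equalityI subsetI)
  fix z assume z: "z \<in> nbrs (rot f)"
  obtain h where "z = rot h" using rot_surj by metis
  then show "z \<in> rot ` nbrs f" using z by (simp add: nbrs_def)
qed (auto simp: nbrs_def)

lemma deg_rot [simp]: "deg (rot f) = deg f"
  unfolding deg_def nbrs_rot by (rule card_image) (rule inj_onI, rule rot_inj)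

lemma funpow_rot_append: "(rot ^^ (2 * sz a)) (a @ b) = b @ a"
proof (induction a arbitrary: b rule: sz.induct)
  case (2 ts us)
  \<comment> \<open>One rotation opens the first edge, \<open>2 * sz ts\<close> carry its children
    past the rest, one more closes it at the end, and \<open>2 * sz us\<close> move the remaining
    trees.\<close>
  have "(rot ^^ (2 * sz us + (1 + (2 * sz ts + 1)))) ((Node ts # us) @ b) = b @ Node ts # us"
    unfolding funpow_add o_apply using "2.IH"(1)[of "[Node (us @ b)]"] "2.IH"(2)[of "b @ [Node ts]"]
    by simp
  moreover have "2 * sz us + (1 + (2 * sz ts + 1)) = 2 * sz (Node ts # us)" by simp
  ultimately show ?case by metis
qed simp

definition rot_equiv :: "tree list \<Rightarrow> tree list \<Rightarrow> bool" where
  "rot_equiv f h \<longleftrightarrow> (\<exists>j. (rot ^^ j) f = h)"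

lemma rot_equiv_refl [simp]: "rot_equiv f f"
  unfolding rot_equiv_def by (rule exI[of _ 0]) simp

lemma rot_equiv_trans [trans]: "rot_equiv f h \<Longrightarrow> rot_equiv h k \<Longrightarrow> rot_equiv f k"
  unfolding rot_equiv_def by (metis funpow_add o_apply)

lemma rot_equiv_rot: "rot_equiv f (rot f)"
  unfolding rot_equiv_def by (rule exI[of _ 1]) simp

lemma rot_equiv_Node: "rot_equiv (Node a # b) (a @ [Node b])"
  using rot_equiv_rot[of "Node a # b"] by simp

lemma rot_equiv_append: "rot_equiv (a @ b) (b @ a)"
  unfolding rot_equiv_def using funpow_rot_append by blast

text \<open>Since \<open>2 * sz f\<close> rotations are the identity, all but one of them undo a
  rotation; this makes \<open>rot_equiv\<close> symmetric.\<close>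

lemma rot_rot_equiv: "rot_equiv (rot f) f"
proof (cases f rule: rot.cases)
  case (2 a b)
  have "(rot ^^ Suc (2 * sz f - 1)) f = f"
    using funpow_rot_append[of f "[]"] 2 by simp
  then show ?thesis unfolding rot_equiv_def funpow_Suc_right by auto
qed simp

lemma rot_equiv_sym: "rot_equiv f h \<Longrightarrow> rot_equiv h f"
proof -
  assume "rot_equiv f h"
  then obtain j where "(rot ^^ j) f = h" by (auto simp: rot_equiv_def)
  then show ?thesis
  proof (induction j arbitrary: h)
    case (Suc j)
    then show ?case using rot_equiv_trans[OF rot_rot_equiv] by auto
  qed simp
qed

lemma rot_equiv_induct [consumes 1, case_names refl rot]:
  assumes "rot_equiv f h" "P h" "\<And>f. P (rot f) \<Longrightarrow> P f"
  shows "P f"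
proof -
  obtain j where "(rot ^^ j) f = h" using assms(1) by (auto simp: rot_equiv_def)
  then show ?thesis
  proof (induction j arbitrary: f)
    case (Suc j)
    then show ?case using assms(3) by (simp add: funpow_Suc_right del: funpow.simps)
  qed (use assms(2) in simp)
qed

lemma deg_rot_equiv: "rot_equiv f h \<Longrightarrow> deg f = deg h"
  by (induction rule: rot_equiv_induct) auto

lemma sz_rot_equiv: "rot_equiv f h \<Longrightarrow> sz f = sz h"
  by (induction rule: rot_equiv_induct) auto

lemma ins_end: "ins (2 * sz b) x b = b @ x"
  using ins_append_right[of b 0 x "[]"] by simp

lemma ins_Cons_cases:
  assumes "g \<le> 2 * sz (Node a # b)"
  obtains "g = 0"
    | g' where "g = Suc g'" "g' \<le> 2 * sz a" "\<And>x. ins g x (Node a # b) = Node (ins g' x a) # b"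
    | g' where "g = 2 + 2 * sz a + g'" "g' \<le> 2 * sz b" "\<And>x. ins g x (Node a # b) = Node a # ins g' x b"
proof -
  consider "g = 0" | "0 < g" "g \<le> 1 + 2 * sz a" | "1 + 2 * sz a < g" by linarith
  then show thesis
  proof cases
    case 2
    then show ?thesis using that(2)[of "g - 1"] by simp
  next
    case 3
    then show ?thesis using that(3)[of "g - 2 - 2 * sz a"] assms by simp
  qed (use that(1) in blast)
qed

text \<open>A rotation lowers every gap by one. Gap 0 is cyclically the same as gap
  \<open>2 * sz f\<close>, both lying between the last and the first point, and so becomes
  \<open>2 * sz f - 1\<close>.\<close>

lemma rot_equiv_ins_rot:
  assumes "f \<noteq> []" "g \<le> 2 * sz f"
  shows "rot_equiv (ins g x f) (ins (if g = 0 then 2 * sz f - 1 else g - 1) x (rot f))"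
proof -
  obtain a b where f: "f = Node a # b" using assms(1) by (cases f rule: sz.cases) auto
  from assms(2)[unfolded f] show ?thesis
  proof (cases rule: ins_Cons_cases)
    case 1
    have "ins (2 * sz f - 1) x (rot f) = a @ [Node (b @ x)]"
      using ins_append_right[of a "1 + 2 * sz b" x "[Node b]"] f by (simp add: ins_end)
    moreover have "rot_equiv (x @ f) (f @ x)" by (rule rot_equiv_append)
    moreover have "rot_equiv (f @ x) (a @ [Node (b @ x)])" using rot_equiv_Node[of a "b @ x"] f by simp
    ultimately show ?thesis using 1 rot_equiv_trans by simp
  next
    case (2 g')
    then have "ins g' x (rot f) = ins g' x a @ [Node b]" using f by (simp add: ins_append_left)
    then show ?thesis using 2 f rot_equiv_Node[of "ins g' x a" b] by simp
  next
    case (3 g')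
    then have "ins (g - 1) x (rot f) = a @ [Node (ins g' x b)]"
      using ins_append_right[of a "1 + g'" x "[Node b]"] f by simp
    then show ?thesis using 3 f rot_equiv_Node[of a "ins g' x b"] by simp
  qed
qed

text \<open>Three consecutive leaves contain two overlapping pairs. With \<open>z\<close> a
  neighbour of the forest that keeps one of the leaves, replacing the first or the last pair by a
  pendant path gives two different neighbours. Oddness makes the forest with one leaf even, so that
  \<open>z\<close> exists.\<close>

lemma deg_three:
  assumes "odd (sz f)" "g \<le> 2 * sz f"
  shows "2 \<le> deg (ins g [lf, lf, lf] f)"
proof -
  let ?f = "ins g [lf] f"
  obtain z where z: "adj ?f z" using deg_pos_even[of ?f] assms(1) by (auto simp: deg_pos_iff)
  have szz: "sz z = Suc (sz f)" using adj_sz[OF z] by simp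
  have 1: "ins g [lf, lf, lf] f = ins g [lf, lf] ?f"
    using ins_ins_nested[of 0 "[lf]" g f "[lf, lf]"] assms(2) by simp
  have 2: "ins g [lf, lf, lf] f = ins (g + 2) [lf, lf] ?f"
    using ins_ins_nested[of 2 "[lf]" g f "[lf, lf]"] assms(2) by simp
  have "adj (ins g [lf, lf, lf] f) (ins g [Node [lf]] z)"
    unfolding 1 using adj_ins[of ?f z "[lf, lf]" "[Node [lf]]" g] z szz assms(2) adj_lf_lf by simp
  moreover have "adj (ins g [lf, lf, lf] f) (ins (g + 2) [Node [lf]] z)"
    unfolding 2 using adj_ins[of ?f z "[lf, lf]" "[Node [lf]]" "g + 2"] z szz assms(2) adj_lf_lf by simp
  moreover have "ins g [Node [lf]] z \<noteq> ins (g + 2) [Node [lf]] z"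
  proof
    assume eq: "ins g [Node [lf]] z = ins (g + 2) [Node [lf]] z"
    have "{g, g + 3} \<in> mat 0 (ins g [Node [lf]] z)"
      using mat_ins_0[of g z "[Node [lf]]"] assms(2) szz by (simp add: numeral_eq_Suc)
    moreover have "{g + 3, g + 4} \<in> mat 0 (ins g [Node [lf]] z)"
      unfolding eq using mat_ins_0[of "g + 2" z "[Node [lf]]"] assms(2) szz by (simp add: numeral_eq_Suc)
    ultimately show False
      using ncm_unique[OF ncm_mat, of "g + 3" g 0 "ins g [Node [lf]] z" "g + 4"] by (simp add: insert_commute)
  qed
  ultimately have "card {ins g [Node [lf]] z, ins (g + 2) [Node [lf]] z} \<le> card (nbrs (ins g [lf, lf, lf] f))"
    by (intro card_mono finite_nbrs) (auto simp: nbrs_def)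
  then show ?thesis using \<open>ins g [Node [lf]] z \<noteq> ins (g + 2) [Node [lf]] z\<close> by (simp add: deg_def)
qed

lemma deg_three_front: "odd (sz f) \<Longrightarrow> 2 \<le> deg (lf # lf # lf # f)"
  using deg_three[of f 0] by simp

lemma deg_append_A: "deg f \<le> deg (lf # lf # f)"
  using deg_ins_A[of 0 f] by simp

section \<open>Isolated matchings\<close>

lemma deg_single: "deg [lf] = 0"
proof -
  have "\<not> adj [lf] h" for h
  proof
    assume a: "adj [lf] h"
    then have "h = [lf]" using adj_sz[OF a] by (simp add: sz_eq_1)
    then show False using a adj_irrefl by blast
  qed
  then show ?thesis by (simp add: deg_eq_0_iff)
qed

text \<open>A vertex of the dual tree has \<open>ups\<close> value 0 if it is the mate of its parent in a perfect
  matching of the tree, 1 if it is the mate of one of its children, and at least 2 if its subtree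
  obstructs a perfect matching.\<close>

fun ups :: "tree list \<Rightarrow> nat" where
  "ups [] = 0"
| "ups (Node ts # us) = (if ups ts = 0 then 1 else if ups ts = 1 then 0 else 2) + ups us"

lemma ups_append [simp]: "ups (a @ b) = ups a + ups b"
  by (induction a rule: ups.induct) auto

lemma ups_ins_B: "ups (ins g [Node [lf]] f) = ups f"
  by (induction f arbitrary: g rule: ups.induct) auto

text \<open>Two sibling leaves compete for the same mate. The value is at least 2 at their parent,
  and a subtree with value at least 2 contributes 2 to the forest around it, so the obstruction
  reaches the root.\<close>

lemma ups_ins_A: "2 \<le> ups (ins g [lf, lf] f)"
proof (induction f arbitrary: g rule: sz.induct)
  case (2 ts us)
  show ?case using "2.IH"(1)[of "g - 1"] "2.IH"(2)[of "g - 2 - 2 * sz ts"] by auto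
qed simp

text \<open>State B changes neither side of the equivalence, and state A makes both sides false;
  what remains is the single edge.\<close>

lemma deg_eq_0_iff_ups:
  assumes "odd (sz f)"
  shows "deg f = 0 \<longleftrightarrow> ups f = 1"
  using assms
proof (induction "sz f" arbitrary: f rule: less_induct)
  case less
  show ?case
  proof (cases "sz f = 1")
    case True
    then have "f = [lf]" by (simp add: sz_eq_1)
    then show ?thesis by (simp add: deg_single)
  next
    case False
    then have "2 \<le> sz f" using less.prems by presburger
    then show ?thesis
    proof (cases rule: ins_cases)
      case (1 g h)
      then show ?thesis using deg_pos_ins_A[OF 1(1)] ups_ins_A[of g h] less.prems by simp
    next
      case (2 g h)
      then show ?thesis using less.hyps[of h] less.prems by (simp add: deg_ins_B ups_ins_B)
    qed
  qed
qed

section \<open>Reaching an A-extension of a non-isolated matching\<close>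

lemma peel_B:
  assumes "g \<le> 2 * sz h" "f = ins g [Node [lf]] h" "0 < deg f"
  shows "\<exists>g N. g \<le> 2 * sz N \<and> 0 < deg N \<and> sz f = sz N + 2 \<and> adj f (ins g [lf, lf] N)"
proof -
  obtain z where "adj f z" using assms(3) by (auto simp: deg_pos_iff)
  then obtain h' where h': "adj h h'" "z = ins g [lf, lf] h'"
    using adj_ins_B[OF assms(1)] assms(2) by blast
  then have "0 < deg h'" using adj_sym[of h h'] by (auto simp: deg_pos_iff)
  then show ?thesis using h' \<open>adj f z\<close> adj_sz[OF h'(1)] assms(1,2)
    by (intro exI[of _ g] exI[of _ h']) simp
qed

text \<open>For a B-extension one step suffices, since all its neighbours are A-extensions of
  non-isolated matchings. The critical case is an A-extension of an isolated \<open>h\<close>: then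
  \<open>h\<close> must itself be a B-extension of some \<open>n\<close>, and the positions of the
  two blocks are compared.\<close>

lemma peel:
  assumes "odd (sz f)" "5 \<le> sz f" "0 < deg f"
  shows "\<exists>g N. g \<le> 2 * sz N \<and> 0 < deg N \<and> sz f = sz N + 2 \<and> adj\<^sup>*\<^sup>* f (ins g [lf, lf] N)"
proof -
  have B: ?thesis if "g \<le> 2 * sz h" "f = ins g [Node [lf]] h" for g h
    using peel_B[OF that assms(3)] by blast
  have "2 \<le> sz f" using assms(2) by simp
  then show ?thesis
  proof (cases rule: ins_cases)
    case (2 g h)
    then show ?thesis by (rule B)
  next
    case (1 g h)
    note gh = this
    show ?thesis
    proof (cases "deg h = 0")
      case False
      then show ?thesis using gh by (intro exI[of _ g] exI[of _ h]) simp
    next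
      case True
      have "2 \<le> sz h" using gh(2) assms(2) by simp
      then show ?thesis
      proof (cases rule: ins_cases)
        case (1 i n)
        then show ?thesis using deg_pos_ins_A[OF 1(1)] True gh(2) assms(1) by simp
      next
        case (2 i n)
        have on: "odd (sz n)" using gh(2) 2(2) assms(1) by simp
        \<comment> \<open>The two leaves fell into the pendant path of \<open>h\<close> and made a
          block of four edges: an outer edge with a forest \<open>x\<close> of three edges below it.
          The outer edge is treated as a leaf edge added to \<open>n\<close>: it is split on the
          side of \<open>z\<close>, while \<open>x\<close> is exchanged for \<open>y\<close>, which
          is an A-extension of a single edge.\<close>
        have inner: ?thesis
          if f: "f = ins i [Node x] n" and xy: "adj x y" "sz x = 3"
            and y: "y = ins j [lf, lf] [lf]" "j \<le> 2" for x y j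
        proof -
          obtain z where z: "adj (ins i [lf] n) z"
            using deg_pos_even[of "ins i [lf] n"] on by (auto simp: deg_pos_iff)
          have szz: "sz z = Suc (sz n)" using adj_sz[OF z] by simp
          have "f = ins (Suc i) x (ins i [lf] n)"
            unfolding f using ins_ins_nested[of 1 "[lf]" i n x] 2(1) by simp
          then have "adj f (ins (Suc i) y z)"
            using adj_ins[of "ins i [lf] n" z x y "Suc i"] z xy adj_sz[OF xy(1)] szz 2(1) by simp
          moreover have "ins (Suc i) y z = ins (Suc i + j) [lf, lf] (ins (Suc i) [lf] z)"
            unfolding y(1) by (rule ins_ins_nested) (use y(2) szz 2(1) in auto)
          moreover have "0 < deg (ins (Suc i) [lf] z)"
            using adj_split[OF 2(1) z] adj_sym deg_pos_iff by blast
          ultimately show ?thesis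
            using szz 2(1) y(2) gh(2) 2(2)
            by (intro exI[of _ "Suc i + j"] exI[of _ "ins (Suc i) [lf] z"]) auto
        qed
        \<comment> \<open>Outside the path, the two blocks are independent and \<open>f\<close> is
          also a B-extension. The three gaps inside the path give two shapes of \<open>x\<close>,
          which are neighbours of each other.\<close>
        consider "g \<le> i" | "g = i + 1" | "g = i + 2" | "g = i + 3" | "i + 4 \<le> g" by linarith
        then show ?thesis
        proof cases
          case a: 1
          then have "f = ins (i + 4) [Node [lf]] (ins g [lf, lf] n)"
            unfolding gh(2) 2(2) using ins_ins_comm[of g i n "[lf, lf]"] 2(1) by simp
          then show ?thesis by (rule B[rotated]) (use 2(1) in simp)
        next
          case a: 2
          have e: "ins 1 [lf, lf] [Node [lf]] = [Node [lf, lf, lf]]" by (simp add: numeral_eq_Suc)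
          have "f = ins i [Node [lf, lf, lf]] n"
            unfolding gh(2) 2(2) a e[symmetric]
            by (rule ins_ins_nested[symmetric]) (use 2(1) in simp_all)
          then show ?thesis by (rule inner[OF _ adj_lf_lf_lf, of 1]) simp_all
        next
          case a: 3
          have e: "ins 2 [lf, lf] [Node [lf]] = [Node [Node [lf, lf]]]" by (simp add: numeral_eq_Suc)
          have "f = ins i [Node [Node [lf, lf]]] n"
            unfolding gh(2) 2(2) a e[symmetric]
            by (rule ins_ins_nested[symmetric]) (use 2(1) in simp_all)
          then show ?thesis by (rule inner[OF _ iffD1[OF adj_sym adj_lf_lf_lf], of 0]) simp_all
        next
          case a: 4
          have e: "ins 3 [lf, lf] [Node [lf]] = [Node [lf, lf, lf]]" by (simp add: numeral_eq_Suc)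
          have "f = ins i [Node [lf, lf, lf]] n"
            unfolding gh(2) 2(2) a e[symmetric]
            by (rule ins_ins_nested[symmetric]) (use 2(1) in simp_all)
          then show ?thesis by (rule inner[OF _ adj_lf_lf_lf, of 1]) simp_all
        next
          case a: 5
          then have "f = ins i [Node [lf]] (ins (g - 4) [lf, lf] n)"
            unfolding gh(2) 2(2) using ins_ins_comm[of i "g - 4" n "[Node [lf]]" "[lf, lf]"] gh(1) 2(2) a by simp
          then show ?thesis by (rule B[rotated]) (use 2(1) in simp)
        qed
      qed
    qed
  qed
qed

section \<open>Cubic caterpillars\<close>

text \<open>On the six points of the first tree, nesting under \<open>{0, 5}\<close> confines the
  partners of 1, 2, 3 and 4. Excluding crossings and common edges, only 4 and 0 remain as partner of
  1: the former makes 1 to 4 a pendant path, the latter forces three short edges on all six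
  points.\<close>

lemma adj_Node_lf_lf:
  assumes "adj (Node [lf, lf] # ts) z"
  shows "(\<exists>h. adj (lf # ts) h \<and> z = ins 1 [Node [lf]] h) \<or> (\<exists>y. adj ts y \<and> z = lf # lf # lf # y)"
proof -
  define M where "M = mat 0 (Node [lf, lf] # ts)"
  let ?Z = "mat 0 z"
  have szz: "sz z = sz ts + 3" using adj_sz[OF assms] by simp
  have M: "{0, 5} \<in> M" "{1, 2} \<in> M" "{3, 4} \<in> M" by (simp_all add: M_def numeral_eq_Suc)
  have Z: "ncm {0..<0 + 2 * sz z} ?Z" by (rule ncm_mat)
  have part: "\<exists>q\<le>5. {p, q} \<in> ?Z \<and> q \<noteq> p \<and> {p, q} \<notin> M" if "0 < p" "p < 5" for p :: nat
  proof -
    have p: "p < 2 * sz (Node [lf, lf] # ts)" using that by simp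
    obtain q where q: "{p, q} \<in> ?Z" "q \<noteq> p" "{p, q} \<notin> M" by (rule adj_partner[OF assms p, folded M_def])
    from adj_nested[OF assms M(1)[unfolded M_def] q(1) that] show ?thesis using q by blast
  qed
  obtain q where q: "q \<le> 5" "{1, q} \<in> ?Z" "q \<noteq> 1" "{1, q} \<notin> M" using part[of 1] by auto
  obtain r where r: "r \<le> 5" "{2, r} \<in> ?Z" "r \<noteq> 2" "{2, r} \<notin> M" using part[of 2] by auto
  obtain s where s: "s \<le> 5" "{3, s} \<in> ?Z" "s \<noteq> 3" "{3, s} \<notin> M" using part[of 3] by auto
  obtain t where t: "t \<le> 5" "{4, t} \<in> ?Z" "t \<noteq> 4" "{4, t} \<notin> M" using part[of 4] by auto
  have uq: "b = c" if "{a, b} \<in> ?Z" "{a, c} \<in> ?Z" for a b c using ncm_unique[OF Z that] .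
  have uq': "b = c" if "{b, a} \<in> ?Z" "{c, a} \<in> ?Z" for a b c
    using uq[of a b c] that by (simp add: insert_commute)
  have nest: "a < d \<and> d < b" if "{a, b} \<in> ?Z" "{c, d} \<in> ?Z" "a < c" "c < b" for a b c d :: nat
    using mat_nested[OF that] .
  have q2: "q \<noteq> 2" using q M by auto
  have r1: "r \<noteq> 1" using r M by (auto simp: insert_commute)
  have s4: "s \<noteq> 4" using s M by auto
  have t3: "t \<noteq> 3" using t M by (auto simp: insert_commute)
  have le5: "n = 0 \<or> n = 1 \<or> n = 2 \<or> n = 3 \<or> n = 4 \<or> n = 5" if "n \<le> 5" for n :: nat
    using that by linarith
  have swap: "{b, a} \<in> ?Z" if "{a, b} \<in> ?Z" for a b using that by (simp add: insert_commute)
  have "q = 0 \<or> q = 3 \<or> q = 4 \<or> q = 5" using le5[OF q(1)] q(3) q2 by blast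
  moreover have "q \<noteq> 3"
  proof
    assume "q = 3"
    then have "{1, 3} \<in> ?Z" using q by simp
    from nest[OF this r(2)] r(3) show False by simp
  qed
  moreover have "q \<noteq> 5"
  proof
    assume "q = 5"
    then have q5: "{1, 5} \<in> ?Z" using q by simp
    from nest[OF q5 r(2)] r(3) have "r = 3 \<or> r = 4" by auto
    then show False
    proof
      assume "r = 3"
      then have "{2, 3} \<in> ?Z" using r by simp
      moreover from nest[OF q5 t(2)] t(3) t3 have "t = 2" by auto
      then have "{4, 2} \<in> ?Z" using t by simp
      ultimately show False using uq[of 2 3 4] swap[of 4 2] by simp
    next
      assume "r = 4"
      then have "{2, 4} \<in> ?Z" using r by simp
      from nest[OF this s(2)] s(3) show False by simp
    qed
  qed
  ultimately consider "q = 4" | "q = 0" by blast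
  then show ?thesis
  proof cases
    case 1
    then have q4: "{1, 4} \<in> ?Z" using q by simp
    from nest[OF q4 r(2)] r(3) have "r = 3" by auto
    then have "{2, 3} \<in> ?Z" using r by simp
    then have "mat 1 [Node [lf]] \<subseteq> ?Z" using q4 by (simp add: numeral_eq_Suc)
    then obtain h where h: "1 \<le> 2 * sz h" "z = ins 1 [Node [lf]] h"
      using ins_split[of 1 "[Node [lf]]" z] szz by auto
    have "Node [lf, lf] # ts = ins 1 [lf, lf] (lf # ts)" by simp
    then have "adj (lf # ts) h"
      using adj_ins[of "lf # ts" h "[lf, lf]" "[Node [lf]]" 1] assms h szz by simp
    then show ?thesis using h(2) by blast
  next
    case 2
    then have q0: "{1, 0} \<in> ?Z" using q by simp
    have "r \<noteq> 0"
    proof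
      assume "r = 0"
      then have "{0, 2} \<in> ?Z" using swap[OF r(2)] by simp
      from uq[OF swap[OF q0] this] show False by simp
    qed
    then have "r = 3 \<or> r = 4 \<or> r = 5" using le5[OF r(1)] r(3) r1 by blast
    moreover have "r \<noteq> 4"
    proof
      assume "r = 4"
      then have "{2, 4} \<in> ?Z" using r by simp
      from nest[OF this s(2)] s(3) show False by simp
    qed
    moreover have "r \<noteq> 5"
    proof
      assume "r = 5"
      then have "{2, 5} \<in> ?Z" using r by simp
      from nest[OF this s(2)] s(3) s4 show False by simp
    qed
    ultimately have r3: "{2, 3} \<in> ?Z" using r by blast
    have "t \<noteq> 0"
    proof
      assume "t = 0"
      then have "{0, 4} \<in> ?Z" using swap[OF t(2)] by simp
      from uq[OF swap[OF q0] this] show False by simp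
    qed
    moreover have "t \<noteq> 1" using uq[of 1 0 4] q0 swap[OF t(2)] by auto
    moreover have "t \<noteq> 2" using uq[of 2 3 4] r3 swap[OF t(2)] by auto
    ultimately have "t = 5" using le5[OF t(1)] t(3) t3 by blast
    then have "mat 0 [lf, lf, lf] \<subseteq> ?Z"
      using t(2) r3 swap[OF q0] by (simp add: numeral_eq_Suc insert_commute)
    then obtain y where y: "z = ins 0 [lf, lf, lf] y"
      using ins_split[of 0 "[lf, lf, lf]" z] szz by auto
    then have "adj ts y"
      using adj_append[of "[Node [lf, lf]]" "[lf, lf, lf]" ts y] assms szz by simp
    then show ?thesis using y by auto
  qed
qed

lemma nbrs_Node_lf_lf:
  "nbrs (Node [lf, lf] # ts) = ins 1 [Node [lf]] ` nbrs (lf # ts) \<union> (\<lambda>y. lf # lf # lf # y) ` nbrs ts"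
proof (intro equalityI subsetI)
  fix z assume "z \<in> nbrs (Node [lf, lf] # ts)"
  then show "z \<in> ins 1 [Node [lf]] ` nbrs (lf # ts) \<union> (\<lambda>y. lf # lf # lf # y) ` nbrs ts"
    using adj_Node_lf_lf[of ts z] by (auto simp: nbrs_def)
next
  fix z assume "z \<in> ins 1 [Node [lf]] ` nbrs (lf # ts) \<union> (\<lambda>y. lf # lf # lf # y) ` nbrs ts"
  then have "adj (Node [lf, lf] # ts) z"
  proof
    assume "z \<in> ins 1 [Node [lf]] ` nbrs (lf # ts)"
    then obtain h where h: "adj (lf # ts) h" "z = ins 1 [Node [lf]] h" by (auto simp: nbrs_def)
    then show ?thesis
      using adj_ins[of "lf # ts" h "[lf, lf]" "[Node [lf]]" 1] adj_sz[OF h(1)] adj_lf_lf by simp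
  next
    assume "z \<in> (\<lambda>y. lf # lf # lf # y) ` nbrs ts"
    then obtain y where y: "adj ts y" "z = [lf, lf, lf] @ y" by (auto simp: nbrs_def)
    then show ?thesis
      using adj_append[of "[Node [lf, lf]]" "[lf, lf, lf]" ts y] adj_sz[OF y(1)] adj_lf_lf_lf adj_sym
      by simp
  qed
  then show "z \<in> nbrs (Node [lf, lf] # ts)" by (simp add: nbrs_def)
qed

text \<open>The recursion behind the number of leaves of the star: for a limb \<open>Node ts\<close>
  the forest \<open>ts\<close> has exactly one neighbour, so an additional spine vertex raises the
  degree by one.\<close>

lemma deg_Node_lf_lf: "deg (Node [lf, lf] # ts) = deg (lf # ts) + deg ts"
proof -
  let ?L = "ins 1 [Node [lf]] ` nbrs (lf # ts)" and ?X = "(\<lambda>y. lf # lf # lf # y) ` nbrs ts"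
  have "?L \<inter> ?X = {}"
  proof -
    have False if hy: "ins 1 [Node [lf]] h = lf # lf # lf # y" "h \<in> nbrs (lf # ts)" for h y
    proof -
      have "1 \<le> 2 * sz h" using hy(2) adj_sz[of "lf # ts" h] by (simp add: nbrs_def)
      then have "{1, 4} \<in> mat 0 (ins 1 [Node [lf]] h)"
        using mat_ins_0[of 1 h "[Node [lf]]"] by (simp add: numeral_eq_Suc)
      moreover have "{1, 0} \<in> mat 0 (lf # lf # lf # y)" by (simp add: insert_commute)
      ultimately show False
        using ncm_unique[OF ncm_mat, of 1 4 0 "lf # lf # lf # y" 0] unfolding hy(1) by simp
    qed
    then show ?thesis by blast
  qed
  moreover have "card ?L = deg (lf # ts)" unfolding deg_def
    by (rule card_image, rule inj_on_subset[OF inj_on_ins nbrs_subset]) simp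
  moreover have "card ?X = deg ts" unfolding deg_def
    by (rule card_image) (auto intro: inj_onI)
  ultimately show ?thesis
    unfolding deg_def[of "Node [lf, lf] # ts"] nbrs_Node_lf_lf by (simp add: card_Un_disjoint)
qed

lemma nbrs_Nil: "nbrs [] = {[]}"
  by (auto simp: nbrs_def adj_Nil)

lemma deg_lf_lf_lf: "deg [lf, lf, lf] = 1"
  using deg_Node_lf_lf[of "[]"] deg_rot[of "[Node [lf, lf]]"] deg_single by (simp add: deg_def nbrs_Nil)

section \<open>Caterpillars, their rotations and their components\<close>

text \<open>A member of \<open>limbs\<close> is a cubic caterpillar hanging by one of its end edges; the forms in
  \<open>caterpillars\<close> are the possible positions of the root of a cubic caterpillar relative to its spine.\<close>

inductive_set limbs :: "tree set" where
  leaf: "lf \<in> limbs"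
| left: "t \<in> limbs \<Longrightarrow> Node [lf, t] \<in> limbs"
| right: "t \<in> limbs \<Longrightarrow> Node [t, lf] \<in> limbs"

definition caterpillars :: "tree list set" where
  "caterpillars = {f. \<exists>t\<in>limbs. \<exists>u\<in>limbs. f \<in> {[lf, t, u], [t, lf, u], [t, u, lf], [Node [t, u]]}}"

lemma caterpillarsI:
  assumes "t \<in> limbs" "u \<in> limbs"
  shows "[lf, t, u] \<in> caterpillars" "[t, lf, u] \<in> caterpillars" "[t, u, lf] \<in> caterpillars" "[Node [t, u]] \<in> caterpillars"
  using assms unfolding caterpillars_def by blast+

lemma odd_sz_limb: "t \<in> limbs \<Longrightarrow> odd (sz [t])"
  by (induction rule: limbs.induct) (auto simp: sz_append[of "[_]" "[_]", simplified append.simps])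

lemma sz_pair: "sz [t, u] = sz [t] + sz [u]" and sz_triple: "sz [t, u, w] = sz [t] + sz [u] + sz [w]"
  by (cases t; cases u; cases w; simp)+

lemma caterpillar_sz:
  assumes "c \<in> caterpillars"
  shows "odd (sz c)" "3 \<le> sz c"
proof -
  obtain t u where tu: "t \<in> limbs" "u \<in> limbs" "c \<in> {[lf, t, u], [t, lf, u], [t, u, lf], [Node [t, u]]}"
    using assms unfolding caterpillars_def by blast
  then have "sz c = Suc (sz [t] + sz [u])" by (auto simp: sz_pair sz_triple)
  moreover have "odd (sz [t])" "odd (sz [u])" using odd_sz_limb tu by blast+
  ultimately show "odd (sz c)" "3 \<le> sz c" by presburger+
qed

lemma rot_in_caterpillars: "c \<in> caterpillars \<Longrightarrow> rot c \<in> caterpillars"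
proof -
  assume "c \<in> caterpillars"
  then obtain t u where tu: "t \<in> limbs" "u \<in> limbs" and c: "c \<in> {[lf, t, u], [t, lf, u], [t, u, lf], [Node [t, u]]}"
    unfolding caterpillars_def by blast
  note I = caterpillarsI limbs.intros tu
  from c consider "c = [lf, t, u]" | "c = [t, lf, u]" | "c = [t, u, lf]" | "c = [Node [t, u]]" by blast
  then show ?thesis
  proof cases
    case 1
    then show ?thesis using I by simp
  next
    case 2
    from tu(1) show ?thesis unfolding 2 by cases (simp_all add: I)
  next
    case 3
    from tu(1) show ?thesis unfolding 3 by cases (simp_all add: I)
  next
    case 4
    then show ?thesis using I by simp
  qed
qed

lemma rot_equiv_in_caterpillars: "rot_equiv c d \<Longrightarrow> c \<in> caterpillars \<Longrightarrow> d \<in> caterpillars"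
proof -
  assume "rot_equiv c d" "c \<in> caterpillars"
  then obtain j where "(rot ^^ j) c = d" by (auto simp: rot_equiv_def)
  then show ?thesis
  proof (induction j arbitrary: d)
    case (Suc j)
    then show ?case using rot_in_caterpillars by auto
  qed (use \<open>c \<in> caterpillars\<close> in simp)
qed

lemma rot_equiv_to_end: "rot_equiv [lf, t, u] [t, u, lf]"
  using rot_equiv_append[of "[lf]" "[t, u]"] by simp

text \<open>Rotation moves the root along the spine towards the end of \<open>t\<close>: this limb
  gets shorter and \<open>u\<close> longer, until \<open>t\<close> is a leaf.\<close>

lemma rot_equiv_canonical:
  assumes "t \<in> limbs"
  shows "\<forall>u\<in>limbs. (\<exists>w\<in>limbs. rot_equiv [t, lf, u] [lf, lf, w]) \<and> (\<exists>w\<in>limbs. rot_equiv [t, u, lf] [lf, lf, w])"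
  using assms
proof induction
  case leaf
  have "rot_equiv [lf, u, lf] [lf, lf, u]" for u using rot_equiv_append[of "[lf, u]" "[lf]"] by simp
  then show ?case using rot_equiv_refl by blast
next
  case (left t)
  show ?case
  proof (intro ballI conjI)
    fix u assume u: "u \<in> limbs"
    have "rot_equiv [Node [lf, t], lf, u] [t, Node [lf, u], lf]"
      using rot_equiv_trans[OF rot_equiv_Node[of "[lf, t]" "[lf, u]"]] rot_equiv_to_end by simp
    then show "\<exists>w\<in>limbs. rot_equiv [Node [lf, t], lf, u] [lf, lf, w]"
      using left.IH limbs.left[OF u] rot_equiv_trans by blast
    have "rot_equiv [Node [lf, t], u, lf] [t, Node [u, lf], lf]"
      using rot_equiv_trans[OF rot_equiv_Node[of "[lf, t]" "[u, lf]"]] rot_equiv_to_end by simp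
    then show "\<exists>w\<in>limbs. rot_equiv [Node [lf, t], u, lf] [lf, lf, w]"
      using left.IH limbs.right[OF u] rot_equiv_trans by blast
  qed
next
  case (right t)
  show ?case
  proof (intro ballI conjI)
    fix u assume u: "u \<in> limbs"
    have "rot_equiv [Node [t, lf], lf, u] [t, lf, Node [lf, u]]" using rot_equiv_Node[of "[t, lf]" "[lf, u]"] by simp
    then show "\<exists>w\<in>limbs. rot_equiv [Node [t, lf], lf, u] [lf, lf, w]"
      using right.IH limbs.left[OF u] rot_equiv_trans by blast
    have "rot_equiv [Node [t, lf], u, lf] [t, lf, Node [u, lf]]" using rot_equiv_Node[of "[t, lf]" "[u, lf]"] by simp
    then show "\<exists>w\<in>limbs. rot_equiv [Node [t, lf], u, lf] [lf, lf, w]"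
      using right.IH limbs.right[OF u] rot_equiv_trans by blast
  qed
qed

lemma caterpillar_canonical:
  assumes "c \<in> caterpillars"
  obtains t where "t \<in> limbs" "rot_equiv c [lf, lf, t]"
proof -
  obtain t u where tu: "t \<in> limbs" "u \<in> limbs" and c: "c \<in> {[lf, t, u], [t, lf, u], [t, u, lf], [Node [t, u]]}"
    using assms unfolding caterpillars_def by blast
  from c consider "c = [t, lf, u]" | "rot_equiv c [t, u, lf]"
    using rot_equiv_to_end rot_equiv_refl rot_equiv_Node[of "[t, u]" "[]"] by fastforce
  then show thesis
  proof cases
    case 1
    then show ?thesis using that rot_equiv_canonical[OF tu(1)] tu(2) by blast
  next
    case 2
    then show ?thesis using that rot_equiv_canonical[OF tu(1)] tu(2) rot_equiv_trans by blast
  qed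
qed

text \<open>The children of a limb are, up to rotation, a pendant path added to the children of a
  shorter limb, which leaves exactly one neighbour. That neighbour \<open>y\<close> is built from
  nested pendant paths, so inserting it as a block preserves degrees; this gives the degrees of the
  outer vertices of the star.\<close>

lemma nbrs_limb:
  assumes "t \<in> limbs"
  shows "\<forall>ts. t = Node ts \<longrightarrow> (\<exists>y. nbrs ts = {y} \<and> (\<forall>g f. g \<le> 2 * sz f \<longrightarrow> deg (ins g y f) = deg f))"
  using assms
proof induction
  case leaf
  have "ins g [] f = f" for g f by (induction f arbitrary: g rule: sz.induct) auto
  then show ?case by (auto simp: nbrs_Nil)
next
  case (left t)
  obtain us where t: "t = Node us" by (cases t)
  then obtain y where y: "nbrs us = {y}" "\<And>g f. g \<le> 2 * sz f \<Longrightarrow> deg (ins g y f) = deg f"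
    using left.IH by blast
  have "nbrs (rot (Node [lf] # us)) = rot ` nbrs (Node [lf] # us)" by (rule nbrs_rot)
  also have "nbrs (Node [lf] # us) = {[lf, lf] @ y}" using nbrs_ins_B[of 0 us] y(1) by simp
  finally have "nbrs [lf, t] = {[Node (lf # y)]}" unfolding t by simp
  moreover have "deg (ins g [Node (lf # y)] f) = deg f" if g: "g \<le> 2 * sz f" for g f
  proof -
    have "[Node (lf # y)] = ins 3 y [Node [lf]]" by (simp add: numeral_eq_Suc)
    then have "ins g [Node (lf # y)] f = ins (g + 3) y (ins g [Node [lf]] f)"
      using ins_ins_nested[of 3 "[Node [lf]]" g f y] g by simp
    then show ?thesis using y(2)[of "g + 3" "ins g [Node [lf]] f"] g by (simp add: deg_ins_B)
  qed
  ultimately show ?case by blast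
next
  case (right t)
  obtain us where t: "t = Node us" by (cases t)
  then obtain y where y: "nbrs us = {y}" "\<And>g f. g \<le> 2 * sz f \<Longrightarrow> deg (ins g y f) = deg f"
    using right.IH by blast
  have "rot ` nbrs [t, lf] = nbrs (us @ [Node [lf]])" unfolding t nbrs_rot[symmetric] by simp
  also have "us @ [Node [lf]] = ins (2 * sz us) [Node [lf]] us" by (simp add: ins_end)
  also have "nbrs \<dots> = {ins (2 * sz us) [lf, lf] y}" using nbrs_ins_B[of "2 * sz us" us] y(1) by simp
  also have "sz us = sz y" using y(1) adj_sz[of us y] by (simp add: nbrs_def set_eq_iff)
  also have "{ins (2 * sz y) [lf, lf] y} = rot ` {[Node (y @ [lf])]}" by (simp add: ins_end)
  finally have "nbrs [t, lf] = {[Node (y @ [lf])]}"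
    using inj_image_eq_iff[of rot] rot_inj by (metis injI)
  moreover have "deg (ins g [Node (y @ [lf])] f) = deg f" if g: "g \<le> 2 * sz f" for g f
  proof -
    have "[Node (y @ [lf])] = ins 1 y [Node [lf]]" by simp
    then have "ins g [Node (y @ [lf])] f = ins (g + 1) y (ins g [Node [lf]] f)"
      using ins_ins_nested[of 1 "[Node [lf]]" g f y] g by simp
    then show ?thesis using y(2)[of "g + 1" "ins g [Node [lf]] f"] g by (simp add: deg_ins_B)
  qed
  ultimately show ?case by blast
qed

definition star_centre :: "tree list \<Rightarrow> bool" where
  "star_centre c \<longleftrightarrow> deg c = (sz c - 1) div 2 \<and> (\<forall>m. adj c m \<longrightarrow> deg m = 1)"

lemma star_centre_rot: "star_centre (rot c) \<longleftrightarrow> star_centre c"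
proof -
  have "(\<forall>m. adj (rot c) m \<longrightarrow> deg m = 1) \<longleftrightarrow> (\<forall>m. adj (rot c) (rot m) \<longrightarrow> deg (rot m) = 1)"
    using rot_surj by metis
  then show ?thesis by (simp add: star_centre_def)
qed

lemma star_centre_rot_equiv: "rot_equiv c d \<Longrightarrow> star_centre c \<longleftrightarrow> star_centre d"
  by (induction rule: rot_equiv_induct) (auto simp: star_centre_rot)

text \<open>Replacing the leaf of \<open>lf # ts\<close> by a cubic vertex lengthens the spine. By
  \<open>adj_Node_lf_lf\<close> the neighbours are B-extensions of old ones, of unchanged degree,
  and a single new one, which is \<open>[lf, lf, lf]\<close> with the block \<open>y\<close>
  inserted and therefore also has degree 1.\<close>

lemma star_centre_step:
  assumes "Node ts \<in> limbs" "ts = [] \<or> star_centre (lf # ts)"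
  shows "star_centre [lf, lf, Node ts]"
proof -
  let ?c = "Node [lf, lf] # ts"
  obtain y where y: "nbrs ts = {y}" "\<And>g f. g \<le> 2 * sz f \<Longrightarrow> deg (ins g y f) = deg f"
    using nbrs_limb[OF assms(1)] by blast
  \<comment> \<open>For \<open>ts = []\<close> the forest is a single edge: no neighbour at all, in
    agreement with degree \<open>sz ts div 2\<close>.\<close>
  have base: "deg (lf # ts) = sz ts div 2 \<and> (\<forall>m. adj (lf # ts) m \<longrightarrow> deg m = 1)"
    using assms(2) deg_single deg_eq_0_iff[of "[lf]"] by (auto simp: star_centre_def)
  have "deg ?c = sz ts div 2 + 1"
    using deg_Node_lf_lf[of ts] base y(1) by (simp add: deg_def)
  moreover have "deg m = 1" if "adj ?c m" for m
    using adj_Node_lf_lf[OF that]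
  proof (elim disjE exE conjE)
    fix h assume h: "adj (lf # ts) h" "m = ins 1 [Node [lf]] h"
    then show ?thesis using deg_ins_B[of 1 h] base adj_sz[OF h(1)] by simp
  next
    fix y' assume "adj ts y'" "m = lf # lf # lf # y'"
    then have "m = ins 6 y [lf, lf, lf]" using y(1) by (auto simp: nbrs_def numeral_eq_Suc)
    then show ?thesis using y(2)[of 6 "[lf, lf, lf]"] deg_lf_lf_lf by simp
  qed
  ultimately have "star_centre ?c" by (simp add: star_centre_def)
  then show ?thesis using star_centre_rot[of ?c] by simp
qed

lemma star_centre_canonical: "t \<in> limbs \<Longrightarrow> star_centre [lf, lf, t]"
proof (induction rule: limbs.induct)
  case leaf
  show ?case by (rule star_centre_step[OF limbs.leaf]) simp
next
  case (left t)
  then show ?case using star_centre_step[OF limbs.left] by simp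
next
  case (right t)
  have "rot_equiv [lf, lf, t] [lf, t, lf]" using rot_equiv_append[of "[lf]" "[lf, t]"] by simp
  then show ?case using star_centre_step[OF limbs.right] right star_centre_rot_equiv by blast
qed

lemma caterpillar_star_centre: "c \<in> caterpillars \<Longrightarrow> star_centre c"
  using star_centre_canonical star_centre_rot_equiv by (metis caterpillar_canonical)

section \<open>Inserting one leaf into a caterpillar\<close>

lemma deg_rot_equiv_three: "rot_equiv f (lf # lf # lf # h) \<Longrightarrow> odd (sz h) \<Longrightarrow> 2 \<le> deg f"
  using deg_rot_equiv deg_three_front by metis

lemma deg_pos_limb:
  assumes "t \<in> limbs" "t \<noteq> lf"
  shows "0 < deg [t]"
proof -
  have *: "0 < deg f" if "rot_equiv f [lf, lf, u]" "u \<in> limbs" for f u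
    using deg_rot_equiv[OF that(1)] deg_pos_ins_A[of 0 "[u]"] odd_sz_limb[OF that(2)] by simp
  from assms(1) show ?thesis
  proof cases
    case (left u)
    have "rot_equiv [lf, u, lf] [lf, lf, u]" using rot_equiv_append[of "[lf, u]" "[lf]"] by simp
    then have "rot_equiv [t] [lf, lf, u]" using rot_equiv_trans[OF rot_equiv_Node[of "[lf, u]" "[]"]] left by simp
    then show ?thesis using * left by blast
  next
    case (right u)
    have "rot_equiv [u, lf, lf] [lf, lf, u]" using rot_equiv_append[of "[u]" "[lf, lf]"] by simp
    then have "rot_equiv [t] [lf, lf, u]" using rot_equiv_trans[OF rot_equiv_Node[of "[u, lf]" "[]"]] right by simp
    then show ?thesis using * right by blast
  qed (use assms(2) in simp)
qed

text \<open>Both lower bounds from \<open>deg_ins_A\<close> for \<open>[Node [t]]\<close>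
  contribute: that forest is even, and adding a leaf beside it gives, up to rotation, a B-extension
  of the non-isolated \<open>[t]\<close>.\<close>

lemma deg_pendant_leaf:
  assumes "t \<in> limbs" "t \<noteq> lf"
  shows "2 \<le> deg [lf, lf, Node [t]]"
proof -
  have "rot_equiv [lf, Node [t]] [Node [t], lf]" using rot_equiv_append[of "[lf]" "[Node [t]]"] by simp
  also have "rot_equiv [Node [t], lf] [t, Node [lf]]" using rot_equiv_Node[of "[t]" "[lf]"] by simp
  finally have "deg [lf, Node [t]] = deg [t, Node [lf]]" by (rule deg_rot_equiv)
  also have "\<dots> = deg [t]"
    using deg_ins_B[of "2 * sz [t]" "[t]"] ins_end[of "[t]" "[Node [lf]]"] by simp
  finally have "0 < deg [lf, Node [t]]" using deg_pos_limb[OF assms] by simp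
  moreover have "0 < deg [Node [t]]"
    by (rule deg_pos_even) (use odd_sz_limb[OF assms(1)] in \<open>cases t; simp\<close>)
  ultimately show ?thesis using deg_ins_A[of 0 "[Node [t]]"] by simp
qed

text \<open>Descends along the spine to the gap. A leaf placed beside a spine vertex creates three
  consecutive leaves there, up to rotation and after discarding the two outer leaves. A leaf placed
  below a leaf prolongs the limb if this is the end of the spine, and otherwise leads to
  \<open>deg_pendant_leaf\<close>.\<close>

lemma ins_limb:
  assumes "t \<in> limbs"
  shows "\<forall>ts g. t = Node ts \<longrightarrow> g \<le> 2 * sz ts \<longrightarrow>
    Node (ins g [lf, lf] ts) \<in> limbs \<or> 2 \<le> deg [lf, lf, Node (ins g [lf] ts)]"
  using assms
proof induction
  case leaf
  show ?case using limbs.left[OF limbs.leaf] by simp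
next
  case (left t)
  obtain us where t: "t = Node us" by (cases t)
  have ot: "odd (sz [t])" using odd_sz_limb left.hyps by blast
  show ?case
  proof (intro allI impI)
    fix ts g assume "Node [lf, t] = Node ts" and g: "g \<le> 2 * sz ts"
    then have ts: "ts = [lf, Node us]" using t by simp
    \<comment> \<open>The two outer leaves are dropped by \<open>deg_append_A\<close>. In
      \<open>[Node a]\<close> the root edge is itself a leaf edge of the dual tree, which a rotation
      shows as the last leaf of \<open>a @ [lf]\<close>.\<close>
    have three: "2 \<le> deg [lf, lf, Node a]" if "rot_equiv (a @ [lf]) (lf # lf # lf # [t])" for a
      using deg_append_A[of "[Node a]"] deg_rot_equiv_three[OF that ot] deg_rot_equiv[OF rot_equiv_Node[of a "[]"]] by simp
    have first: "2 \<le> deg [lf, lf, Node [lf, lf, t]]"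
      by (rule three) (use rot_equiv_append[of "[lf, lf, t]" "[lf]"] in simp)
    have last: "2 \<le> deg [lf, lf, Node [lf, t, lf]]"
      by (rule three) (use rot_equiv_append[of "[lf, t]" "[lf, lf]"] in simp)
    from g[unfolded ts]
    show "Node (ins g [lf, lf] ts) \<in> limbs \<or> 2 \<le> deg [lf, lf, Node (ins g [lf] ts)]"
    proof (cases rule: ins_Cons_cases)
      case 1
      then show ?thesis using first ts t by simp
    next
      case (2 g')
      show ?thesis
      proof (cases "t = lf")
        case True
        then show ?thesis using 2 ts t limbs.right[OF limbs.left[OF limbs.leaf]] by simp
      next
        case False
        have "[lf, lf, Node [Node [lf], t]] = ins 5 [Node [lf]] [lf, lf, Node [t]]"
          by (simp add: numeral_eq_Suc)
        then have "2 \<le> deg [lf, lf, Node [Node [lf], t]]"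
          using deg_ins_B[of 5 "[lf, lf, Node [t]]"] deg_pendant_leaf[OF left.hyps False] by simp
        then show ?thesis using 2 ts t by simp
      qed
    next
      case (3 g')
      from 3(2) show ?thesis
      proof (cases rule: ins_Cons_cases)
        case 1
        then show ?thesis using 3 first ts t by simp
      next
        case (2 i)
        from left.IH t 2(2) have "Node (ins i [lf, lf] us) \<in> limbs \<or> 2 \<le> deg [lf, lf, Node (ins i [lf] us)]"
          by blast
        then show ?thesis
        proof
          assume "Node (ins i [lf, lf] us) \<in> limbs"
          then show ?thesis using 2 3 ts limbs.left by simp
        next
          let ?a = "Node (ins i [lf] us)"
          assume a: "2 \<le> deg [lf, lf, ?a]"
          have "rot_equiv [Node [lf, ?a]] [lf, ?a, lf]" using rot_equiv_Node[of "[lf, ?a]" "[]"] by simp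
          also have "rot_equiv [lf, ?a, lf] [lf, lf, ?a]" using rot_equiv_append[of "[lf, ?a]" "[lf]"] by simp
          finally have "2 \<le> deg [Node [lf, ?a]]" using a deg_rot_equiv by metis
          then show ?thesis using deg_append_A[of "[Node [lf, ?a]]"] 2 3 ts by simp
        qed
      next
        case (3 i)
        then show ?thesis using \<open>\<And>x. ins g x (lf # [Node us]) = lf # ins g' x [Node us]\<close> last ts t by simp
      qed
    qed
  qed
next
  case (right t)
  obtain us where t: "t = Node us" by (cases t)
  have ot: "odd (sz [t])" using odd_sz_limb right.hyps by blast
  show ?case
  proof (intro allI impI)
    fix ts g assume "Node [t, lf] = Node ts" and g: "g \<le> 2 * sz ts"
    then have ts: "ts = [Node us, lf]" using t by simp
    have three: "2 \<le> deg [lf, lf, Node a]" if "rot_equiv (a @ [lf]) (lf # lf # lf # [t])" for a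
      using deg_append_A[of "[Node a]"] deg_rot_equiv_three[OF that ot] deg_rot_equiv[OF rot_equiv_Node[of a "[]"]] by simp
    have first: "2 \<le> deg [lf, lf, Node [lf, t, lf]]"
      by (rule three) (use rot_equiv_append[of "[lf, t]" "[lf, lf]"] in simp)
    have last: "2 \<le> deg [lf, lf, Node [t, lf, lf]]"
      by (rule three) (use rot_equiv_append[of "[t]" "[lf, lf, lf]"] in simp)
    from g[unfolded ts]
    show "Node (ins g [lf, lf] ts) \<in> limbs \<or> 2 \<le> deg [lf, lf, Node (ins g [lf] ts)]"
    proof (cases rule: ins_Cons_cases)
      case 1
      then show ?thesis using first ts t by simp
    next
      case (2 i)
      from right.IH t 2(2) have "Node (ins i [lf, lf] us) \<in> limbs \<or> 2 \<le> deg [lf, lf, Node (ins i [lf] us)]"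
        by blast
      then show ?thesis
      proof
        assume "Node (ins i [lf, lf] us) \<in> limbs"
        then show ?thesis using 2 ts limbs.right by simp
      next
        let ?a = "Node (ins i [lf] us)"
        assume a: "2 \<le> deg [lf, lf, ?a]"
        have "rot_equiv [Node [?a, lf]] [?a, lf, lf]" using rot_equiv_Node[of "[?a, lf]" "[]"] by simp
        also have "rot_equiv [?a, lf, lf] [lf, lf, ?a]" using rot_equiv_append[of "[?a]" "[lf, lf]"] by simp
        finally have "2 \<le> deg [Node [?a, lf]]" using a deg_rot_equiv by metis
        then show ?thesis using deg_append_A[of "[Node [?a, lf]]"] 2 ts by simp
      qed
    next
      case (3 g')
      note g3 = 3(3)
      from 3(2) show ?thesis
      proof (cases rule: ins_Cons_cases)
        case 1
        then show ?thesis using g3 last ts t by simp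
      next
        case (2 i)
        show ?thesis
        proof (cases "t = lf")
          case True
          then show ?thesis using 2 g3 ts t limbs.left[OF limbs.left[OF limbs.leaf]] by simp
        next
          case False
          have "[lf, lf, Node [t, Node [lf]]] = ins (5 + 2 * sz [t]) [Node [lf]] [lf, lf, Node [t]]"
            using ins_end[of "[t]" "[Node [lf]]"] by (simp add: numeral_eq_Suc)
          then have "2 \<le> deg [lf, lf, Node [t, Node [lf]]]"
            using deg_ins_B[of "5 + 2 * sz [t]" "[lf, lf, Node [t]]"] deg_pendant_leaf[OF right.hyps False]
            by simp
          then show ?thesis using 2 g3 ts t by simp
        qed
      next
        case (3 i)
        then show ?thesis using g3 last ts t by simp
      qed
    qed
  qed
qed

lemma caterpillar_ins_canonical:
  assumes "t \<in> limbs" "g \<le> 2 * sz [lf, lf, t]"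
  shows "2 \<le> deg (ins g [lf] [lf, lf, t]) \<or> ins g [lf, lf] [lf, lf, t] \<in> caterpillars"
proof -
  obtain ts where t: "t = Node ts" by (cases t)
  have ot: "odd (sz [t])" using odd_sz_limb assms(1) by blast
  have first: "2 \<le> deg [lf, lf, lf, t]" using deg_three_front[OF ot] by simp
  have last: "2 \<le> deg [lf, lf, t, lf]"
    by (rule deg_rot_equiv_three[of _ "[t]"]) (use ot rot_equiv_append[of "[lf, lf, t]" "[lf]"] in simp_all)
  have N: "Node [lf, lf] \<in> limbs" using limbs.left[OF limbs.leaf] .
  from assms(2)[unfolded t] show ?thesis
  proof (cases rule: ins_Cons_cases)
    case 1
    then show ?thesis using first by simp
  next
    case (2 g')
    then show ?thesis using caterpillarsI(2)[OF N assms(1)] t by simp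
  next
    case (3 g')
    note g3 = 3(3)
    from 3(2) show ?thesis
    proof (cases rule: ins_Cons_cases)
      case 1
      then show ?thesis using g3 first t by simp
    next
      case (2 g'')
      then show ?thesis using g3 caterpillarsI(1)[OF N assms(1)] t by simp
    next
      case (3 h)
      note h3 = 3(3)
      from 3(2) show ?thesis
      proof (cases rule: ins_Cons_cases)
        case 1
        then show ?thesis using g3 h3 first t by simp
      next
        case (2 i)
        have "Node (ins i [lf, lf] ts) \<in> limbs \<or> 2 \<le> deg [lf, lf, Node (ins i [lf] ts)]"
          using ins_limb[OF assms(1)] t 2(2) by blast
        then show ?thesis using g3 h3 2 t caterpillarsI(1)[OF limbs.leaf] by auto
      next
        case (3 i)
        then show ?thesis using g3 h3 last t by simp
      qed
    qed
  qed
qed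

text \<open>Serves the equality case of the size bound: above a caterpillar, either splitting yields
  two members or the A-extension is again a caterpillar.\<close>

lemma caterpillar_ins:
  assumes "c \<in> caterpillars" "g \<le> 2 * sz c"
  shows "2 \<le> deg (ins g [lf] c) \<or> ins g [lf, lf] c \<in> caterpillars"
proof -
  obtain t where t: "t \<in> limbs" "rot_equiv c [lf, lf, t]" using caterpillar_canonical assms(1) by blast
  \<comment> \<open>The gap is quantified inside the induction because every rotation renumbers
    it.\<close>
  have "c \<noteq> [] \<longrightarrow> (\<forall>g\<le>2 * sz c. 2 \<le> deg (ins g [lf] c) \<or> ins g [lf, lf] c \<in> caterpillars)"
    using t(2)
  proof (induction rule: rot_equiv_induct)
    case refl
    then show ?case using caterpillar_ins_canonical[OF t(1)] by blast
  next
    case (rot c)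
    show ?case
    proof (intro impI allI)
      fix g assume c: "c \<noteq> []" and g: "g \<le> 2 * sz c"
      let ?g = "if g = 0 then 2 * sz c - 1 else g - 1"
      have "rot c \<noteq> []" using c sz_rot[of c] by (metis sz_eq_0)
      moreover have "?g \<le> 2 * sz (rot c)" using g by (cases "g = 0") simp_all
      ultimately have "2 \<le> deg (ins ?g [lf] (rot c)) \<or> ins ?g [lf, lf] (rot c) \<in> caterpillars"
        using rot by blast
      then show "2 \<le> deg (ins g [lf] c) \<or> ins g [lf, lf] c \<in> caterpillars"
      proof
        assume "2 \<le> deg (ins ?g [lf] (rot c))"
        then show ?thesis using deg_rot_equiv[OF rot_equiv_ins_rot[OF c g, of "[lf]"]] by (simp only: simp_thms)
      next
        assume "ins ?g [lf, lf] (rot c) \<in> caterpillars"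
        then show ?thesis using rot_equiv_in_caterpillars[OF rot_equiv_sym[OF rot_equiv_ins_rot[OF c g, of "[lf, lf]"]]] by blast
      qed
    qed
  qed
  moreover have "c \<noteq> []" using caterpillar_sz[OF assms(1)] by auto
  ultimately show ?thesis using assms(2) by blast
qed

section \<open>Neighbours of a caterpillar with three consecutive leaves\<close>

lemma ins_second: "g \<le> 2 * sz a \<Longrightarrow> ins (3 + g) x [lf, Node a] = [lf, Node (ins g x a)]"
  and ins_first: "g \<le> 2 * sz a \<Longrightarrow> ins (1 + g) x [Node a, lf] = [Node (ins g x a), lf]"
  by simp_all

text \<open>The three leaves arise at the end of the spine, where \<open>[Node [lf, lf]]\<close> is
  exchanged for \<open>[lf, lf, lf]\<close>. Each further spine edge with its leaf only wraps one
  more edge around this block and puts one beside it.\<close>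

lemma limb_nbr_three:
  assumes "t \<in> limbs" "t \<noteq> lf"
  shows "\<exists>g r. g \<le> 2 * sz r \<and> adj [t] (ins g [lf, lf, lf] r)"
  using assms
proof induction
  case (left t)
  show ?case
  proof (cases "t = lf")
    case True
    then show ?thesis using adj_lf_lf_lf adj_sym by (intro exI[of _ 0] exI[of _ "[]"]) simp
  next
    case False
    then obtain g r where gr: "g \<le> 2 * sz r" "adj [t] (ins g [lf, lf, lf] r)" using left.IH by blast
    let ?n = "ins g [lf, lf, lf] r"
    have "adj (ins 3 [t] [Node [lf]]) (ins 3 ?n [lf, lf])"
      using adj_ins[of "[Node [lf]]" "[lf, lf]" "[t]" ?n 3] gr(2) adj_sz[OF gr(2)] adj_lf_lf adj_sym by simp
    then have "adj [Node [lf, t]] [lf, Node ?n]" by (simp add: numeral_eq_Suc)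
    moreover have "[lf, Node ?n] = ins (3 + g) [lf, lf, lf] [lf, Node r]"
      by (rule ins_second[OF gr(1), symmetric])
    moreover have "3 + g \<le> 2 * sz [lf, Node r]" using gr(1) by simp
    ultimately show ?thesis by metis
  qed
next
  case (right t)
  show ?case
  proof (cases "t = lf")
    case True
    then show ?thesis using adj_lf_lf_lf adj_sym by (intro exI[of _ 0] exI[of _ "[]"]) simp
  next
    case False
    then obtain g r where gr: "g \<le> 2 * sz r" "adj [t] (ins g [lf, lf, lf] r)" using right.IH by blast
    let ?n = "ins g [lf, lf, lf] r"
    have "adj (ins 1 [t] [Node [lf]]) (ins 1 ?n [lf, lf])"
      using adj_ins[of "[Node [lf]]" "[lf, lf]" "[t]" ?n 1] gr(2) adj_sz[OF gr(2)] adj_lf_lf adj_sym by simp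
    then have "adj [Node [t, lf]] [Node ?n, lf]" by simp
    moreover have "[Node ?n, lf] = ins (1 + g) [lf, lf, lf] [Node r, lf]"
      by (rule ins_first[OF gr(1), symmetric])
    moreover have "1 + g \<le> 2 * sz [Node r, lf]" using gr(1) by simp
    ultimately show ?thesis by metis
  qed
qed simp

text \<open>Two kinds of neighbours with a triple of leaves are at hand, and each gap leaves the
  triple of one of them intact after the additional leaf is inserted; \<open>deg_three\<close> then
  applies.\<close>

lemma caterpillar_nbr_canonical:
  assumes "t \<in> limbs" "t \<noteq> lf" "g \<le> 2 * sz [lf, lf, t]"
  shows "\<exists>m. adj [lf, lf, t] m \<and> 2 \<le> deg (ins g [lf] m)"
proof -
  obtain ts where t: "t = Node ts" by (cases t)
  have ot: "odd (sz [t])" using odd_sz_limb assms(1) by blast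
  then have et: "even (sz ts)" using t by simp
  \<comment> \<open>Here the triple of leaves lies in the part that belongs to \<open>t\<close>;
    insertion before this part or at its far end cannot break it.\<close>
  have far: ?thesis if g: "g \<le> 4 \<or> g = 2 * sz [lf, lf, t]"
  proof -
    obtain h r where hr: "h \<le> 2 * sz r" "adj [t] (ins h [lf, lf, lf] r)"
      using limb_nbr_three[OF assms(1,2)] by blast
    have szr: "sz [t] = sz r + 3" using adj_sz[OF hr(2)] by simp
    let ?m = "Node [lf] # ins h [lf, lf, lf] r" and ?r = "Node [lf] # r"
    have "adj [lf, lf, t] ?m"
      using adj_append[of "[lf, lf]" "[Node [lf]]" "[t]" "ins h [lf, lf, lf] r"] hr(2) szr adj_lf_lf by simp
    moreover have m: "?m = ins (4 + h) [lf, lf, lf] ?r" by (simp add: numeral_eq_Suc)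
    have "2 \<le> deg (ins g [lf] ?m)"
      using g
    proof
      assume "g \<le> 4"
      then have "ins g [lf] ?m = ins (4 + h + 2) [lf, lf, lf] (ins g [lf] ?r)"
        unfolding m using ins_ins_comm[of g "4 + h" ?r "[lf]" "[lf, lf, lf]"] hr(1) by simp
      then show ?thesis using deg_three[of "ins g [lf] ?r" "4 + h + 2"] hr(1) szr ot by simp
    next
      assume g: "g = 2 * sz [lf, lf, t]"
      then have g: "g = 4 + 2 * sz r + 6" using szr sz_append[of "[lf, lf]" "[t]"] by simp
      then have "ins g [lf] ?m = ins (4 + h) [lf, lf, lf] (ins (g - 6) [lf] ?r)"
        unfolding m using ins_ins_comm[of "4 + h" "g - 6" ?r "[lf, lf, lf]" "[lf]"] hr(1) by simp
      then show ?thesis using deg_three[of "ins (g - 6) [lf] ?r" "4 + h"] hr(1) szr ot by simp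
    qed
    ultimately show ?thesis by blast
  qed
  obtain y where y: "adj ts y" using deg_pos_even[OF et] by (auto simp: deg_pos_iff)
  have szy: "sz y = sz ts" using adj_sz[OF y] .
  \<comment> \<open>For the remaining gaps, which lie in \<open>y\<close>: the outer edge and the
    first two children of this neighbour are three consecutive leaves up to rotation.\<close>
  let ?m = "[Node ([lf, lf] @ y)]"
  have "adj (Node [lf, lf] # ts) ([lf, lf, lf] @ y)"
    using adj_append[of "[Node [lf, lf]]" "[lf, lf, lf]" ts y] y szy adj_lf_lf_lf adj_sym by simp
  then have "adj (rot (Node [lf, lf] # ts)) (rot ([lf, lf, lf] @ y))" by (simp only: adj_rot)
  then have m: "adj [lf, lf, t] ?m" using t by simp
  consider "g \<le> 4 \<or> g = 2 * sz [lf, lf, t]" | i where "g = 5 + i" "i \<le> 2 * sz y"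
  proof -
    have "2 * sz [lf, lf, t] = 6 + 2 * sz y" using t szy by simp
    then have "g \<le> 4 \<or> g = 2 * sz [lf, lf, t] \<or> g = 5 + (g - 5) \<and> g - 5 \<le> 2 * sz y"
      using assms(3) by linarith
    then show thesis using that by blast
  qed
  then show ?thesis
  proof cases
    case (2 i)
    let ?y = "ins i [lf] y"
    have end_lf: "rot_equiv ([lf, lf] @ a @ [lf]) (lf # lf # lf # a)" for a
      using rot_equiv_append[of "[lf, lf] @ a" "[lf]"] by simp
    have "ins (5 + i) x [Node ([lf, lf] @ y)] = [Node ([lf, lf] @ ins i x y)]" for x
      using 2(2) by simp
    then have "ins g [lf] ?m = [Node ([lf, lf] @ ?y)]" using 2(1) by simp
    also have "rot_equiv \<dots> (([lf, lf] @ ?y) @ [lf])" using rot_equiv_Node[of "[lf, lf] @ ?y" "[]"] by simp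
    also have "rot_equiv \<dots> (lf # lf # lf # ?y)" using end_lf[of ?y] by (simp only: append_assoc)
    finally have "2 \<le> deg (ins g [lf] ?m)"
      by (rule deg_rot_equiv_three) (use et szy in simp)
    then show ?thesis using m by blast
  qed (rule far)
qed

lemma caterpillar_nbr:
  assumes "c \<in> caterpillars" "5 \<le> sz c" "g \<le> 2 * sz c"
  shows "\<exists>m. adj c m \<and> 2 \<le> deg (ins g [lf] m)"
proof -
  obtain t where t: "t \<in> limbs" "rot_equiv c [lf, lf, t]" using caterpillar_canonical assms(1) by blast
  have "t \<noteq> lf" using sz_rot_equiv[OF t(2)] assms(2) by auto
  have "c \<noteq> [] \<longrightarrow> (\<forall>g\<le>2 * sz c. \<exists>m. adj c m \<and> 2 \<le> deg (ins g [lf] m))"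
    using t(2)
  proof (induction rule: rot_equiv_induct)
    case refl
    then show ?case using caterpillar_nbr_canonical[OF t(1) \<open>t \<noteq> lf\<close>] by blast
  next
    case (rot c)
    show ?case
    proof (intro impI allI)
      fix g assume c: "c \<noteq> []" and g: "g \<le> 2 * sz c"
      let ?g = "if g = 0 then 2 * sz c - 1 else g - 1"
      have "rot c \<noteq> []" using c sz_rot[of c] by (metis sz_eq_0)
      moreover have "?g \<le> 2 * sz (rot c)" using g by (cases "g = 0") simp_all
      ultimately obtain m' where m': "adj (rot c) m'" "2 \<le> deg (ins ?g [lf] m')"
        using rot by blast
      obtain m where m: "m' = rot m" using rot_surj by metis
      have "adj c m" using m' m by simp
      then have szm: "sz m = sz c" by (rule adj_sz)
      then have "m \<noteq> []" using c by (metis sz_eq_0)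
      then have "rot_equiv (ins g [lf] m) (ins ?g [lf] m')"
        using rot_equiv_ins_rot[of m g "[lf]"] g unfolding szm m by blast
      then have "2 \<le> deg (ins g [lf] m)" using deg_rot_equiv m'(2) by simp
      then show "\<exists>m. adj c m \<and> 2 \<le> deg (ins g [lf] m)" using \<open>adj c m\<close> by blast
    qed
  qed
  moreover have "c \<noteq> []" using caterpillar_sz[OF assms(1)] by auto
  ultimately show ?thesis using assms(3) by blast
qed

section \<open>Orders of components\<close>

definition component :: "tree list \<Rightarrow> tree list set" where
  "component f = {h. adj\<^sup>*\<^sup>* f h}"

lemma component_refl [simp]: "f \<in> component f"
  by (simp add: component_def)

lemma component_step: "h \<in> component f \<Longrightarrow> adj h k \<Longrightarrow> k \<in> component f"
  by (auto simp: component_def)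

lemma component_sz: "h \<in> component f \<Longrightarrow> sz h = sz f"
  unfolding component_def mem_Collect_eq by (induction rule: rtranclp_induct) (auto simp: adj_sz)

lemma finite_component [simp]: "finite (component f)"
  by (rule finite_subset[OF _ finite_sz[of "sz f"]]) (auto simp: component_sz)

lemma adj_rtranclp_sym: "adj\<^sup>*\<^sup>* f h \<Longrightarrow> adj\<^sup>*\<^sup>* h f"
  using adj_sym by (metis rtranclp_converseD conversepI rtranclp_mono predicate2D rtranclp_converseI sympD sympI symp_rtranclp)

lemma component_eq: "h \<in> component f \<Longrightarrow> component h = component f"
  unfolding component_def by (auto intro: rtranclp_trans dest: adj_rtranclp_sym)

lemma deg_pos_component: "h \<in> component f \<Longrightarrow> 0 < deg f \<Longrightarrow> 0 < deg h"
  unfolding component_def mem_Collect_eq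
proof (induction rule: rtranclp_induct)
  case (step y z)
  then show ?case using adj_sym deg_pos_iff by blast
qed

text \<open>Each step of a walk starting at \<open>f\<close> lifts to a step that switches between
  the two states, so one of the two extensions of every member is reached.\<close>

lemma component_ins_cases:
  assumes "g \<le> 2 * sz f" "h \<in> component f"
  shows "ins g [lf, lf] h \<in> component (ins g [lf, lf] f) \<or> ins g [Node [lf]] h \<in> component (ins g [lf, lf] f)"
  using assms(2) unfolding component_def mem_Collect_eq
proof (induction rule: rtranclp_induct)
  case (step h k)
  have "h \<in> component f" using step.hyps by (simp add: component_def)
  then have sz: "sz h = sz f" "sz k = sz h" using component_sz adj_sz step.hyps by blast+
  have "adj (ins g [lf, lf] h) (ins g [Node [lf]] k)" "adj (ins g [Node [lf]] h) (ins g [lf, lf] k)"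
    using adj_ins[of h k "[lf, lf]" "[Node [lf]]" g] adj_ins[of h k "[Node [lf]]" "[lf, lf]" g]
      step.hyps(2) sz assms(1) adj_lf_lf adj_sym by simp_all
  then show ?case using step.IH rtranclp.rtrancl_into_rtrancl[of adj] by meson
qed simp

text \<open>The term \<open>deg (ins g [lf] s)\<close> counts the members that arise by splitting the leaf edge at \<open>g\<close>;
  they are not extensions of members of the component of \<open>f\<close>.\<close>

lemma card_component_ins:
  assumes "g \<le> 2 * sz f" "s \<in> component f" "ins g [lf, lf] s \<in> component (ins g [lf, lf] f)"
  shows "card (component f) + deg (ins g [lf] s) \<le> card (component (ins g [lf, lf] f))"
proof -
  let ?C = "component (ins g [lf, lf] f)"
  \<comment> \<open>Chooses for each member an extension within \<open>?C\<close>. Distinct members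
    keep distinct extensions even if different states are chosen, because \<open>ins_inj\<close>
    recovers the outer forest.\<close>
  define L where "L h = (if ins g [lf, lf] h \<in> ?C then ins g [lf, lf] h else ins g [Node [lf]] h)" for h
  let ?E = "ins (Suc g) [lf] ` nbrs (ins g [lf] s)"
  have gs: "g \<le> 2 * sz s" using assms(1) component_sz[OF assms(2)] by simp
  have "L ` component f \<subseteq> ?C" using component_ins_cases[OF assms(1)] by (auto simp: L_def)
  moreover have "?E \<subseteq> ?C"
    using adj_split[OF gs] component_step[OF assms(3)] by (auto simp: nbrs_def)
  moreover have "L ` component f \<inter> ?E = {}"
  proof -
    have False if "L h = ins (Suc g) [lf] z" "z \<in> nbrs (ins g [lf] s)" for h z
      using that split_not_ins[OF gs, of z h] by (auto simp: L_def nbrs_def split: if_splits)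
    then show ?thesis by blast
  qed
  moreover have "inj_on L (component f)"
  proof (rule inj_onI)
    fix h k assume hk: "h \<in> component f" "k \<in> component f" "L h = L k"
    have "g \<le> 2 * sz h" using assms(1) component_sz[OF hk(1)] by simp
    then have *: "h = k" if "ins g x h = ins g y k" "sz x = sz y" for x y using ins_inj that by blast
    from hk(3) show "h = k" by (auto simp: L_def split: if_splits intro: *)
  qed
  then have "card (L ` component f) = card (component f)" by (rule card_image)
  moreover have "card ?E = deg (ins g [lf] s)" unfolding deg_def
    by (rule card_image, rule inj_on_subset[OF inj_on_ins nbrs_subset]) (use gs in simp)
  ultimately show ?thesis
    using card_mono[OF finite_component, of "L ` component f \<union> ?E"] card_Un_disjoint[of "L ` component f" ?E] by simp
qed

lemma sz3_in_caterpillars: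
  assumes "sz f = 3" "0 < deg f"
  shows "f \<in> caterpillars"
proof -
  have "2 \<le> sz f" using assms(1) by simp
  then show ?thesis
  proof (cases rule: ins_cases)
    case (1 g h)
    then have "h = [lf]" "g \<le> 2" using assms(1) sz_eq_1[of h] by auto
    then have "f \<in> {[lf, lf, lf], [Node [lf, lf]]}"
      using 1(2) by (cases "g = 0"; cases "g = 1") auto
    then show ?thesis using caterpillarsI[OF limbs.leaf limbs.leaf] by auto
  next
    case (2 g h)
    then have "h = [lf]" using assms(1) sz_eq_1[of h] by auto
    then show ?thesis using 2 assms(2) deg_ins_B[OF 2(1)] deg_single by simp
  qed
qed

lemma card_component_ge:
  assumes "odd (sz f)" "3 \<le> sz f" "0 < deg f"
  shows "(sz f + 1) div 2 \<le> card (component f) \<and> (card (component f) = (sz f + 1) div 2 \<longrightarrow> component f \<inter> caterpillars \<noteq> {})"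
  using assms
proof (induction "sz f" arbitrary: f rule: less_induct)
  case less
  show ?case
  proof (cases "sz f = 3")
    case True
    obtain h where h: "adj f h" using less.prems(3) by (auto simp: deg_pos_iff)
    have "f \<noteq> []" using True by auto
    then have "f \<noteq> h" using h adj_irrefl by blast
    then have "card {f, h} = 2" by simp
    moreover have "card {f, h} \<le> card (component f)"
      by (rule card_mono) (use h component_step[OF component_refl h] in auto)
    moreover have "component f \<inter> caterpillars \<noteq> {}" using sz3_in_caterpillars[OF True less.prems(3)] component_refl by blast
    ultimately show ?thesis using True by auto
  next
    case False
    then have "5 \<le> sz f" using less.prems by presburger
    then obtain g N where N: "g \<le> 2 * sz N" "0 < deg N" "sz f = sz N + 2" "adj\<^sup>*\<^sup>* f (ins g [lf, lf] N)"
      using peel[OF less.prems(1) _ less.prems(3)] by blast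
    let ?A = "ins g [lf, lf]" and ?B = "ins g [Node [lf]]"
    have C: "component f = component (?A N)" using component_eq[of "?A N" f] N(4) by (simp add: component_def)
    have oN: "odd (sz N)" "3 \<le> sz N" using N(3) \<open>5 \<le> sz f\<close> less.prems(1) by auto
    then have IH: "(sz N + 1) div 2 \<le> card (component N)"
      "card (component N) = (sz N + 1) div 2 \<Longrightarrow> component N \<inter> caterpillars \<noteq> {}"
      using less.hyps[of N] N by auto
    have pos: "0 < deg (ins g [lf] s)" if "s \<in> component N" for s
      by (rule deg_pos_even) (use that oN component_sz in simp)
    have big: "card (component N) + deg (ins g [lf] s) \<le> card (component f)" if "s \<in> component N" "?A s \<in> component f" for s
      using card_component_ins[OF N(1) that(1)] that(2) C by simp
    \<comment> \<open>The missing unit is supplied by \<open>pos\<close>: splitting always gives at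
      least one member.\<close>
    have l: "(sz f + 1) div 2 = (sz N + 1) div 2 + 1" using N(3) by simp
    have "?A N \<in> component f" using C by simp
    then have ge: "(sz f + 1) div 2 \<le> card (component f)"
      using big[of N] pos[of N] IH(1) l by simp
    moreover have "component f \<inter> caterpillars \<noteq> {}" if eq: "card (component f) = (sz f + 1) div 2"
    proof -
      \<comment> \<open>At equality the component has room for only one split member.\<close>
      have small: "\<not> 2 \<le> deg (ins g [lf] s)" if "s \<in> component N" "?A s \<in> component f" for s
        using big[OF that] eq IH(1) l by simp
      have "card (component N) = (sz N + 1) div 2"
        using big[of N] pos[of N] \<open>?A N \<in> component f\<close> eq IH(1) l by simp
      then obtain c where c: "c \<in> component N" "c \<in> caterpillars" using IH(2) by blast
      have szc: "sz c = sz N" using component_sz[OF c(1)] .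
      have *: "component f \<inter> caterpillars \<noteq> {}" if d: "d \<in> component N" "d \<in> caterpillars" "?A d \<in> component f" for d
      proof -
        have "g \<le> 2 * sz d" using component_sz[OF d(1)] N(1) by simp
        then have "?A d \<in> caterpillars" using caterpillar_ins[OF d(2)] small[OF d(1,3)] by blast
        then show ?thesis using d(3) by blast
      qed
      show ?thesis
      proof (cases "?A c \<in> component f")
        case True
        then show ?thesis using * c by blast
      next
        case False
        \<comment> \<open>If only the B-extension of the caterpillar is present, the A-extensions of
          all neighbours of \<open>c\<close> are, so one of these neighbours has to take the role of
          \<open>c\<close>.\<close>
        then have B: "?B c \<in> component f" using component_ins_cases[OF N(1) c(1)] C by simp
        have A: "m \<in> component N \<and> ?A m \<in> component f" if m: "adj c m" for m
        proof -
          have "adj (?B c) (?A m)"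
            using adj_ins[of c m "[Node [lf]]" "[lf, lf]" g] m adj_sz[OF m] szc N(1) adj_lf_lf adj_sym
            by simp
          then show ?thesis using component_step[OF B] component_step[OF c(1) m] by blast
        qed
        show ?thesis
        proof (cases "sz c = 3")
          \<comment> \<open>With three edges every non-isolated matching is a caterpillar, so any
            neighbour of \<open>c\<close> will do.\<close>
          case True
          obtain m where m: "adj c m" using deg_pos_component[OF c(1) N(2)] by (auto simp: deg_pos_iff)
          have "0 < deg m" using m adj_sym deg_pos_iff by blast
          then have "m \<in> caterpillars" using sz3_in_caterpillars adj_sz[OF m] True by simp
          then show ?thesis using * A[OF m] by blast
        next
          case False
          then have "5 \<le> sz c" using oN szc by presburger
          then obtain m where "adj c m" "2 \<le> deg (ins g [lf] m)"
            using caterpillar_nbr[OF c(2), of g] N(1) szc by auto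
          then show ?thesis using A small by blast
        qed
      qed
    qed
    ultimately show ?thesis by blast
  qed
qed

lemma component_caterpillar:
  assumes "c \<in> caterpillars"
  shows "component c = insert c (nbrs c)"
proof -
  have one: "k = c" if "adj c h" "adj h k" for h k
  proof -
    have "card (nbrs h) = 1" using caterpillar_star_centre[OF assms] that(1) by (simp add: star_centre_def deg_def)
    then obtain x where "nbrs h = {x}" by (auto simp: card_1_singleton_iff)
    then show ?thesis using that adj_sym[of c h] by (auto simp: nbrs_def set_eq_iff)
  qed
  have "h \<in> insert c (nbrs c)" if "adj\<^sup>*\<^sup>* c h" for h
    using that
  proof (induction rule: rtranclp_induct)
    case (step y z)
    then show ?case using one[of y z] by (auto simp: nbrs_def)
  qed simp
  then show ?thesis by (auto simp: component_def nbrs_def)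
qed

lemma card_component_caterpillar:
  assumes "c \<in> caterpillars"
  shows "card (component c) = (sz c + 1) div 2"
proof -
  have "c \<noteq> []" using caterpillar_sz(2)[OF assms] by auto
  then have "c \<notin> nbrs c" using adj_irrefl by (simp add: nbrs_def)
  then have "card (component c) = Suc (deg c)" using component_caterpillar[OF assms] by (simp add: deg_def)
  then show ?thesis
    using caterpillar_star_centre[OF assms] caterpillar_sz[OF assms] unfolding star_centre_def by presburger
qed

text \<open>The empty forest is listed separately: it is adjacent to itself, hence has degree 1 in a
  component of order 1.\<close>

lemma component_singleton_iff: "card (component f) = 1 \<longleftrightarrow> deg f = 0 \<or> f = []"
proof
  assume c: "card (component f) = 1"
  show "deg f = 0 \<or> f = []"
  proof (rule ccontr)
    assume a: "\<not> ?thesis"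
    then obtain h where h: "adj f h" using deg_pos_iff by auto
    then have "h \<noteq> f" using a adj_irrefl by blast
    then have "card {f, h} = 2" by simp
    moreover have "card {f, h} \<le> card (component f)"
      by (rule card_mono) (use h component_step[OF component_refl h] in auto)
    ultimately show False using c by simp
  qed
next
  assume "deg f = 0 \<or> f = []"
  then have stay: "h = f" if "adj f h" for h using that deg_eq_0_iff adj_Nil by auto
  have "h = f" if "adj\<^sup>*\<^sup>* f h" for h
    using that by (induction rule: rtranclp_induct) (auto dest: stay)
  then have "component f = {f}" by (auto simp: component_def)
  then show "card (component f) = 1" by simp
qed

section \<open>Counting\<close>

text \<open>A forest with \<open>ups\<close> value 1 has exactly one tree whose root is matched upwards, which leaves three
  forests of value 0; hence a nonempty forest of value 0 splits into four, as for quaternary trees.\<close>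

definition tuples :: "nat \<Rightarrow> nat \<Rightarrow> tree list list set" where
  "tuples r n = {fs. length fs = r \<and> (\<forall>f\<in>set fs. ups f = 0) \<and> sum_list (map sz fs) = 2 * n}"

lemma ups_1_split:
  assumes "ups f = 1"
  obtains a b c where "f = a @ Node b # c" "ups a = 0" "ups b = 0" "ups c = 0"
proof -
  have "\<exists>a b c. f = a @ Node b # c \<and> ups a = 0 \<and> ups b = 0 \<and> ups c = 0"
    using assms
  proof (induction f rule: sz.induct)
    case (2 ts us)
    consider "ups ts = 0" "ups us = 0" | "ups ts = 1" "ups us = 1"
      using "2.prems" by (auto split: if_splits)
    then show ?case
    proof cases
      case 1
      then show ?thesis by (intro exI[of _ "[]"] exI[of _ ts] exI[of _ us]) simp
    next
      case 2
      then obtain a b c where "us = a @ Node b # c" "ups a = 0" "ups b = 0" "ups c = 0"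
        using "2.IH"(2) by blast
      then show ?thesis using 2
        by (intro exI[of _ "Node ts # a"] exI[of _ b] exI[of _ c]) simp
    qed
  qed simp
  then show thesis using that by blast
qed

lemma ups_1_unique:
  assumes "a @ Node b # c = a' @ Node b' # c'" "ups a = 0" "ups b = 0" "ups a' = 0" "ups b' = 0"
  shows "a = a' \<and> b = b' \<and> c = c'"
  using assms
proof (induction a arbitrary: a')
  case Nil
  show ?case using Nil by (cases a') (auto split: if_splits)
next
  case (Cons t a)
  show ?case
  proof (cases a')
    case Nil
    then show ?thesis using Cons.prems by (auto split: if_splits)
  next
    case (Cons t' a'')
    have "ups a = 0" "ups a'' = 0" "a @ Node b # c = a'' @ Node b' # c'"
      using Cons.prems Cons by (cases t; auto split: if_splits)+
    then show ?thesis using Cons.IH[of a''] Cons.prems Cons by simp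
  qed
qed

lemma ups_join: "ups a = 0 \<Longrightarrow> ups b = 0 \<Longrightarrow> ups c = 0 \<Longrightarrow> ups (a @ Node b # c) = 1"
  by simp

text \<open>Builds a nonempty forest of \<open>ups\<close> value 0 from four such forests. Lists
  shorter than four are left alone and do not occur in \<open>tuples (r + 4) n\<close>.\<close>

fun join :: "tree list list \<Rightarrow> tree list list" where
  "join (a # b # c # d # fs) = (Node (a @ Node b # c) # d) # fs"
| "join fs = fs"

text \<open>The first forest is empty or a join of four. A join spends two edges, its root edge and
  the one matched upwards below it, so \<open>n\<close>, which counts pairs of edges, drops by
  one.\<close>

lemma tuples_Suc:
  "tuples (Suc r) n = Cons [] ` tuples r n \<union> (if n = 0 then {} else join ` tuples (r + 4) (n - 1))"
proof (intro equalityI subsetI)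
  fix gs assume gs: "gs \<in> tuples (Suc r) n"
  then obtain f fs where f: "gs = f # fs" by (cases gs) (auto simp: tuples_def)
  show "gs \<in> Cons [] ` tuples r n \<union> (if n = 0 then {} else join ` tuples (r + 4) (n - 1))"
  proof (cases f rule: sz.cases)
    case 1
    then have "gs \<in> Cons [] ` tuples r n" using gs f by (auto simp: tuples_def)
    then show ?thesis by blast
  next
    case (2 ts d)
    have u: "ups ts = 1" "ups d = 0" using gs f 2 by (auto simp: tuples_def split: if_splits)
    from u(1) obtain a b c where abc: "ts = a @ Node b # c" "ups a = 0" "ups b = 0" "ups c = 0"
      by (rule ups_1_split)
    have "n \<noteq> 0" "a # b # c # d # fs \<in> tuples (r + 4) (n - 1)"
      using gs f 2 abc u by (auto simp: tuples_def)
    moreover have "gs = join (a # b # c # d # fs)" using f 2 abc by simp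
    ultimately have "gs \<in> join ` tuples (r + 4) (n - 1)" by (metis imageI)
    then show ?thesis using \<open>n \<noteq> 0\<close> by simp
  qed
next
  fix gs assume "gs \<in> Cons [] ` tuples r n \<union> (if n = 0 then {} else join ` tuples (r + 4) (n - 1))"
  then consider fs where "gs = [] # fs" "fs \<in> tuples r n"
    | hs where "0 < n" "gs = join hs" "hs \<in> tuples (r + 4) (n - 1)"
    by (auto split: if_splits)
  then show "gs \<in> tuples (Suc r) n"
  proof cases
    case 1
    then show ?thesis by (auto simp: tuples_def)
  next
    case 2
    then obtain a b c d fs where hs: "hs = a # b # c # d # fs"
      by (cases hs rule: join.cases) (auto simp: tuples_def)
    then show ?thesis using 2 ups_join[of a b c] by (auto simp: tuples_def)
  qed
qed

lemma inj_on_join: "inj_on join (tuples (r + 4) n)"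
proof (rule inj_onI)
  fix fs hs assume *: "fs \<in> tuples (r + 4) n" "hs \<in> tuples (r + 4) n" "join fs = join hs"
  obtain a b c d fs' where f: "fs = a # b # c # d # fs'"
    using *(1) by (cases fs rule: join.cases) (auto simp: tuples_def)
  obtain a' b' c' d' hs' where h: "hs = a' # b' # c' # d' # hs'"
    using *(2) by (cases hs rule: join.cases) (auto simp: tuples_def)
  have "a = a' \<and> b = b' \<and> c = c'"
    by (rule ups_1_unique) (use * f h in \<open>auto simp: tuples_def\<close>)
  then show "fs = hs" using *(3) f h by simp
qed

lemma tuples_0: "tuples 0 n = (if n = 0 then {[]} else {})"
  by (auto simp: tuples_def)

text \<open>The Raney numbers \<open>r / (4*n + r) * (4*n + r choose n)\<close>, multiplied out to
  remain in \<open>nat\<close>. The induction on \<open>n\<close> is the outer one because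
  \<open>tuples_Suc\<close> raises \<open>r\<close> by 4 when it lowers \<open>n\<close>.\<close>

lemma card_tuples: "finite (tuples r n) \<and> (4 * n + r) * card (tuples r n) = (if r = 0 then 0 else r * ((4 * n + r) choose n))"
proof (induction n arbitrary: r rule: less_induct)
  case (less n)
  show ?case
  proof (induction r)
    case 0
    show ?case by (simp add: tuples_0)
  next
    case (Suc r)
    have inj: "card (Cons [] ` A) = card A" for A :: "tree list list set"
      by (rule card_image) simp
    show ?case
    proof (cases "n = 0")
      case True
      then show ?thesis using Suc tuples_Suc[of r n] inj[of "tuples r n"]
        by (cases "r = 0") (auto simp: tuples_0)
    next
      case False
      let ?T = "tuples r n" and ?U = "tuples (r + 4) (n - 1)"
      have U: "finite ?U" "(4 * (n - 1) + (r + 4)) * card ?U = (r + 4) * ((4 * (n - 1) + (r + 4)) choose (n - 1))"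
        using less.IH[of "n - 1" "r + 4"] False by auto
      have N: "4 * (n - 1) + (r + 4) = 4 * n + r" using False by simp
      have T: "finite ?T" "(4 * n + r) * card ?T = r * ((4 * n + r) choose n)"
        using Suc by (auto split: if_splits)
      have "hd (join hs) \<noteq> []" if "hs \<in> ?U" for hs
      proof -
        have "length hs = r + 4" using that by (simp add: tuples_def)
        then show ?thesis by (cases hs rule: join.cases) simp_all
      qed
      then have "[] # fs \<noteq> join hs" if "hs \<in> ?U" for fs hs using that by (metis list.sel(1))
      then have "Cons [] ` ?T \<inter> join ` ?U = {}" by blast
      then have c: "finite (tuples (Suc r) n)" "card (tuples (Suc r) n) = card ?T + card ?U"
        using tuples_Suc[of r n] False T(1) U(1) inj[of ?T] card_image[OF inj_on_join, of r "n - 1"]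
        by (simp_all add: card_Un_disjoint)
      define m where "m = 4 * n + r"
      have m: "0 < m" "n < m" using False by (auto simp: m_def)
      define A B where "A = (m choose n)" and "B = (m choose (n - 1))"
      have "n * A = (m + 1 - n) * B"
        using binomial_absorption[of "n - 1" m] binomial_absorb_comp[of m "n - 1"] False
        by (simp add: A_def B_def Suc_diff_le)
      then have AB: "n * (A + B) = (m + 1) * B"
        using m by (simp add: add_mult_distrib2 add_mult_distrib[symmetric] del: add_mult_distrib)
      have AB': "((m + 1) choose n) = A + B" using False by (cases n) (simp_all add: A_def B_def)
      have "m * card (tuples (Suc r) n) = r * A + (r + 4) * B"
        using T(2) U(2) unfolding N c(2) m_def[symmetric] A_def[symmetric] B_def[symmetric]
        by (simp add: add_mult_distrib2)
      \<comment> \<open>Multiplication by \<open>m + 1\<close> allows \<open>AB\<close> to replace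
        \<open>B\<close> by \<open>A + B\<close>, the binomial coefficient of the next row; then
        \<open>m\<close> cancels.\<close>
      then have "m * ((m + 1) * card (tuples (Suc r) n)) = (m + 1) * (r * A + (r + 4) * B)"
        by (metis mult.left_commute)
      also have "\<dots> = (m + 1) * r * (A + B) + 4 * ((m + 1) * B)" by (simp add: algebra_simps)
      also have "\<dots> = ((m + 1) * r + 4 * n) * (A + B)" unfolding AB[symmetric] by (simp add: algebra_simps)
      also have "\<dots> = m * ((r + 1) * (A + B))" by (simp add: m_def algebra_simps)
      finally have "(m + 1) * card (tuples (Suc r) n) = (r + 1) * (A + B)" using m(1) by simp
      then show ?thesis unfolding AB'[symmetric] using c(1) by (simp add: m_def)
    qed
  qed
qed

text \<open>A forest with \<open>ups\<close> value 1 is a triple of forests with value 0, so this is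
  the case \<open>r = 3\<close>; absorption turns \<open>3 / (4*n + 3) * (4*n + 3 choose n)\<close>
  into the stated form.\<close>

lemma card_isolated:
  "real (card {f. sz f = 2 * Suc n - 1 \<and> ups f = 1}) = real ((4 * Suc n - 2) choose n) / real (Suc n)"
proof -
  let ?I = "{f. sz f = 2 * Suc n - 1 \<and> ups f = 1}"
  let ?j = "\<lambda>fs. fs ! 0 @ Node (fs ! 1) # fs ! 2"
  have triple: "\<exists>a b c. fs = [a, b, c]" if "fs \<in> tuples 3 n" for fs
  proof -
    have "length fs = Suc (Suc (Suc 0))" using that by (simp add: tuples_def)
    then show ?thesis by (auto simp: length_Suc_conv)
  qed
  have "bij_betw ?j (tuples 3 n) ?I"
    unfolding bij_betw_def
  proof
    show "inj_on ?j (tuples 3 n)"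
    proof (rule inj_onI)
      fix fs hs assume *: "fs \<in> tuples 3 n" "hs \<in> tuples 3 n" "?j fs = ?j hs"
      obtain a b c a' b' c' where e: "fs = [a, b, c]" "hs = [a', b', c']"
        using triple[OF *(1)] triple[OF *(2)] by blast
      have "a = a' \<and> b = b' \<and> c = c'"
        by (rule ups_1_unique) (use * e in \<open>auto simp: tuples_def\<close>)
      then show "fs = hs" using e by simp
    qed
    show "?j ` tuples 3 n = ?I"
    proof (intro equalityI subsetI)
      fix f assume "f \<in> ?j ` tuples 3 n"
      then obtain fs where fs: "fs \<in> tuples 3 n" "f = ?j fs" by blast
      obtain a b c where "fs = [a, b, c]" using triple[OF fs(1)] by blast
      then show "f \<in> ?I" using fs by (auto simp: tuples_def)
    next
      fix f assume f: "f \<in> ?I"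
      then have "ups f = 1" by simp
      then obtain a b c where abc: "f = a @ Node b # c" "ups a = 0" "ups b = 0" "ups c = 0"
        by (rule ups_1_split)
      then have "[a, b, c] \<in> tuples 3 n" using f by (auto simp: tuples_def)
      then show "f \<in> ?j ` tuples 3 n" using abc(1) by (intro image_eqI[of _ _ "[a, b, c]"]) simp_all
    qed
  qed
  then have I: "card ?I = card (tuples 3 n)" by (rule bij_betw_same_card[symmetric])
  define N where "N = 4 * n + 3"
  have "N * card (tuples 3 n) = 3 * (N choose n)"
    using card_tuples[of 3 n] by (simp add: N_def)
  then have "N * (Suc n * card (tuples 3 n)) = 3 * Suc n * (N choose n)"
    by (metis mult.assoc mult.left_commute)
  also have "3 * Suc n = N - n" by (simp add: N_def)
  also have "(N - n) * (N choose n) = N * (N - 1 choose n)" by (rule binomial_absorb_comp)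
  finally have "Suc n * card (tuples 3 n) = (4 * Suc n - 2 choose n)" by (simp add: N_def)
  from arg_cong[OF this, of real] have "real (Suc n) * real (card (tuples 3 n)) = real (4 * Suc n - 2 choose n)"
    by (simp only: of_nat_mult)
  moreover have "real (Suc n) \<noteq> 0" by simp
  note nonzero_eq_divide_eq[OF this, of "real (card (tuples 3 n))"]
  ultimately show ?thesis unfolding I by (simp only: mult.commute)
qed

section \<open>Counting limbs and caterpillars\<close>

definition limbs_of :: "nat \<Rightarrow> tree set" where
  "limbs_of a = {t \<in> limbs. sz [t] = 2 * a + 1}"

lemma limbs_of_0: "limbs_of 0 = {lf}"
proof -
  have "t = lf" if "sz [t] = 1" for t using that by (cases t) simp
  then show ?thesis using limbs.leaf by (auto simp: limbs_of_def)
qed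

lemma limbs_of_Suc: "limbs_of (Suc a) = (\<lambda>t. Node [lf, t]) ` limbs_of a \<union> (\<lambda>t. Node [t, lf]) ` limbs_of a"
proof (intro equalityI subsetI)
  fix t assume t: "t \<in> limbs_of (Suc a)"
  then have "t \<in> limbs" by (simp add: limbs_of_def)
  then show "t \<in> (\<lambda>t. Node [lf, t]) ` limbs_of a \<union> (\<lambda>t. Node [t, lf]) ` limbs_of a"
  proof cases
    case leaf
    then show ?thesis using t by (simp add: limbs_of_def)
  next
    case (left u)
    then have "u \<in> limbs_of a" using t by (simp add: limbs_of_def sz_pair)
    then show ?thesis using left by blast
  next
    case (right u)
    then have "u \<in> limbs_of a" using t by (simp add: limbs_of_def sz_pair)
    then show ?thesis using right by blast
  qed
qed (auto simp: limbs_of_def sz_pair intro: limbs.intros)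

lemma lf_in_limbs_of: "lf \<in> limbs_of a \<longleftrightarrow> a = 0"
  using limbs.leaf by (auto simp: limbs_of_def)

text \<open>The index counts the cubic vertices, each of which adds two edges. Each one offers the
  choice of \<open>left\<close> or \<open>right\<close>, except that the innermost gives
  \<open>Node [lf, lf]\<close> either way.\<close>

lemma card_limbs_of: "finite (limbs_of a) \<and> card (limbs_of a) = (if a = 0 then 1 else 2 ^ (a - 1))"
proof (induction a)
  case 0
  then show ?case by (simp add: limbs_of_0)
next
  case (Suc a)
  have inj: "card ((\<lambda>t. Node [lf, t]) ` A) = card A" "card ((\<lambda>t. Node [t, lf]) ` A) = card A" for A
    by (rule card_image, simp add: inj_on_def)+
  show ?case
  proof (cases "a = 0")
    case True
    then show ?thesis by (simp add: limbs_of_Suc limbs_of_0)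
  next
    case False
    then have "(\<lambda>t. Node [lf, t]) ` limbs_of a \<inter> (\<lambda>t. Node [t, lf]) ` limbs_of a = {}"
      using lf_in_limbs_of[of a] by auto
    then show ?thesis using Suc False inj by (cases a) (simp_all add: limbs_of_Suc card_Un_disjoint)
  qed
qed

text \<open>The four root positions overlap when a limb is a leaf. Hence pairs of limbs are sorted
  into \<open>Q\<close> (neither is a leaf), \<open>L\<close> (the first is) and \<open>R\<close>
  (the second is).\<close>

lemma card_caterpillars:
  assumes "1 \<le> s"
  shows "card {c \<in> caterpillars. sz c = 2 * s + 3} = (2 * s + 3) * 2 ^ (s - 1)"
proof -
  define Q where "Q = (\<Union>a\<in>{1..<s}. limbs_of a \<times> limbs_of (s - a))"
  define L R where "L = {lf} \<times> limbs_of s" and "R = limbs_of s \<times> {lf}"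
  have nlf: "lf \<notin> limbs_of s" using lf_in_limbs_of[of s] assms by simp
  have fin: "finite (limbs_of a)" and c: "card (limbs_of a) = (if a = 0 then 1 else 2 ^ (a - 1))" for a
    using card_limbs_of by blast+
  have finQ: "finite Q" "finite L" "finite R" using fin by (auto simp: Q_def L_def R_def)
  have cs: "card L = 2 ^ (s - 1)" "card R = 2 ^ (s - 1)"
    using c[of s] assms by (simp_all add: L_def R_def card_cartesian_product)
  have "card Q = (\<Sum>a\<in>{1..<s}. card (limbs_of a \<times> limbs_of (s - a)))"
    unfolding Q_def by (rule card_UN_disjoint) (use fin in \<open>auto simp: limbs_of_def\<close>)
  also have "\<dots> = (\<Sum>a\<in>{1..<s}. 2 ^ (s - 2))"
  proof (rule sum.cong)
    fix a assume a: "a \<in> {1..<s}"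
    then have "card (limbs_of a \<times> limbs_of (s - a)) = 2 ^ (a - 1) * 2 ^ (s - a - 1)"
      using c[of a] c[of "s - a"] by (simp add: card_cartesian_product)
    also have "\<dots> = 2 ^ (s - 2)" using a by (simp add: power_add[symmetric])
    finally show "card (limbs_of a \<times> limbs_of (s - a)) = 2 ^ (s - 2)" .
  qed simp
  finally have cQ: "card Q = (s - 1) * 2 ^ (s - 2)" by simp
  have Q: "(t, u) \<in> Q \<longleftrightarrow> t \<in> limbs \<and> u \<in> limbs \<and> sz [t] + sz [u] = 2 * s + 2 \<and> t \<noteq> lf \<and> u \<noteq> lf" for t u
  proof
    assume "(t, u) \<in> Q"
    then obtain a where "a \<in> {1..<s}" "t \<in> limbs_of a" "u \<in> limbs_of (s - a)" by (auto simp: Q_def)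
    moreover from this have "t \<noteq> lf" "u \<noteq> lf" using lf_in_limbs_of[of a] lf_in_limbs_of[of "s - a"] by auto
    ultimately show "t \<in> limbs \<and> u \<in> limbs \<and> sz [t] + sz [u] = 2 * s + 2 \<and> t \<noteq> lf \<and> u \<noteq> lf"
      by (auto simp: limbs_of_def)
  next
    assume a: "t \<in> limbs \<and> u \<in> limbs \<and> sz [t] + sz [u] = 2 * s + 2 \<and> t \<noteq> lf \<and> u \<noteq> lf"
    have "sz [w] \<noteq> 1" if "w \<noteq> lf" for w using that by (cases w) simp
    then have "sz [t] \<noteq> 1" "sz [u] \<noteq> 1" using a by blast+
    moreover have "odd (sz [t])" "odd (sz [u])" using a odd_sz_limb by blast+
    then obtain i j where ij: "sz [t] = 2 * i + 1" "sz [u] = 2 * j + 1" by (auto elim!: oddE)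
    ultimately have "i \<in> {1..<s}" "j = s - i" using a by auto
    moreover have "t \<in> limbs_of i" "u \<in> limbs_of j" using a ij by (simp_all add: limbs_of_def)
    ultimately show "(t, u) \<in> Q" by (auto simp: Q_def)
  qed
  have L: "(t, u) \<in> L \<longleftrightarrow> t = lf \<and> u \<in> limbs \<and> sz [t] + sz [u] = 2 * s + 2" for t u
    by (auto simp: L_def limbs_of_def)
  have R: "(t, u) \<in> R \<longleftrightarrow> u = lf \<and> t \<in> limbs \<and> sz [t] + sz [u] = 2 * s + 2" for t u
    by (auto simp: R_def limbs_of_def)
  have disj: "Q \<inter> L = {}" "Q \<inter> R = {}" "L \<inter> R = {}"
    using Q nlf by (auto simp: L_def R_def)
  let ?P = "Q \<union> L \<union> R"
  have P: "(t, u) \<in> ?P \<longleftrightarrow> t \<in> limbs \<and> u \<in> limbs \<and> sz [t] + sz [u] = 2 * s + 2" for t u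
    using Q[of t u] L[of t u] R[of t u] limbs.leaf by blast
  \<comment> \<open>Every forest is counted at its first possible form: \<open>[lf, lf, u]\<close>
    and \<open>[lf, u, lf]\<close> already belong to \<open>F1\<close>, and
    \<open>[t, lf, lf]\<close> to \<open>F2\<close>.\<close>
  define F1 F2 F3 F4 where "F1 = (\<lambda>(t, u). [lf, t, u]) ` ?P" and "F2 = (\<lambda>(t, u). [t, lf, u]) ` (Q \<union> R)"
    and "F3 = (\<lambda>(t, u). [t, u, lf]) ` Q" and "F4 = (\<lambda>(t, u). [Node [t, u]]) ` ?P"
  have "{c \<in> caterpillars. sz c = 2 * s + 3} = F1 \<union> F2 \<union> F3 \<union> F4"
  proof (intro equalityI subsetI)
    fix f assume f: "f \<in> {c \<in> caterpillars. sz c = 2 * s + 3}"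
    then obtain t u where tu: "t \<in> limbs" "u \<in> limbs"
      and c: "f \<in> {[lf, t, u], [t, lf, u], [t, u, lf], [Node [t, u]]}"
      unfolding caterpillars_def by blast
    have "sz f = Suc (sz [t] + sz [u])" using c by (auto simp: sz_pair sz_triple)
    then have s: "sz [t] + sz [u] = 2 * s + 2" using f by simp
    then have tuP: "(t, u) \<in> ?P" "(u, t) \<in> ?P" using P tu by auto
    have F1: "[lf, a, b] \<in> F1" if "(a, b) \<in> ?P" for a b using that unfolding F1_def by force
    have F2: "[a, lf, b] \<in> F1 \<union> F2" if "(a, b) \<in> ?P" for a b
    proof (cases "a = lf")
      case True
      then show ?thesis using F1[of lf b] that by simp
    next
      case False
      then have "(a, b) \<in> Q \<union> R" using that by (auto simp: L_def)
      then show ?thesis unfolding F2_def by force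
    qed
    have F3: "[a, b, lf] \<in> F1 \<union> F2 \<union> F3" if ab: "(a, b) \<in> ?P" for a b
    proof -
      have ba: "(b, a) \<in> ?P" using ab P[of a b] P[of b a] by (simp add: add.commute)
      consider "a = lf" | "b = lf" | "a \<noteq> lf" "b \<noteq> lf" by blast
      then show ?thesis
      proof cases
        case 1
        then show ?thesis using F1[OF ba] by simp
      next
        case 2
        then show ?thesis using F2[OF ab] by simp
      next
        case 3
        then have "(a, b) \<in> Q" using ab by (auto simp: L_def R_def)
        then show ?thesis unfolding F3_def by force
      qed
    qed
    have F4: "[Node [a, b]] \<in> F4" if "(a, b) \<in> ?P" for a b using that unfolding F4_def by force
    from c show "f \<in> F1 \<union> F2 \<union> F3 \<union> F4" using F1 F2 F3 F4 tuP by blast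
  next
    fix f assume "f \<in> F1 \<union> F2 \<union> F3 \<union> F4"
    then obtain p where "p \<in> ?P" "f = (\<lambda>(t, u). [lf, t, u]) p \<or> f = (\<lambda>(t, u). [t, lf, u]) p \<or>
        f = (\<lambda>(t, u). [t, u, lf]) p \<or> f = (\<lambda>(t, u). [Node [t, u]]) p"
      unfolding F1_def F2_def F3_def F4_def by blast
    then obtain t u where tu: "(t, u) \<in> ?P" and c: "f \<in> {[lf, t, u], [t, lf, u], [t, u, lf], [Node [t, u]]}"
      by (cases p) auto
    have "sz f = Suc (sz [t] + sz [u])" using c by (auto simp: sz_pair sz_triple)
    then show "f \<in> {c \<in> caterpillars. sz c = 2 * s + 3}" using tu c P[of t u] caterpillarsI[of t u] by auto
  qed
  moreover have "F1 \<inter> F2 = {}" "(F1 \<union> F2) \<inter> F3 = {}" "(F1 \<union> F2 \<union> F3) \<inter> F4 = {}"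
    using Q R nlf by (auto simp: F1_def F2_def F3_def F4_def R_def)
  moreover have "card F1 = card ?P" "card F2 = card (Q \<union> R)" "card F3 = card Q" "card F4 = card ?P"
    unfolding F1_def F2_def F3_def F4_def by (rule card_image; auto simp: inj_on_def)+
  moreover have "finite F1" "finite F2" "finite F3" "finite F4"
    using finQ by (simp_all add: F1_def F2_def F3_def F4_def)
  moreover have "card ?P = card Q + 2 * 2 ^ (s - 1)" "card (Q \<union> R) = card Q + 2 ^ (s - 1)"
    using disj finQ cs by (simp_all add: card_Un_disjoint Int_Un_distrib2)
  \<comment> \<open>\<open>Q\<close> enters four times, once per form; the pairs with a leaf enter
    twice in \<open>F1\<close>, once in \<open>F2\<close> and twice in \<open>F4\<close>.\<close>
  ultimately have "card {c \<in> caterpillars. sz c = 2 * s + 3} = 4 * card Q + 5 * 2 ^ (s - 1)"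
    by (simp add: card_Un_disjoint)
  also have "\<dots> = (2 * s + 3) * 2 ^ (s - 1)"
  proof (cases "s = 1")
    case True
    then show ?thesis using cQ by simp
  next
    case False
    then obtain r where "s = Suc (Suc r)" using assms by (metis One_nat_def Suc_le_D not0_implies_Suc)
    then show ?thesis using cQ by (simp add: algebra_simps)
  qed
  finally show ?thesis .
qed

section \<open>Transfer to the graph of matchings\<close>

lemma dcm_component_mat:
  assumes "sz f = k"
  shows "dcm_component k (mat 0 f) = mat 0 ` component f"
proof (intro equalityI subsetI)
  fix M assume "M \<in> dcm_component k (mat 0 f)"
  then have "(dcm_adj k)\<^sup>*\<^sup>* (mat 0 f) M" by (simp add: dcm_component_def)
  then show "M \<in> mat 0 ` component f"
  proof (induction rule: rtranclp_induct)
    case (step M N)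
    then obtain h where h: "h \<in> component f" "M = mat 0 h" by blast
    have "N \<in> matchings k" using step.hyps(2) by (simp add: dcm_adj_def matchings_def)
    then obtain n where n: "sz n = k" "N = mat 0 n" using bij_betw_mat[of k] by (auto simp: bij_betw_def)
    have "adj h n" using step.hyps(2) dcm_adj_mat[of h k n] component_sz[OF h(1)] assms h(2) n by simp
    then show ?case using component_step[OF h(1)] n(2) by blast
  qed simp
next
  fix M assume "M \<in> mat 0 ` component f"
  then obtain h where h: "adj\<^sup>*\<^sup>* f h" "M = mat 0 h" by (auto simp: component_def)
  from h(1) have "(dcm_adj k)\<^sup>*\<^sup>* (mat 0 f) (mat 0 h)"
  proof (induction rule: rtranclp_induct)
    case (step y z)
    have "sz y = k" using step.hyps(1) component_sz[of y f] assms by (simp add: component_def)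
    then have "dcm_adj k (mat 0 y) (mat 0 z)"
      using dcm_adj_mat[of y k z] step.hyps(2) adj_sz[OF step.hyps(2)] by simp
    then show ?case using step.IH by (rule rtranclp.rtrancl_into_rtrancl[rotated])
  qed simp
  then show "M \<in> dcm_component k (mat 0 f)" using h(2) by (simp add: dcm_component_def)
qed

lemma dcm_components_mat: "dcm_components k = (\<lambda>f. mat 0 ` component f) ` {f. sz f = k}"
proof -
  have "dcm_components k = dcm_component k ` mat 0 ` {f. sz f = k}"
    using bij_betw_mat[of k] by (simp add: dcm_components_def bij_betw_def)
  also have "\<dots> = (\<lambda>f. mat 0 ` component f) ` {f. sz f = k}"
    unfolding image_image by (rule image_cong) (auto simp: dcm_component_mat)
  finally show ?thesis .
qed

lemma inj_mat: "inj (mat 0)"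
  by (rule injI) (rule mat_inj)

lemma card_mat_image [simp]: "card (mat 0 ` A) = card A"
  by (rule card_image) (rule inj_on_subset[OF inj_mat subset_UNIV])

lemma is_star_caterpillar:
  assumes "c \<in> caterpillars" "sz c = k"
  shows "is_star k (mat 0 ` component c) ((k - 1) div 2)"
  unfolding is_star_def
proof (intro conjI bexI[of _ "mat 0 c"] ballI)
  show "card (mat 0 ` component c) = (k - 1) div 2 + 1"
    using card_component_caterpillar[OF assms(1)] caterpillar_sz[OF assms(1)] unfolding assms(2) card_mat_image by presburger
  show "mat 0 c \<in> mat 0 ` component c" by simp
  have nb: "\<exists>h. x = mat 0 h \<and> adj c h" if "x \<in> mat 0 ` component c - {mat 0 c}" for x
    using that component_caterpillar[OF assms(1)] by (auto simp: nbrs_def)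
  fix x assume "x \<in> mat 0 ` component c - {mat 0 c}"
  then obtain h where h: "x = mat 0 h" "adj c h" using nb by blast
  have szh: "sz h = k" using adj_sz[OF h(2)] assms(2) by simp
  show "dcm_adj k (mat 0 c) x" using dcm_adj_mat[of c k h] assms(2) szh h by simp
  fix y assume "y \<in> mat 0 ` component c - {mat 0 c}"
  then obtain i where i: "y = mat 0 i" "adj c i" using nb by blast
  have szi: "sz i = k" using adj_sz[OF i(2)] assms(2) by simp
  have "card (nbrs h) = 1" using caterpillar_star_centre[OF assms(1)] h(2) by (simp add: star_centre_def deg_def)
  then obtain w where "nbrs h = {w}" by (auto simp: card_1_singleton_iff)
  moreover have "c \<in> nbrs h" using h(2) adj_sym by (simp add: nbrs_def)
  ultimately have h1: "nbrs h = {c}" by simp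
  have ne: "c \<noteq> []" using caterpillar_sz(2)[OF assms(1)] by auto
  have "\<not> adj h i"
  proof
    assume "adj h i"
    then have "i = c" using h1 by (simp add: nbrs_def set_eq_iff)
    then show False using i(2) adj_irrefl[OF ne] by simp
  qed
  then show "\<not> dcm_adj k x y" using dcm_adj_mat[of h k i] szh szi h i by simp
qed

theorem theorem2:
  fixes k l :: nat
  assumes "odd k" and "l = nat \<lceil>real k / 2\<rceil>"
  shows "Min (card ` dcm_components k) = 1
       \<and> real (card {C \<in> dcm_components k. card C = 1})
           = real ((4*l - 2) choose (l - 1)) / real l
       \<and> (k \<ge> 3 \<longrightarrow>
           (card ` dcm_components k - {1} \<noteq> {}
            \<and> Min (card ` dcm_components k - {1}) = l
            \<and> (\<forall>C\<in>dcm_components k. card C = Min (card ` dcm_components k - {1})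
                 \<longrightarrow> is_star k C (l - 1))))
       \<and> (k \<ge> 5 \<longrightarrow>
           card {C \<in> dcm_components k. card C = Min (card ` dcm_components k - {1})}
             = (2*l - 1) * 2^(l - 3))"
proof -
  obtain n where k: "k = 2 * n + 1" using assms(1) by (auto elim: oddE)
  have "real k / 2 = real n + 1 / 2" by (simp add: k field_simps)
  then have "\<lceil>real k / 2\<rceil> = int n + 1" by (simp add: ceiling_eq_iff)
  then have l: "l = Suc n" using assms(2) by simp
  let ?D = "\<lambda>f. mat 0 ` component f"
  let ?S = "card ` dcm_components k"
  have S: "?S = (\<lambda>f. card (component f)) ` {f. sz f = k}" by (simp add: dcm_components_mat image_image)
  have finS: "finite ?S" using finite_sz[of k] by (simp add: S)
  have iso: "card (component f) = 1 \<longleftrightarrow> ups f = 1" if "sz f = k" for f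
    using component_singleton_iff[of f] deg_eq_0_iff_ups[of f] that k by auto
  have pos: "1 \<le> card (component f)" for f
    using card_mono[of "component f" "{f}"] by simp

  have "{C \<in> dcm_components k. card C = 1} = (\<lambda>f. {mat 0 f}) ` {f. sz f = 2 * Suc n - 1 \<and> ups f = 1}"
  proof -
    have "component f = {f}" if f: "sz f = k" "ups f = 1" for f
    proof -
      have "card (component f) = 1" using iso[OF f(1)] f(2) by simp
      then obtain h where "component f = {h}" by (rule card_1_singletonE)
      then show ?thesis using component_refl[of f] by simp
    qed
    then have D: "?D f = {mat 0 f}" if "sz f = k" "ups f = 1" for f using that by simp
    have "{C \<in> dcm_components k. card C = 1} = ?D ` {f. sz f = k \<and> ups f = 1}"
      using iso by (auto simp: dcm_components_mat)
    also have "\<dots> = (\<lambda>f. {mat 0 f}) ` {f. sz f = k \<and> ups f = 1}"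
      by (rule image_cong) (use D in auto)
    finally show ?thesis by (simp add: k)
  qed
  moreover have "inj_on (\<lambda>f. {mat 0 f}) A" for A using inj_mat by (auto simp: inj_on_def)
  ultimately have cI: "card {C \<in> dcm_components k. card C = 1}
      = card {f. sz f = 2 * Suc n - 1 \<and> ups f = 1}"
    by (simp add: card_image)
  then have c1: "real (card {C \<in> dcm_components k. card C = 1}) = real ((4*l - 2) choose (l - 1)) / real l"
    using card_isolated[of n] l by simp
  \<comment> \<open>Positivity of the count shows that the order 1 is attained.\<close>
  have "0 < (4*l - 2) choose (l - 1)" using l by (simp add: zero_less_binomial_iff)
  then have "0 < real (card {C \<in> dcm_components k. card C = 1})" unfolding c1 using l by simp
  then have "{C \<in> dcm_components k. card C = 1} \<noteq> {}" by (metis card.empty less_irrefl of_nat_0)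
  then have "1 \<in> ?S" by force
  moreover have "1 \<le> x" if "x \<in> ?S" for x using that pos unfolding S by blast
  ultimately have m1: "Min ?S = 1" using Min_eqI[OF finS, of 1] by blast

  have main: "card ` dcm_components k - {1} \<noteq> {} \<and> Min (card ` dcm_components k - {1}) = l" if "3 \<le> k"
  proof -
    \<comment> \<open>A limb with \<open>n - 1\<close> cubic vertices completes
      \<open>[lf, lf, t]\<close> to a caterpillar with \<open>k\<close> edges, so the order
      \<open>l\<close> is attained.\<close>
    have "card (limbs_of (n - 1)) \<noteq> 0" using card_limbs_of[of "n - 1"] by simp
    then obtain t where "t \<in> limbs_of (n - 1)" by fastforce
    then have t: "t \<in> limbs" "sz [t] = 2 * (n - 1) + 1" by (simp_all add: limbs_of_def)
    have c: "[lf, lf, t] \<in> caterpillars" "sz [lf, lf, t] = k"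
      using caterpillarsI(1)[OF limbs.leaf t(1)] t(2) that k by (simp_all add: sz_triple)
    have "card (component [lf, lf, t]) = l" using card_component_caterpillar[OF c(1)] c(2) k l by simp
    then have "l \<in> ?S" using c(2) unfolding S by blast
    then have lS: "l \<in> ?S - {1}" using l that k by simp
    moreover have "l \<le> x" if x: "x \<in> ?S - {1}" for x
    proof -
      obtain f where f: "sz f = k" "x = card (component f)" "card (component f) \<noteq> 1" using x by (auto simp: S)
      have "0 < deg f" using f component_singleton_iff[of f] by auto
      then show ?thesis using card_component_ge[of f] f \<open>3 \<le> k\<close> k l by simp
    qed
    ultimately show ?thesis using Min_eqI[of "?S - {1}" l] finS by blast
  qed
  have centre: "\<exists>c\<in>caterpillars. sz c = k \<and> C = ?D c" if C: "C \<in> dcm_components k" "card C = l" "3 \<le> k" for C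
  proof -
    obtain f where f: "sz f = k" "C = ?D f" using C(1) by (auto simp: dcm_components_mat)
    then have cf: "card (component f) = l" using C(2) by simp
    have "0 < deg f" using cf component_singleton_iff[of f] l C(3) k by auto
    then have "component f \<inter> caterpillars \<noteq> {}" using card_component_ge[of f] f(1) cf C(3) k l by simp
    then obtain c where "c \<in> component f" "c \<in> caterpillars" by blast
    then show ?thesis using component_eq[of c f] component_sz[of c f] f by auto
  qed
  have star: "is_star k C (l - 1)" if "C \<in> dcm_components k" "card C = l" "3 \<le> k" for C
    using centre[OF that] is_star_caterpillar[of _ k] k l by auto
  have count: "card {C \<in> dcm_components k. card C = l} = (2*l - 1) * 2^(l - 3)" if "5 \<le> k"
  proof -
    have n: "2 \<le> n" using that k by simp
    have "{C \<in> dcm_components k. card C = l} = ?D ` {c \<in> caterpillars. sz c = k}"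
    proof (intro equalityI subsetI)
      fix C assume "C \<in> {C \<in> dcm_components k. card C = l}"
      then show "C \<in> ?D ` {c \<in> caterpillars. sz c = k}" using centre[of C] that by auto
    next
      fix C assume "C \<in> ?D ` {c \<in> caterpillars. sz c = k}"
      then obtain c where c: "c \<in> caterpillars" "sz c = k" "C = ?D c" by blast
      then show "C \<in> {C \<in> dcm_components k. card C = l}"
        using card_component_caterpillar[OF c(1)] k l by (auto simp: dcm_components_mat)
    qed
    \<comment> \<open>Each star has only one caterpillar: the other members have degree 1, but a
      caterpillar has degree \<open>n\<close>, which is at least 2 since \<open>5 \<le> k\<close>.
      For \<open>k = 3\<close> both ends of the single edge are caterpillars.\<close>
    moreover have "inj_on ?D {c \<in> caterpillars. sz c = k}"
    proof (rule inj_onI)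
      fix c d assume cd: "c \<in> {c \<in> caterpillars. sz c = k}" "d \<in> {c \<in> caterpillars. sz c = k}" "?D c = ?D d"
      have "component c = component d" by (rule inj_image_eq_iff[OF inj_mat, THEN iffD1, OF cd(3)])
      then have "d \<in> insert c (nbrs c)" using component_caterpillar[of c] component_refl[of d] cd(1) by blast
      moreover have "d \<notin> nbrs c"
      proof
        assume "d \<in> nbrs c"
        then have "deg d = 1" using caterpillar_star_centre[of c] cd(1) by (simp add: star_centre_def nbrs_def)
        moreover have "deg d = n" using caterpillar_star_centre[of d] cd(2) k by (simp add: star_centre_def)
        ultimately show False using n by simp
      qed
      ultimately show "c = d" by blast
    qed
    ultimately have "card {C \<in> dcm_components k. card C = l} = card {c \<in> caterpillars. sz c = k}"
      by (simp add: card_image)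
    also have "k = 2 * (n - 1) + 3" using k n by simp
    then have "card {c \<in> caterpillars. sz c = k} = (2 * (n - 1) + 3) * 2 ^ (n - 1 - 1)"
      using card_caterpillars[of "n - 1"] n by simp
    also have "\<dots> = (2*l - 1) * 2^(l - 3)" 
    proof -
      have "2 * (n - 1) + 3 = 2*l - 1" "n - 1 - 1 = l - 3" using l n by auto
      then show ?thesis by (simp only:)
    qed
    finally show ?thesis .
  qed
  show ?thesis
  proof (intro conjI impI ballI)
    fix C assume "3 \<le> k" "C \<in> dcm_components k" "card C = Min (card ` dcm_components k - {1})"
    then show "is_star k C (l - 1)" using star main by simp
  next
    assume "5 \<le> k"
    then show "card {C \<in> dcm_components k. card C = Min (card ` dcm_components k - {1})} = (2*l - 1) * 2^(l - 3)"
      using count main by simp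
  qed (use m1 c1 main in blast)+
qed

end
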